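(* Let $\nu$ be a finite (complex) Borel measure on $\mathbb{T}$ and suppose that the Cauchy integral $$\mathcal{C}_\nu(z)=\int_{\mathbb{T}}\frac{1}{1-\overline{x}z}\,d\nu(x)=\sum_{n\ge0}\nu_n z^n,\quad z\in\mathbb{D},$$ satisfies $\sup_{n\ge0}|\nu_n|e^{c\sqrt n}<\infty$ for some $c>0$. Then $\nu$ is absolutely continuous with respect to $m$, $d\nu=g\,dm$ with $g\in L^1(\mathbb{T})$, and there exists an open set $U\subset\mathbb{T}$ which differs from $\{x\in\mathbb{T}:|g(x)|>0\}$ only by a set of $m$-measure zero, with the property that for each $x\in U$ there is an arc $I\subset U$ containing $x$ such that $\int_I\log|g|\,dm>-\infty$.
   Context: $\mathbb{D}$ is the open unit disk, $\mathbb{T}$ the unit circle, $m$ normalized arc-length measure on $\mathbb{T}$. The $\nu_n$ are the Fourier coefficients $\nu_n=\int_{\mathbb{T}}\overline{x}^n\,d\nu(x)$, $n\ge0$. *)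

theory Defs
  imports "HOL-Analysis.Analysis"
begin

abbreviation circle :: "complex set" where
  "circle \<equiv> sphere 0 1"

definition arc_measure :: "complex measure" where
  "arc_measure = distr (restrict_space lborel {0..<1}) borel (\<lambda>t. cis (2 * pi * t))"

definition finite_circle_measure :: "complex measure \<Rightarrow> bool" where
  "finite_circle_measure M \<longleftrightarrow>
     sets M = sets borel \<and> finite_measure M \<and> emeasure M (- circle) = 0"

text \<open>A finite complex Borel measure on T is represented by its Jordan decomposition
  nu = (mu1 - mu2) + i (mu3 - mu4) with mu1,...,mu4 finite positive Borel
  measures on T (every finite complex measure has such a decomposition).\<close>
definition cmeas_val ::
  "complex measure \<Rightarrow> complex measure \<Rightarrow> complex measure \<Rightarrow> complex measure \<Rightarrow> complex set \<Rightarrow> complex" where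
  "cmeas_val \<mu>1 \<mu>2 \<mu>3 \<mu>4 A =
     complex_of_real (measure \<mu>1 A - measure \<mu>2 A) + \<i> * complex_of_real (measure \<mu>3 A - measure \<mu>4 A)"

definition cmeas_integral ::
  "complex measure \<Rightarrow> complex measure \<Rightarrow> complex measure \<Rightarrow> complex measure \<Rightarrow> (complex \<Rightarrow> complex) \<Rightarrow> complex" where
  "cmeas_integral \<mu>1 \<mu>2 \<mu>3 \<mu>4 f =
     (integral\<^sup>L \<mu>1 f - integral\<^sup>L \<mu>2 f) + \<i> * (integral\<^sup>L \<mu>3 f - integral\<^sup>L \<mu>4 f)"

definition fourier_coeff ::
  "complex measure \<Rightarrow> complex measure \<Rightarrow> complex measure \<Rightarrow> complex measure \<Rightarrow> nat \<Rightarrow> complex" where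
  "fourier_coeff \<mu>1 \<mu>2 \<mu>3 \<mu>4 n = cmeas_integral \<mu>1 \<mu>2 \<mu>3 \<mu>4 (\<lambda>x. cnj x ^ n)"

definition open_arc :: "complex set \<Rightarrow> bool" where
  "open_arc I \<longleftrightarrow> (\<exists>a b. a < b \<and> b - a < 2 * pi \<and> I = (\<lambda>t. cis t) ` {a<..<b})"

end

theory Submission
  imports Defs "HOL-Complex_Analysis.Complex_Analysis" "HOL-Real_Asymp.Real_Asymp"
begin

text \<open>
  Let \<open>\<phi>\<close> be a bounded function on the circle and \<open>h\<close> the outer function with \<open>\<bar>h\<bar> = exp \<phi>\<close> on the
  circle. If \<open>\<bar>h z\<bar> \<le> exp (\<delta> / (1 - \<bar>z\<bar>))\<close> in the disk, then the Taylor coefficients of \<open>h\<close> are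
  \<open>O(exp (3 * sqrt (\<delta> * n)))\<close>, so \<open>h\<close> may be paired with a measure \<open>\<nu>\<close> as in the theorem once \<open>\<delta>\<close> is
  small. Hence, if outer functions \<open>h n\<close> with \<open>\<delta> n \<rightarrow> 0\<close> tend to 1 in the disk, tend to 0 in
  \<open>L\<^sup>1(\<bar>\<nu>\<bar>)\<close> on a set \<open>Z\<close> and to 1 off \<open>Z\<close>, then \<open>\<nu>\<close> vanishes on \<open>Z\<close>.

  For a null set \<open>Z\<close> one takes \<open>\<phi> = - n\<close> on a very small neighbourhood of \<open>Z\<close> and \<open>\<phi> = 0\<close> elsewhere;
  this gives absolute continuity, \<open>\<nu> = g m\<close>. Let now \<open>U\<close> be the union of all arcs on which \<open>ln \<bar>g\<bar>\<close> is
  integrable, and \<open>Z\<close> its complement. Cut the circle into \<open>N\<close> equal arcs. On an arc that meets \<open>Z\<close>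
  the integral of \<open>ln \<bar>g\<bar>\<close> diverges, which leaves room for a function \<open>\<phi>\<close> of mean zero over the arc
  with \<open>exp \<phi> * \<bar>g\<bar> \<le> exp (- A) * max \<bar>g\<bar> 1\<close> and \<open>L\<^sup>1\<close> norm at most \<open>2 * A / N\<close>; on the other arcs
  \<open>\<phi> = 0\<close>. As \<open>\<phi>\<close> has mean zero over every arc, its Herglotz integral is controlled by \<open>A / N\<close> times
  the total variation of the kernel, so \<open>\<delta>\<close> is of order \<open>A / N\<close>. Letting \<open>A \<rightarrow> \<infinity>\<close> and \<open>A / N \<rightarrow> 0\<close> gives
  \<open>g = 0\<close> on \<open>Z\<close>. The radial dilation \<open>h (r * z)\<close> replaces \<open>h\<close> throughout, so that no boundary values of
  analytic functions are needed.
\<close>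

section \<open>Uniqueness of Fourier coefficients\<close>

text \<open>The square root in the hypothesis comes from Cauchy's estimate: if \<open>h\<close> is
  bounded by \<open>exp (\<delta> / (1 - s))\<close> on the circle of radius
  \<open>s = 1 - t\<close>, its coefficients are at most about
  \<open>exp (\<delta> / t + 2 * t * n)\<close>, and the best choice
  \<open>t = sqrt (\<delta> / n)\<close> balances the two terms. The decay of \<nu> therefore beats
  the growth of \<open>h\<close> only if \<delta> is below a fixed multiple of \<open>c\<close>
  squared. The obstacle is that \<phi> may have total mass of order \<open>A\<close>, and the crude
  bound of the Herglotz integral by \<open>A / (1 - \<bar>z\<bar>)\<close> is useless as
  \<open>A\<close> grows. The kernel has supremum and total variation of the same order
  \<open>1 / (1 - \<bar>z\<bar>)\<close>, so replacing its size by its oscillation on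
  \<open>N\<close> arcs gains a full factor \<open>1 / N\<close>. A second obstacle is that \<phi>
  takes large positive values where \<open>g\<close> is small, so the outer functions have no common
  bound on the circle; all dominations are made for products with \<open>\<bar>g\<bar>\<close>. The
  known coefficients integrate powers of \<open>cnj x\<close>, hence analytic functions are
  evaluated at \<open>cnj x\<close> throughout.\<close>

lemma finite_circle_measureD:
  assumes "finite_circle_measure M"
  shows "sets M = sets borel" "space M = UNIV" "finite_measure M" "AE x in M. cmod x = 1"
proof -
  show s: "sets M = sets borel" and "finite_measure M"
    using assms by (auto simp: finite_circle_measure_def)
  show "space M = UNIV" using sets_eq_imp_space_eq[OF s] by simp
  have "- circle \<in> null_sets M"
    using assms by (auto simp: finite_circle_measure_def null_sets_def)
  then show "AE x in M. cmod x = 1"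
    by (rule AE_I') (auto simp: sphere_def)
qed

lemma integrable_mult_bounded_on_circle:
  fixes f q :: "complex \<Rightarrow> complex"
  assumes M: "finite_circle_measure M" and q: "integrable M q"
    and f[measurable]: "f \<in> borel_measurable borel"
    and b: "\<And>x. cmod x = 1 \<Longrightarrow> cmod (f x) \<le> B"
  shows "integrable M (\<lambda>x. f x * q x)"
proof -
  note [measurable_cong] = finite_circle_measureD(1)[OF M]
  have [measurable]: "q \<in> borel_measurable M" using q by auto
  have "integrable M (\<lambda>x. B * cmod (q x))" using q by simp
  then show ?thesis
  proof (rule Bochner_Integration.integrable_bound)
    show "AE x in M. cmod (f x * q x) \<le> norm (B * cmod (q x))"
      using finite_circle_measureD(4)[OF M]
    proof eventually_elim
      case (elim x)
      have "cmod (f x) * cmod (q x) \<le> B * cmod (q x)"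
        using b[OF elim] by (intro mult_right_mono) auto
      then show ?case by (simp add: norm_mult)
    qed
  qed simp
qed

lemma borel_measurable_power_int[measurable]:
  "(\<lambda>x::complex. x powi k) \<in> borel_measurable borel"
  unfolding power_int_def by (cases "k \<ge> 0") simp_all

lemma cnj_eq_inverse: "cmod x = 1 \<Longrightarrow> cnj x = inverse x"
  by (metis complex_norm_square inverse_unique mult.commute of_real_1 one_power2)

lemma cnj_power_eq_power_int: "cmod x = 1 \<Longrightarrow> cnj x ^ n = x powi (- int n)"
  by (simp add: cnj_eq_inverse power_int_minus power_inverse)

text \<open>On the circle a real linear function is a combination of \<open>x\<close> and
  \<open>inverse x\<close>, so multiplying by it shifts exponents by one in either direction.
  Products are reached because \<open>q\<close> varies in the induction. This turns vanishing
  Fourier coefficients into vanishing integrals against all polynomials, the input for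
  Stone-Weierstrass.\<close>

lemma real_polynomial_mult_preserves_zero_fourier:
  fixes p :: "complex \<Rightarrow> real" and q :: "complex \<Rightarrow> complex"
  assumes M: "finite_circle_measure M" and p: "real_polynomial_function p"
    and q: "integrable M q" and z: "\<And>k. (\<integral>x. x powi k * q x \<partial>M) = 0"
  shows "integrable M (\<lambda>x. of_real (p x) * q x) \<and> (\<forall>k. (\<integral>x. x powi k * (of_real (p x) * q x) \<partial>M) = 0)"
  using p q z
proof (induction arbitrary: q rule: real_polynomial_function.induct)
  case (linear f)
  note [measurable_cong] = finite_circle_measureD(1)[OF M]
  have [measurable]: "q \<in> borel_measurable M" using linear(2) by auto
  have i: "integrable M (\<lambda>x. x powi k * q x)" for k
    using linear(2) by (rule integrable_mult_bounded_on_circle[OF M, of _ _ 1]) (auto simp: norm_power_int)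
  \<comment> \<open>The number \<open>a\<close> is chosen so that
    \<open>2 * Re (a * x) = f x\<close>.\<close>
  define a where "a = Complex (f 1) (- f \<i>) / 2"
  have fx: "complex_of_real (f x) = a * x + cnj a * cnj x" for x
  proof -
    have "x = Re x *\<^sub>R 1 + Im x *\<^sub>R \<i>" by (simp add: complex_eq_iff)
    then have "f x = f (Re x *\<^sub>R 1 + Im x *\<^sub>R \<i>)" by (rule arg_cong)
    also have "\<dots> = Re x * f 1 + Im x * f \<i>"
      using bounded_linear.linear[OF linear.hyps] by (simp only: linear_add linear_scale real_scaleR_def)
    finally have "f x = Re x * f 1 + Im x * f \<i>" .
    then show ?thesis by (simp add: a_def complex_eq_iff field_simps)
  qed
  have eq: "AE x in M. x powi k * (of_real (f x) * q x) = a * (x powi (k+1) * q x) + cnj a * (x powi (k-1) * q x)" for k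
    using finite_circle_measureD(4)[OF M]
  proof eventually_elim
    case (elim x)
    then have "x \<noteq> 0" by auto
    then show ?case
      by (simp add: fx cnj_eq_inverse[OF elim] power_int_add power_int_diff field_simps)
  qed
  have [measurable]: "f \<in> borel_measurable borel"
    using linear.hyps by (intro borel_measurable_continuous_onI linear_continuous_on)
  obtain B where B: "\<And>x. norm (f x) \<le> norm x * B" using linear.hyps bounded_linear.bounded by blast
  have I: "integrable M (\<lambda>x. of_real (f x) * q x)"
    using linear(2) by (rule integrable_mult_bounded_on_circle[OF M, of _ _ B]) (use B in \<open>auto, metis mult_1\<close>)
  moreover have "(\<integral>x. x powi k * (of_real (f x) * q x) \<partial>M) = 0" for k
  proof -
    have "(\<integral>x. x powi k * (of_real (f x) * q x) \<partial>M) = (\<integral>x. a * (x powi (k+1) * q x) + cnj a * (x powi (k-1) * q x) \<partial>M)"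
      by (rule integral_cong_AE[OF _ _ eq]) auto
    also have "\<dots> = 0" using i linear(3) by (simp add: Bochner_Integration.integral_add)
    finally show ?thesis .
  qed
  ultimately show ?case by blast
next
  case (const c)
  then show ?case by (simp add: mult.left_commute)
next
  case (add f g)
  note f = add.IH(1)[OF add.prems] and g = add.IH(2)[OF add.prems]
  have i: "integrable M (\<lambda>x. x powi k * u x)" if "integrable M u" for u :: "complex \<Rightarrow> complex" and k
    using that by (rule integrable_mult_bounded_on_circle[OF M, of _ _ 1]) (auto simp: norm_power_int)
  show ?case using f g by (auto simp: distrib_left distrib_right Bochner_Integration.integral_add i)
next
  case (mult f g)
  note g = mult.IH(2)[OF mult.prems]
  have f: "integrable M (\<lambda>x. of_real (f x) * (of_real (g x) * q x)) \<and> (\<forall>k. (\<integral>x. x powi k * (of_real (f x) * (of_real (g x) * q x)) \<partial>M) = 0)"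
    by (rule mult.IH(1)) (use g in auto)
  then show ?case by (simp add: mult.assoc)
qed

lemma AE_eq_0_if_set_integrals_0:
  fixes q :: "'a \<Rightarrow> complex"
  assumes q: "integrable M q" and z: "\<And>A. A \<in> sets M \<Longrightarrow> (\<integral>x. indicator A x *\<^sub>R q x \<partial>M) = 0"
  shows "AE x in M. q x = 0"
proof -
  have *: "AE x in M. u x \<le> 0" if u: "integrable M u" "\<And>A. A \<in> sets M \<Longrightarrow> (\<integral>x. indicator A x * u x \<partial>M) = 0"
    for u :: "'a \<Rightarrow> real"
  proof -
    have [measurable]: "u \<in> borel_measurable M" using u(1) by auto
    define A where "A = {x \<in> space M. u x > 0}"
    have [measurable]: "A \<in> sets M" by (simp add: A_def)
    have "integrable M (\<lambda>x. indicator A x * u x)"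
      using integrable_mult_indicator[OF \<open>A \<in> sets M\<close> u(1)] by simp
    moreover have "(\<integral>x. indicator A x * u x \<partial>M) = 0" using u(2) by simp
    moreover have "AE x in M. 0 \<le> indicator A x * u x" by (auto simp: A_def indicator_def)
    ultimately have "AE x in M. indicator A x * u x = 0"
      using integral_nonneg_eq_0_iff_AE by blast
    moreover have "AE x in M. x \<in> space M" by simp
    ultimately show ?thesis by eventually_elim (auto simp: A_def indicator_def split: if_splits)
  qed
  have i: "integrable M (\<lambda>x. indicator A x *\<^sub>R q x)" if "A \<in> sets M" for A
    using integrable_mult_indicator[OF that q] .
  have Re: "(\<integral>x. indicator A x * Re (q x) \<partial>M) = 0" if "A \<in> sets M" for A
    using integral_Re[OF i[OF that]] z[OF that] by simp
  have Im: "(\<integral>x. indicator A x * Im (q x) \<partial>M) = 0" if "A \<in> sets M" for A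
    using integral_Im[OF i[OF that]] z[OF that] by simp
  have "AE x in M. Re (q x) \<le> 0" "AE x in M. - Re (q x) \<le> 0" "AE x in M. Im (q x) \<le> 0" "AE x in M. - Im (q x) \<le> 0"
    by (intro *; use q Re Im in \<open>auto simp: integrable_Re integrable_Im\<close>)+
  then show ?thesis by eventually_elim (auto simp: complex_eq_iff)
qed

text \<open>Dynkin's argument: the closed sets are stable under intersection and generate the Borel
  sets, and the sets on which \<open>q\<close> integrates to zero are closed under complements and
  countable disjoint unions.\<close>

lemma integral_indicator_eq_0_if_closed:
  fixes q :: "complex \<Rightarrow> complex"
  assumes s: "sets M = sets borel" and q: "integrable M q"
    and z: "\<And>A. closed A \<Longrightarrow> (\<integral>x. indicator A x *\<^sub>R q x \<partial>M) = 0" and A: "A \<in> sets M"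
  shows "(\<integral>x. indicator A x *\<^sub>R q x \<partial>M) = 0"
proof -
  have sig: "sigma_sets UNIV {S::complex set. closed S} = sets M"
    unfolding s by (subst borel_eq_closed) (simp add: sets_measure_of)
  have Int_stable: "Int_stable {S::complex set. closed S}" by (auto simp: Int_stable_def)
  have "A \<in> sigma_sets UNIV {S::complex set. closed S}" using A sig by simp
  with Int_stable subset_UNIV[of "{S::complex set. closed S}", folded Pow_UNIV] show ?thesis
  proof (induction rule: sigma_sets_induct_disjoint)
    case (basic A) then show ?case using z by simp
  next
    case empty show ?case by simp
  next
    case (compl A)
    have Am: "A \<in> sets M" using compl.hyps sig by simp
    have "(\<integral>x. indicator (UNIV - A) x *\<^sub>R q x \<partial>M) = (\<integral>x. indicator UNIV x *\<^sub>R q x - indicator A x *\<^sub>R q x \<partial>M)"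
      by (intro Bochner_Integration.integral_cong) (auto simp: indicator_def)
    also have "\<dots> = 0" using integrable_mult_indicator[OF Am q] q compl z[of UNIV]
      by (subst Bochner_Integration.integral_diff) auto
    finally show ?case .
  next
    case (union A)
    have Am: "A i \<in> sets M" for i using union.hyps sig by auto
    have "(\<integral>x. indicator (\<Union>i. A i) x *\<^sub>R q x \<partial>M) = (LINT x:(\<Union>i. A i)|M. q x)"
      by (simp add: set_lebesgue_integral_def)
    also have "\<dots> = (\<Sum>i. (LINT x:(A i)|M. q x))"
    proof (rule lebesgue_integral_countable_add)
      show "set_integrable M (\<Union>i. A i) q"
        unfolding set_integrable_def using Am q by (intro integrable_mult_indicator) auto
    qed (use Am union in \<open>auto simp: disjoint_family_on_def\<close>)
    also have "\<dots> = 0" using union by (simp add: set_lebesgue_integral_def)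
    finally show ?case .
  qed
qed

text \<open>Polynomials approximate continuous functions uniformly on the circle, and continuous
  cut-offs decrease to indicators of closed sets, which determine a finite complex measure.\<close>

theorem fourier_uniqueness:
  fixes q :: "complex \<Rightarrow> complex"
  assumes M: "finite_circle_measure M" and q: "integrable M q"
    and z: "\<And>k. (\<integral>x. x powi k * q x \<partial>M) = 0"
  shows "AE x in M. q x = 0"
proof -
  note [measurable_cong] = finite_circle_measureD(1)[OF M]
  have [measurable]: "q \<in> borel_measurable M" using q by auto
  have cont: "(\<integral>x. of_real (f x) * q x \<partial>M) = 0" if f: "continuous_on UNIV f" for f :: "complex \<Rightarrow> real"
  proof -
    have [measurable]: "f \<in> borel_measurable borel" using f by (rule borel_measurable_continuous_onI)
    define Q where "Q = (\<integral>x. cmod (q x) \<partial>M)"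
    have bound: "cmod (\<integral>x. of_real (f x) * q x \<partial>M) \<le> e * Q" if e: "e > 0" for e
    proof -
      obtain p where p: "real_polynomial_function p" "\<And>x. x \<in> circle \<Longrightarrow> \<bar>f x - p x\<bar> < e"
        using Stone_Weierstrass_real_polynomial_function[of circle f e] f e continuous_on_subset compact_sphere by blast
      have [measurable]: "p \<in> borel_measurable borel"
        using p(1) by (intro borel_measurable_continuous_onI)
          (simp add: continuous_on_polymonial_function real_polynomial_function_eq)
      note pz = real_polynomial_mult_preserves_zero_fourier[OF M p(1) q z]
      have i: "integrable M (\<lambda>x. of_real (f x - p x) * q x)"
        using q by (rule integrable_mult_bounded_on_circle[OF M, of _ _ e])
          (use p(2) in \<open>auto simp: less_imp_le simp flip: of_real_diff\<close>)
      have "(\<integral>x. of_real (p x) * q x \<partial>M) = 0" using pz[THEN conjunct2, rule_format, of 0] by simp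
      moreover have "(\<integral>x. of_real (f x) * q x \<partial>M) = (\<integral>x. of_real (f x - p x) * q x + of_real (p x) * q x \<partial>M)"
        by (intro Bochner_Integration.integral_cong) (auto simp: algebra_simps)
      ultimately have "(\<integral>x. of_real (f x) * q x \<partial>M) = (\<integral>x. of_real (f x - p x) * q x \<partial>M)"
        using i pz by (simp add: Bochner_Integration.integral_add)
      also have "cmod \<dots> \<le> (\<integral>x. e * cmod (q x) \<partial>M)"
      proof (rule order_trans[OF integral_norm_bound], rule integral_mono_AE)
        show "AE x in M. cmod (of_real (f x - p x) * q x) \<le> e * cmod (q x)"
          using finite_circle_measureD(4)[OF M]
        proof eventually_elim
          case (elim x)
          then have "\<bar>f x - p x\<bar> \<le> e" using p(2)[of x] by simp
          then show ?case by (simp add: norm_mult mult_right_mono del: of_real_diff)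
        qed
      qed (use i q in auto)
      finally show ?thesis using q by (simp add: Q_def)
    qed
    have "((\<lambda>e. e * Q) \<longlongrightarrow> 0 * Q) (at_right 0)" by (intro tendsto_intros)
    moreover have "\<forall>\<^sub>F e in at_right 0. cmod (\<integral>x. of_real (f x) * q x \<partial>M) \<le> e * Q"
      using bound by (auto simp: eventually_at_right_field intro: exI[of _ 1])
    ultimately have "cmod (\<integral>x. of_real (f x) * q x \<partial>M) \<le> 0 * Q"
      by (intro tendsto_lowerbound) auto
    then show ?thesis by simp
  qed
  have closed: "(\<integral>x. indicator A x *\<^sub>R q x \<partial>M) = 0" if A: "closed A" for A
  \<comment> \<open>The empty set is split off because \<open>infdist x {} = 0\<close>, so that the
    cut-offs \<open>f n\<close> below would be identically 1. For nonempty \<open>A\<close> they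
    equal 1 on \<open>A\<close> and 0 at distance at least \<open>1 / n\<close> from it.\<close>
  proof (cases "A = {}")
    case False
    define f where "f n x = max 0 (1 - real n * infdist x A)" for n :: nat and x
    have fc: "continuous_on UNIV (f n)" for n unfolding f_def by (intro continuous_intros)
    then have [measurable]: "f n \<in> borel_measurable borel" for n by (rule borel_measurable_continuous_onI)
    have [measurable]: "A \<in> sets borel" using A by auto
    have "(\<lambda>n. (\<integral>x. of_real (f n x) * q x \<partial>M)) \<longlonglongrightarrow> (\<integral>x. indicator A x *\<^sub>R q x \<partial>M)"
    proof (rule integral_dominated_convergence[where w="\<lambda>x. cmod (q x)"])
      show "AE x in M. (\<lambda>n. of_real (f n x) * q x) \<longlonglongrightarrow> indicator A x *\<^sub>R q x"
      proof (intro always_eventually allI)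
        fix x
        have "(\<lambda>n. f n x) \<longlonglongrightarrow> indicator A x"
        proof (cases "x \<in> A")
          case True then show ?thesis by (simp add: f_def)
        next
          case nx: False
          then have d: "infdist x A > 0" using in_closed_iff_infdist_zero[OF A False, of x] infdist_nonneg[of x A] by linarith
          have "\<forall>\<^sub>F n in sequentially. f n x = 0"
            using eventually_ge_at_top[of "nat \<lceil>1 / infdist x A\<rceil>"]
          proof eventually_elim
            case (elim n)
            then have "1 / infdist x A \<le> real n" by linarith
            then show ?case using d by (simp add: f_def field_simps)
          qed
          then show ?thesis using nx by (simp add: tendsto_eventually)
        qed
        then have "(\<lambda>n. complex_of_real (f n x) * q x) \<longlonglongrightarrow> of_real (indicator A x) * q x" by (intro tendsto_intros)
        then show "(\<lambda>n. of_real (f n x) * q x) \<longlonglongrightarrow> indicator A x *\<^sub>R q x"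
          by (simp add: scaleR_conv_of_real)
      qed
      show "AE x in M. cmod (of_real (f n x) * q x) \<le> cmod (q x)" for n
        by (auto simp: f_def norm_mult infdist_nonneg intro!: mult_left_le_one_le)
    qed (use q in auto)
    moreover have "(\<integral>x. of_real (f n x) * q x \<partial>M) = 0" for n using cont[OF fc] .
    ultimately show ?thesis by (simp add: LIMSEQ_const_iff)
  qed simp
  show ?thesis
    using AE_eq_0_if_set_integrals_0[OF q]
      integral_indicator_eq_0_if_closed[OF finite_circle_measureD(1)[OF M] q closed] by blast
qed

section \<open>Annihilation by analytic functions\<close>

lemma borel_measurable_cnj[measurable]: "cnj \<in> borel_measurable borel"
  by (intro borel_measurable_continuous_onI continuous_intros)

lemma integrable_circle_power_int:
  fixes u :: "complex \<Rightarrow> complex"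
  assumes M: "finite_circle_measure M" and u: "integrable M u"
  shows "integrable M (\<lambda>x. x powi k * u x)"
  using u by (rule integrable_mult_bounded_on_circle[OF M, of _ _ 1]) (auto simp: norm_power_int)

text \<open>On the circle \<open>cnj x ^ j\<close> is \<open>x powi (- int j)\<close>, so
  multiplying the density by \<open>h (cnj x)\<close> only brings in coefficients with smaller
  exponents. For \<open>k \<le> 0\<close> these are exactly the coefficients whose decay is
  known.\<close>

lemma sums_integral_power_series:
  fixes u :: "complex \<Rightarrow> complex"
  assumes M: "finite_circle_measure M" and u: "integrable M u"
    and a: "summable (\<lambda>j. cmod (a j))"
    and h: "\<And>x. cmod x = 1 \<Longrightarrow> (\<lambda>j. a j * x ^ j) sums h x"
    and hm[measurable]: "h \<in> borel_measurable borel"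
  shows "integrable M (\<lambda>x. x powi k * (h (cnj x) * u x))"
    "(\<lambda>j. a j * (\<integral>x. x powi (k - int j) * u x \<partial>M)) sums (\<integral>x. x powi k * (h (cnj x) * u x) \<partial>M)"
proof -
  note [measurable_cong] = finite_circle_measureD(1)[OF M]
  have [measurable]: "u \<in> borel_measurable M" using u by auto
  let ?f = "\<lambda>j x. a j * (x powi (k - int j) * u x)"
  have i: "integrable M (?f j)" for j
    using integrable_circle_power_int[OF M u] by simp
  have n: "AE x in M. norm (?f j x) = cmod (a j) * cmod (u x)" for j
    using finite_circle_measureD(4)[OF M] by eventually_elim (simp add: norm_mult norm_power_int)
  have s1: "AE x in M. summable (\<lambda>j. norm (?f j x))"
    using finite_circle_measureD(4)[OF M]
    by eventually_elim (use a in \<open>simp add: norm_mult norm_power_int summable_mult2\<close>)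
  have "(\<integral>x. norm (?f j x) \<partial>M) = cmod (a j) * (\<integral>x. cmod (u x) \<partial>M)" for j
    using integral_cong_AE[OF _ _ n, of j] by simp
  then have s2: "summable (\<lambda>j. \<integral>x. norm (?f j x) \<partial>M)" using a by (simp add: summable_mult2)
  have eq: "AE x in M. (\<Sum>j. ?f j x) = x powi k * (h (cnj x) * u x)"
    using finite_circle_measureD(4)[OF M]
  proof eventually_elim
    case (elim x)
    then have "x \<noteq> 0" by auto
    have "(\<lambda>j. (x powi k * u x) * (a j * cnj x ^ j)) sums ((x powi k * u x) * h (cnj x))"
      by (intro sums_mult h) (use elim in simp)
    moreover have "(x powi k * u x) * (a j * cnj x ^ j) = ?f j x" for j
      using \<open>x \<noteq> 0\<close> by (simp add: cnj_power_eq_power_int[OF elim] power_int_diff power_int_minus field_simps)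
    ultimately have "(\<lambda>j. ?f j x) sums ((x powi k * u x) * h (cnj x))" by simp
    then show ?case using sums_unique by (fastforce simp: mult_ac)
  qed
  show int: "integrable M (\<lambda>x. x powi k * (h (cnj x) * u x))"
  proof (subst integrable_cong_AE[symmetric])
    show "integrable M (\<lambda>x. \<Sum>j. ?f j x)" using i s1 s2 by (rule integrable_suminf)
  qed (use eq in auto)
  have "(\<lambda>j. integral\<^sup>L M (?f j)) sums (\<integral>x. (\<Sum>j. ?f j x) \<partial>M)"
    using i s1 s2 by (rule sums_integral)
  also have "(\<integral>x. (\<Sum>j. ?f j x) \<partial>M) = (\<integral>x. x powi k * (h (cnj x) * u x) \<partial>M)"
    using eq by (intro integral_cong_AE) auto
  finally show "(\<lambda>j. a j * (\<integral>x. x powi (k - int j) * u x \<partial>M)) sums (\<integral>x. x powi k * (h (cnj x) * u x) \<partial>M)"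
    by simp
qed

lemma summable_exp_minus_sqrt:
  assumes "d > (0::real)"
  shows "summable (\<lambda>j::nat. exp (- d * sqrt (real j)))"
proof (rule summable_comparison_test_bigo)
  show "summable (\<lambda>n::nat. norm (1 / real n ^ 2))"
    using inverse_power_summable[of 2, where 'a=real] by (simp add: field_simps power_inverse)
  show "(\<lambda>j. exp (- d * sqrt (real j))) \<in> O(\<lambda>n. 1 / real n ^ 2)"
    using assms by real_asymp
qed

text \<open>The analytic functions \<open>h n\<close> tend to 1 inside the disk, and therefore pair with the measure
  \<open>q M\<close> as the constant 1 does; on the boundary they kill the part of \<open>q M\<close> on \<open>Z\<close>. So the
  restriction of \<open>q M\<close> to \<open>Z\<close> has vanishing Fourier coefficients of one sign; applying the \<open>h n\<close>
  to this restriction and using \<open>h n 0 \<rightarrow> 1\<close>, the remaining coefficients vanish one after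
  another.\<close>
theorem vanishing_on_annihilated_set:
  fixes q :: "complex \<Rightarrow> complex" and a :: "nat \<Rightarrow> nat \<Rightarrow> complex"
  assumes M: "finite_circle_measure M" and q: "integrable M q" and Z[measurable]: "Z \<in> sets borel"
    and decay: "\<And>k. cmod (\<integral>x. cnj x ^ k * q x \<partial>M) \<le> B * exp (- c * sqrt (real k))"
    and cc: "0 \<le> c'" "c' < c"
    and a_sum: "\<And>n. summable (\<lambda>j. cmod (a n j))"
    and h_sums: "\<And>n x. cmod x = 1 \<Longrightarrow> (\<lambda>j. a n j * x ^ j) sums h n x"
    and hm[measurable]: "\<And>n. h n \<in> borel_measurable borel"
    and a_bound: "\<And>n j. cmod (a n j) \<le> K * exp (c' * sqrt (real j))"
    and a_lim: "\<And>j. (\<lambda>n. a n j) \<longlonglongrightarrow> (if j = 0 then 1 else 0)"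
    and Zlim: "(\<lambda>n. \<integral>x. indicator Z x * (cmod (h n (cnj x)) * cmod (q x)) \<partial>M) \<longlonglongrightarrow> 0"
    and Zclim: "(\<lambda>n. \<integral>x. indicator (- Z) x * (cmod (h n (cnj x) - 1) * cmod (q x)) \<partial>M) \<longlonglongrightarrow> 0"
  shows "AE x in M. x \<in> Z \<longrightarrow> q x = 0"
proof -
  note [measurable_cong] = finite_circle_measureD(1)[OF M]
  note pow_int = integrable_circle_power_int[OF M]
  have [measurable]: "q \<in> borel_measurable M" using q by auto
  define u where "u x = indicator Z x *\<^sub>R q x" for x
  define v where "v x = indicator (- Z) x *\<^sub>R q x" for x
  have u: "integrable M u" and v: "integrable M v" unfolding u_def v_def
    by (intro integrable_mult_indicator q; measurable)+
  have [measurable]: "u \<in> borel_measurable M" "v \<in> borel_measurable M" using u v by auto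
  have quv: "q x = u x + v x" for x by (auto simp: u_def v_def indicator_def)
  have int_h: "integrable M (\<lambda>x. x powi k * (h n (cnj x) * w x))" if "integrable M w" for k n w
    using sums_integral_power_series(1)[OF M that a_sum h_sums hm] .
  have norm1: "AE x in M. cmod (x powi k) = 1" for k
    using finite_circle_measureD(4)[OF M] by eventually_elim (simp add: norm_power_int)
  have ulim: "(\<lambda>n. \<integral>x. x powi k * (h n (cnj x) * u x) \<partial>M) \<longlonglongrightarrow> 0" for k
  proof (rule Lim_null_comparison[OF _ Zlim], intro always_eventually allI)
    fix n
    have "cmod (\<integral>x. x powi k * (h n (cnj x) * u x) \<partial>M) \<le> (\<integral>x. cmod (x powi k * (h n (cnj x) * u x)) \<partial>M)"
      by (rule integral_norm_bound)
    also have "\<dots> = (\<integral>x. indicator Z x * (cmod (h n (cnj x)) * cmod (q x)) \<partial>M)"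
    proof (rule integral_cong_AE)
      show "AE x in M. cmod (x powi k * (h n (cnj x) * u x)) = indicator Z x * (cmod (h n (cnj x)) * cmod (q x))"
        using norm1[of k] by eventually_elim (simp add: norm_mult u_def)
    qed measurable
    finally show "cmod (\<integral>x. x powi k * (h n (cnj x) * u x) \<partial>M) \<le> (\<integral>x. indicator Z x * (cmod (h n (cnj x)) * cmod (q x)) \<partial>M)" .
  qed
  have vlim: "(\<lambda>n. \<integral>x. x powi k * (h n (cnj x) * v x) \<partial>M) \<longlonglongrightarrow> (\<integral>x. x powi k * v x \<partial>M)" for k
  proof (rule LIM_zero_cancel, rule Lim_null_comparison[OF _ Zclim], intro always_eventually allI)
    fix n
    have "(\<integral>x. x powi k * (h n (cnj x) * v x) \<partial>M) - (\<integral>x. x powi k * v x \<partial>M)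
        = (\<integral>x. x powi k * (h n (cnj x) * v x) - x powi k * v x \<partial>M)"
      using int_h[OF v] pow_int[OF v] by simp
    also have "cmod \<dots> \<le> (\<integral>x. cmod (x powi k * (h n (cnj x) * v x) - x powi k * v x) \<partial>M)"
      by (rule integral_norm_bound)
    also have "\<dots> = (\<integral>x. indicator (- Z) x * (cmod (h n (cnj x) - 1) * cmod (q x)) \<partial>M)"
    proof (intro integral_cong_AE)
      show "AE x in M. cmod (x powi k * (h n (cnj x) * v x) - x powi k * v x)
          = indicator (- Z) x * (cmod (h n (cnj x) - 1) * cmod (q x))"
        using norm1[of k]
      proof eventually_elim
        case (elim x)
        have "x powi k * (h n (cnj x) * v x) - x powi k * v x = x powi k * ((h n (cnj x) - 1) * v x)"
          by (simp add: algebra_simps)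
        then show ?case using elim by (simp add: norm_mult v_def)
      qed
    qed measurable
    finally show "cmod ((\<integral>x. x powi k * (h n (cnj x) * v x) \<partial>M) - (\<integral>x. x powi k * v x \<partial>M))
        \<le> (\<integral>x. indicator (- Z) x * (cmod (h n (cnj x) - 1) * cmod (q x)) \<partial>M)" .
  qed
  have nonpos: "(\<integral>x. x powi (- int k) * u x \<partial>M) = 0" for k
  proof -
    let ?\<nu> = "\<lambda>j. \<integral>x. cnj x ^ j * q x \<partial>M"
    have \<nu>: "?\<nu> j = (\<integral>x. x powi (- int j) * q x \<partial>M)" for j
      using finite_circle_measureD(4)[OF M]
      by (intro integral_cong_AE) (auto simp: cnj_power_eq_power_int elim!: eventually_mono)
    have B: "B \<ge> 0" and K: "K \<ge> 0"
      using order_trans[OF norm_ge_zero decay[of 0]] order_trans[OF norm_ge_zero a_bound[of 0 0]] by auto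
    \<comment> \<open>The part \<open>c'\<close> of the decay rate is spent on the growth of
      \<open>a n j\<close>. The remaining rate \<open>c - c'\<close> gives a summable majorant
      independent of \<open>n\<close>, which allows the limit in \<open>n\<close> to be taken inside
      the series.\<close>
    have bd: "norm (a n j * ?\<nu> (k + j)) \<le> K * B * exp (- (c - c') * sqrt (real j))" for n j
    proof -
      have "norm (a n j * ?\<nu> (k + j)) \<le> (K * exp (c' * sqrt (real j))) * (B * exp (- c * sqrt (real (k + j))))"
        unfolding norm_mult by (intro mult_mono a_bound decay) (use K in auto)
      also have "\<dots> \<le> (K * exp (c' * sqrt (real j))) * (B * exp (- c * sqrt (real j)))"
        using K B cc by (intro mult_left_mono) auto
      also have "\<dots> = K * B * exp (- (c - c') * sqrt (real j))"
        by (simp add: algebra_simps flip: exp_add)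
      finally show ?thesis .
    qed
    have "(\<lambda>n. \<Sum>j. a n j * ?\<nu> (k + j)) \<longlonglongrightarrow> (\<Sum>j. (if j = 0 then 1 else 0) * ?\<nu> (k + j))"
    proof (rule tannerys_theorem[THEN conjunct2, THEN conjunct2])
      show "summable (\<lambda>j. K * B * exp (- (c - c') * sqrt (real j)))"
        using cc by (intro summable_mult summable_exp_minus_sqrt) auto
      show "(\<lambda>n. a n j * ?\<nu> (k + j)) \<longlonglongrightarrow> (if j = 0 then 1 else 0) * ?\<nu> (k + j)" for j
        by (intro tendsto_mult a_lim tendsto_const)
      show "\<forall>\<^sub>F (j, n) in sequentially \<times>\<^sub>F sequentially. norm (a n j * ?\<nu> (k + j)) \<le> K * B * exp (- (c - c') * sqrt (real j))"
        using bd by (intro always_eventually) auto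
    qed simp
    moreover have "(\<Sum>j. a n j * ?\<nu> (k + j)) = (\<integral>x. x powi (- int k) * (h n (cnj x) * q x) \<partial>M)" for n
    proof -
      have "- int k - int j = - int (k + j)" for j by simp
      then show ?thesis
        using sums_unique[OF sums_integral_power_series(2)[OF M q a_sum h_sums hm, of n "- int k"]] by (simp only: \<nu>)
    qed
    moreover have "(\<Sum>j. (if j = 0 then 1 else 0) * ?\<nu> (k + j)) = ?\<nu> k"
      using suminf_finite[of "{0}" "\<lambda>j. (if j = 0 then 1 else 0) * ?\<nu> (k + j)"] by simp
    ultimately have "(\<lambda>n. \<integral>x. x powi (- int k) * (h n (cnj x) * q x) \<partial>M) \<longlonglongrightarrow> ?\<nu> k" by simp
    moreover have "(\<lambda>n. \<integral>x. x powi (- int k) * (h n (cnj x) * q x) \<partial>M) \<longlonglongrightarrow> 0 + (\<integral>x. x powi (- int k) * v x \<partial>M)"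
    proof -
      have "(\<integral>x. x powi (- int k) * (h n (cnj x) * q x) \<partial>M)
        = (\<integral>x. x powi (- int k) * (h n (cnj x) * u x) \<partial>M) + (\<integral>x. x powi (- int k) * (h n (cnj x) * v x) \<partial>M)" for n
        using int_h[OF u] int_h[OF v] by (simp add: quv distrib_left)
      then show ?thesis using tendsto_add[OF ulim vlim] by simp
    qed
    ultimately have "?\<nu> k = (\<integral>x. x powi (- int k) * v x \<partial>M)"
      using LIMSEQ_unique by fastforce
    moreover have "?\<nu> k = (\<integral>x. x powi (- int k) * u x \<partial>M) + (\<integral>x. x powi (- int k) * v x \<partial>M)"
      unfolding \<nu> using pow_int[OF u] pow_int[OF v] by (simp add: quv distrib_left)
    ultimately show ?thesis by simp
  qed
  have upto: "(\<integral>x. x powi k * u x \<partial>M) = 0" if "k \<le> int p" for k p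
    using that
  proof (induction p arbitrary: k)
    case 0
    then show ?case using nonpos[of "nat (- k)"] by simp
  next
    case (Suc p)
    show ?case
    proof (cases "k \<le> int p")
      case False
      \<comment> \<open>Here \<open>k = p + 1\<close>. The terms with \<open>j \<ge> 1\<close>
        contain exponents at most \<open>p\<close>, where the coefficients already vanish; only the
        constant term of \<open>h n\<close> survives, and it tends to 1.\<close>
      have eq: "(\<integral>x. x powi k * (h n (cnj x) * u x) \<partial>M) = a n 0 * (\<integral>x. x powi k * u x \<partial>M)" for n
      proof -
        have "(\<Sum>j. a n j * (\<integral>x. x powi (k - int j) * u x \<partial>M)) = (\<Sum>j\<in>{0}. a n j * (\<integral>x. x powi (k - int j) * u x \<partial>M))"
        proof (rule suminf_finite)
          fix j assume "j \<notin> {0::nat}"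
          then show "a n j * (\<integral>x. x powi (k - int j) * u x \<partial>M) = 0"
            using Suc.IH[of "k - int j"] Suc.prems by simp
        qed simp
        then show ?thesis
          using sums_unique[OF sums_integral_power_series(2)[OF M u a_sum h_sums hm, of n k]] by simp
      qed
      have "(\<lambda>n. a n 0 * (\<integral>x. x powi k * u x \<partial>M)) \<longlonglongrightarrow> 1 * (\<integral>x. x powi k * u x \<partial>M)"
        using a_lim[of 0] by (intro tendsto_intros) simp
      then show ?thesis using ulim[of k] LIMSEQ_unique by (fastforce simp: eq)
    qed (use Suc.IH in simp)
  qed
  have "(\<integral>x. x powi k * u x \<partial>M) = 0" for k
    using upto[of k "nat k"] by simp
  from fourier_uniqueness[OF M u this] show ?thesis
    by eventually_elim (auto simp: u_def)
qed

section \<open>Herglotz and Poisson integrals\<close>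

lemma measurable_cis_param[measurable]: "(\<lambda>t. cis (2 * pi * t)) \<in> borel_measurable borel"
  by (intro borel_measurable_continuous_onI continuous_intros)

lemma sets_arc_measure[simp, measurable_cong]: "sets arc_measure = sets borel"
  by (simp add: arc_measure_def)

lemma space_arc_measure[simp]: "space arc_measure = UNIV"
  by (simp add: arc_measure_def)

lemma
  fixes f :: "complex \<Rightarrow> 'b::{banach, second_countable_topology}"
  assumes f[measurable]: "f \<in> borel_measurable borel"
  shows integral_arc_measure:
      "integral\<^sup>L arc_measure f = (\<integral>t. indicator {0..<1} t *\<^sub>R f (cis (2 * pi * t)) \<partial>lborel)"
    and integrable_arc_measure:
      "integrable arc_measure f \<longleftrightarrow> integrable lborel (\<lambda>t. indicator {0..<1} t *\<^sub>R f (cis (2 * pi * t)))"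
proof -
  have m: "(\<lambda>t. cis (2 * pi * t)) \<in> measurable (restrict_space lborel {0..<1}) borel"
    by (rule measurable_restrict_space1) simp
  show "integral\<^sup>L arc_measure f = (\<integral>t. indicator {0..<1} t *\<^sub>R f (cis (2 * pi * t)) \<partial>lborel)"
    unfolding arc_measure_def by (subst integral_distr[OF m f]) (simp add: integral_restrict_space)
  show "integrable arc_measure f \<longleftrightarrow> integrable lborel (\<lambda>t. indicator {0..<1} t *\<^sub>R f (cis (2 * pi * t)))"
    unfolding arc_measure_def by (subst integrable_distr_eq[OF m f]) (simp add: integrable_restrict_space)
qed

lemma emeasure_arc_measure:
  assumes A[measurable]: "A \<in> sets borel"
  shows "emeasure arc_measure A = emeasure lborel ({t. cis (2 * pi * t) \<in> A} \<inter> {0..<1})"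
proof -
  have m: "(\<lambda>t. cis (2 * pi * t)) \<in> measurable (restrict_space lborel {0..<1}) borel"
    by (rule measurable_restrict_space1) simp
  show ?thesis
    unfolding arc_measure_def
    by (subst emeasure_distr[OF m A], subst emeasure_restrict_space)
       (auto simp: space_restrict_space intro!: arg_cong[where f="emeasure lborel"])
qed

lemma emeasure_arc_measure_UNIV[simp]: "emeasure arc_measure UNIV = 1"
  by (simp add: emeasure_arc_measure)

lemma measure_arc_measure_UNIV[simp]: "measure arc_measure UNIV = 1"
  by (simp add: measure_def)

interpretation arc_measure: finite_measure arc_measure
  by standard simp

lemma finite_circle_measure_arc_measure: "finite_circle_measure arc_measure"
  unfolding finite_circle_measure_def
  by (simp add: arc_measure.finite_measure_axioms emeasure_arc_measure)

lemma AE_arc_measure_circle: "AE y in arc_measure. cmod y = 1"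
  using finite_circle_measureD(4)[OF finite_circle_measure_arc_measure] .

lemma integral_arc_measure_power:
  "(\<integral>y. y ^ j \<partial>arc_measure) = (if j = 0 then 1 else 0 :: complex)"
proof (cases "j = 0")
  case True then show ?thesis by simp
next
  case False
  let ?F = "\<lambda>t. cis (2 * pi * real j * t) / (2 * pi * real j * \<i>)"
  have "(\<integral>y. y ^ j \<partial>arc_measure) = (\<integral>t. indicator {0..<1} t *\<^sub>R cis (2 * pi * t) ^ j \<partial>lborel)"
    by (subst integral_arc_measure) auto
  also have "\<dots> = (\<integral>t. indicator {0..1} t *\<^sub>R cis (2 * pi * real j * t) \<partial>lborel)"
  proof (rule integral_cong_AE)
    show "AE t in lborel. indicator {0..<1} t *\<^sub>R cis (2 * pi * t) ^ j = indicator {0..1} t *\<^sub>R cis (2 * pi * real j * t)"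
      using AE_lborel_singleton[of "1::real"]
      by eventually_elim (auto simp: indicator_def Complex.DeMoivre mult_ac)
    show "(\<lambda>t. indicat_real {0..1} t *\<^sub>R cis (2 * pi * real j * t)) \<in> borel_measurable lborel"
    proof -
      have [measurable]: "(\<lambda>t. cis (2 * pi * real j * t)) \<in> borel_measurable borel"
        by (intro borel_measurable_continuous_onI continuous_intros)
      show ?thesis by simp
    qed
  qed auto
  also have "\<dots> = ?F 1 - ?F 0"
    by (rule integral_FTC_Icc)
      (use False in \<open>auto intro!: derivative_eq_intros continuous_intros simp: scaleR_conv_of_real has_vector_derivative_def field_simps\<close>)
  also have "\<dots> = 0" using cis_multiple_2pi[of "real j"] by (simp add: mult_ac)
  finally show ?thesis using False by simp
qed

text \<open>The usual kernel \<open>(y + z) / (y - z)\<close> equals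
  \<open>(1 + z * cnj y) / (1 - z * cnj y)\<close> on the circle; here \<open>cnj y\<close> is
  replaced by \<open>y\<close>. Consequently the value at \<open>of_real r * cnj x\<close> has as
  real part the Poisson integral of \<phi> at \<open>r * x\<close>, and it recovers
  \<open>\<phi> x\<close> as \<open>r\<close> tends to 1.\<close>

definition herglotz :: "(complex \<Rightarrow> real) \<Rightarrow> complex \<Rightarrow> complex" where
  "herglotz \<phi> z = (\<integral>y. of_real (\<phi> y) * ((1 + z * y) / (1 - z * y)) \<partial>arc_measure)"

definition poisson :: "complex \<Rightarrow> complex \<Rightarrow> real" where
  "poisson z y = Re ((1 + z * y) / (1 - z * y))"

lemma poisson_eq:
  assumes "cmod y = 1"
  shows "poisson z y = (1 - (cmod z)\<^sup>2) / (cmod (1 - z * y))\<^sup>2"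
proof -
  have "Re ((1 + w) / (1 - w)) = (1 - (cmod w)\<^sup>2) / (cmod (1 - w))\<^sup>2" for w
    unfolding Re_divide cmod_power2 by (simp add: algebra_simps power2_eq_square)
  from this[of "z * y"] show ?thesis using assms by (simp add: poisson_def norm_mult)
qed

lemma poisson_nonneg: "cmod y = 1 \<Longrightarrow> cmod z < 1 \<Longrightarrow> 0 \<le> poisson z y"
  by (simp add: poisson_eq power_le_one)

lemma borel_measurable_poisson[measurable]: "poisson z \<in> borel_measurable borel"
  unfolding poisson_def by measurable

lemma one_minus_norm_le:
  fixes z y :: complex
  assumes "cmod y = 1" shows "1 - cmod z \<le> cmod (1 - z * y)"
  using norm_triangle_ineq2[of 1 "z * y"] assms by (simp add: norm_mult)

lemma herglotz_kernel_bound: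
  assumes "cmod y = 1" "cmod z < 1"
  shows "cmod ((1 + z * y) / (1 - z * y)) \<le> 2 / (1 - cmod z)"
proof -
  have "cmod (1 + z * y) \<le> 2"
    using norm_triangle_ineq[of 1 "z * y"] assms by (simp add: norm_mult)
  then show ?thesis unfolding norm_divide
    using one_minus_norm_le[OF assms(1), of z] assms by (intro frac_le) auto
qed

lemma integrable_herglotz:
  assumes \<phi>: "integrable arc_measure \<phi>" and z: "cmod z < 1"
  shows "integrable arc_measure (\<lambda>y. of_real (\<phi> y) * ((1 + z * y) / (1 - z * y)))"
proof -
  have "integrable arc_measure (\<lambda>y. ((1 + z * y) / (1 - z * y)) * of_real (\<phi> y))"
    by (rule integrable_mult_bounded_on_circle[OF finite_circle_measure_arc_measure, where B="2 / (1 - cmod z)"])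
      (use \<phi> herglotz_kernel_bound[OF _ z] in auto)
  then show ?thesis by (simp add: mult.commute)
qed

lemma Re_of_real_mult: "Re (of_real a * w) = a * Re w"
  by simp

lemma integrable_poisson:
  assumes \<phi>: "integrable arc_measure \<phi>" and z: "cmod z < 1"
  shows "integrable arc_measure (\<lambda>y. \<phi> y * poisson z y)"
  using integrable_Re[OF integrable_herglotz[OF assms]] by (simp add: poisson_def Re_of_real_mult del: times_divide_eq_right)

lemma Re_herglotz:
  assumes \<phi>: "integrable arc_measure \<phi>" and z: "cmod z < 1"
  shows "Re (herglotz \<phi> z) = (\<integral>y. \<phi> y * poisson z y \<partial>arc_measure)"
  using integral_Re[OF integrable_herglotz[OF assms]]
  by (simp add: herglotz_def poisson_def Re_of_real_mult del: times_divide_eq_right)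

text \<open>The kernel is \<open>1 + 2 * w + 2 * w ^ 2 + ...\<close> with \<open>w = z * y\<close>.
  The expansion yields both holomorphy and, for the constant function 1, the normalization of the
  Poisson kernel.\<close>

lemma herglotz_sums:
  assumes \<phi>: "integrable arc_measure \<phi>" and z: "cmod z < 1"
  shows "(\<lambda>j. ((if j = 0 then 1 else 2) * (\<integral>y. y ^ j * of_real (\<phi> y) \<partial>arc_measure)) * z ^ j) sums herglotz \<phi> z"
proof -
  let ?b = "\<lambda>j. if j = 0 then 1 else 2 :: complex"
  let ?f = "\<lambda>j y. (?b j * z ^ j) * (y ^ j * of_real (\<phi> y))"
  have [measurable]: "\<phi> \<in> borel_measurable borel" using \<phi> by (auto dest: borel_measurable_integrable)
  have ker: "(\<lambda>j. ?b j * w ^ j) sums ((1 + w) / (1 - w))" if "cmod w < 1" for w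
  proof -
    have "(\<lambda>j. 2 * w ^ j - (if j = 0 then 1 else 0)) sums (2 * (1 / (1 - w)) - 1)"
      by (intro sums_diff sums_mult geometric_sums that sums_If_finite_set[of "{0::nat}" "\<lambda>_. 1", simplified] )
    moreover have "2 * (1 / (1 - w)) - 1 = (1 + w) / (1 - w)"
    proof -
      have "1 - w \<noteq> 0" using that by auto
      then show ?thesis by (simp add: divide_simps)
    qed
    moreover have "(\<lambda>j. 2 * w ^ j - (if j = 0 then 1 else 0)) = (\<lambda>j. ?b j * w ^ j)" by auto
    ultimately show ?thesis by simp
  qed
  have i: "integrable arc_measure (?f j)" for j
    by (intro integrable_mult_right integrable_mult_bounded_on_circle[OF finite_circle_measure_arc_measure, where B=1])
      (use \<phi> in \<open>auto simp: norm_power\<close>)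
  have s: "summable (\<lambda>j. 2 * cmod z ^ j)" using z by (intro summable_mult summable_geometric) simp
  have sn: "summable (\<lambda>j. cmod (?b j * z ^ j))"
    by (rule summable_comparison_test'[OF s]) (auto simp: norm_mult norm_power)
  have n: "AE y in arc_measure. norm (?f j y) = cmod (?b j * z ^ j) * \<bar>\<phi> y\<bar>" for j
    using AE_arc_measure_circle by eventually_elim (simp add: norm_mult norm_power)
  have s1: "AE y in arc_measure. summable (\<lambda>j. norm (?f j y))"
    using AE_arc_measure_circle
  proof eventually_elim
    case (elim y)
    have "norm (?f j y) = cmod (?b j * z ^ j) * \<bar>\<phi> y\<bar>" for j using elim by (simp add: norm_mult norm_power)
    then show ?case using summable_mult2[OF sn] by simp
  qed
  have "(\<integral>y. norm (?f j y) \<partial>arc_measure) = cmod (?b j * z ^ j) * (\<integral>y. \<bar>\<phi> y\<bar> \<partial>arc_measure)" for j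
    using integral_cong_AE[OF _ _ n, of j] by simp
  then have s2: "summable (\<lambda>j. \<integral>y. norm (?f j y) \<partial>arc_measure)" using summable_mult2[OF sn] by simp
  have "(\<lambda>j. integral\<^sup>L arc_measure (?f j)) sums (\<integral>y. (\<Sum>j. ?f j y) \<partial>arc_measure)"
    using i s1 s2 by (rule sums_integral)
  also have "(\<integral>y. (\<Sum>j. ?f j y) \<partial>arc_measure) = herglotz \<phi> z"
    unfolding herglotz_def
  proof (rule integral_cong_AE)
    show "AE y in arc_measure. (\<Sum>j. ?f j y) = of_real (\<phi> y) * ((1 + z * y) / (1 - z * y))"
      using AE_arc_measure_circle
    proof eventually_elim
      case (elim y)
      have "(\<lambda>j. of_real (\<phi> y) * (?b j * (z * y) ^ j)) sums (of_real (\<phi> y) * ((1 + z * y) / (1 - z * y)))"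
        using elim z by (intro sums_mult ker) (simp add: norm_mult)
      moreover have "of_real (\<phi> y) * (?b j * (z * y) ^ j) = ?f j y" for j by (simp add: power_mult_distrib)
      ultimately have "(\<lambda>j. ?f j y) sums (of_real (\<phi> y) * ((1 + z * y) / (1 - z * y)))" by simp
      then show ?case by (rule sums_unique[symmetric])
    qed
  qed measurable
  also have "(\<lambda>j. integral\<^sup>L arc_measure (?f j))
      = (\<lambda>j. (?b j * (\<integral>y. y ^ j * of_real (\<phi> y) \<partial>arc_measure)) * z ^ j)"
    by (rule ext, subst integral_mult_right_zero) (simp only: mult_ac)
  finally show ?thesis .
qed

lemma herglotz_holomorphic:
  assumes "integrable arc_measure \<phi>"
  shows "herglotz \<phi> holomorphic_on ball 0 1"
  by (rule power_series_holomorphic[where a="\<lambda>j. (if j = 0 then 1 else 2) * (\<integral>y. y ^ j * of_real (\<phi> y) \<partial>arc_measure)"])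
    (use herglotz_sums[OF assms] in auto)

lemma integral_poisson:
  assumes z: "cmod z < 1"
  shows "(\<integral>y. poisson z y \<partial>arc_measure) = 1"
proof -
  have "(\<lambda>j. ((if j = 0 then 1 else 2) * (\<integral>y. y ^ j * of_real 1 \<partial>arc_measure)) * z ^ j) sums herglotz (\<lambda>_. 1) z"
    by (rule herglotz_sums) (use z in auto)
  moreover have "(\<lambda>j. ((if j = 0 then 1 else 2) * (\<integral>y. y ^ j * of_real 1 \<partial>arc_measure)) * z ^ j) = (\<lambda>j. if j = 0 then 1 else 0)"
    by (auto simp: integral_arc_measure_power)
  ultimately have "herglotz (\<lambda>_. 1) z = 1"
    using sums_unique2 sums_If_finite_set[of "{0::nat}" "\<lambda>_. 1::complex"] by fastforce
  then show ?thesis using Re_herglotz[of "\<lambda>_. 1" z] z by simp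
qed

text \<open>The Poisson kernel is a probability density, so the real part is an average of \<phi>.
  This bounds the modulus of outer functions inside the disk.\<close>

lemma Re_herglotz_le:
  assumes \<phi>: "integrable arc_measure \<phi>" and z: "cmod z < 1" and T: "\<And>y. \<phi> y \<le> T"
  shows "Re (herglotz \<phi> z) \<le> T"
proof -
  have "Re (herglotz \<phi> z) \<le> (\<integral>y. T * poisson z y \<partial>arc_measure)"
    unfolding Re_herglotz[OF \<phi> z]
  proof (rule integral_mono_AE)
    show "AE y in arc_measure. \<phi> y * poisson z y \<le> T * poisson z y"
      using AE_arc_measure_circle by eventually_elim (use T z in \<open>auto intro!: mult_right_mono poisson_nonneg\<close>)
  qed (use \<phi> z integrable_poisson integrable_poisson[of "\<lambda>_. T"] in auto)
  also have "\<dots> = T" using integral_poisson[OF z] by simp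
  finally show ?thesis .
qed

lemma borel_measurable_herglotz[measurable]:
  assumes [measurable]: "\<phi> \<in> borel_measurable borel"
  shows "herglotz \<phi> \<in> borel_measurable borel"
  unfolding herglotz_def by measurable

text \<open>With \<open>z = of_real r * cnj x\<close>, both \<open>cmod (x - of_real r * y)\<close>
  and \<open>1 - r\<close> are at most \<open>cmod (1 - z * y)\<close>. The denominators of the
  kernels are thus bounded below away from \<open>x\<close>, uniformly in the radius.\<close>

lemma norm_diff_le_double_kernel:
  assumes x: "cmod x = 1" and y: "cmod y = 1" and r: "0 \<le> r" "r \<le> 1"
  shows "cmod (x - y) \<le> 2 * cmod (1 - (of_real r * cnj x) * y)"
proof -
  have xx: "x * cnj x = 1" using x complex_norm_square[of x] by simp
  have "x - of_real r * y = x * (1 - (of_real r * cnj x) * y)"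
    using xx by (simp add: algebra_simps)
  then have k: "cmod (x - of_real r * y) = cmod (1 - (of_real r * cnj x) * y)"
    using x by (simp add: norm_mult)
  have "cmod (of_real r * y - y) = 1 - r"
  proof -
    have "of_real r * y - y = of_real (r - 1) * y" by (simp add: algebra_simps)
    then have "cmod (of_real r * y - y) = \<bar>r - 1\<bar> * 1" using y by (simp only: norm_mult norm_of_real)
    then show ?thesis using r by simp
  qed
  moreover have "1 - r \<le> cmod (1 - (of_real r * cnj x) * y)"
    using one_minus_norm_le[OF y, of "of_real r * cnj x"] x r by (simp add: norm_mult)
  moreover have "cmod (x - y) \<le> cmod (x - of_real r * y) + cmod (of_real r * y - y)"
    using norm_triangle_ineq[of "x - of_real r * y" "of_real r * y - y"] by simp
  ultimately show ?thesis using k by linarith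
qed

text \<open>The two denominators are complex conjugates. The symmetry is what lets the kernel be
  integrated in \<open>x\<close> instead of \<open>y\<close>.\<close>

lemma poisson_symmetric:
  assumes x: "cmod x = 1" and y: "cmod y = 1"
  shows "poisson (of_real r * cnj x) y = poisson (of_real r * cnj y) x"
proof -
  have "cnj (1 - of_real r * cnj x * y) = 1 - of_real r * cnj y * x" by (simp add: mult_ac)
  then have "cmod (1 - of_real r * cnj x * y) = cmod (1 - of_real r * cnj y * x)"
    by (metis complex_mod_cnj)
  then show ?thesis using x y by (simp add: poisson_eq norm_mult)
qed

lemma nn_integral_poisson:
  assumes z: "cmod z < 1"
  shows "(\<integral>\<^sup>+y. ennreal (poisson z y) \<partial>arc_measure) = 1"
proof -
  have "integrable arc_measure (\<lambda>y. 1 * poisson z y)" by (rule integrable_poisson) (use z in auto)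
  moreover have "AE y in arc_measure. 0 \<le> poisson z y"
    using AE_arc_measure_circle by eventually_elim (use z in \<open>auto intro: poisson_nonneg\<close>)
  ultimately show ?thesis
    using integral_poisson[OF z] by (simp add: nn_integral_eq_integral)
qed

text \<open>By Tonelli the order of integration may be exchanged; the inner integral, over
  \<open>x\<close>, is then 1 by symmetry of the kernel.\<close>

lemma
  assumes \<phi>: "integrable arc_measure \<phi>" "\<And>y. 0 \<le> \<phi> y" and r: "0 \<le> r" "r < 1"
  shows integrable_poisson_integral_nonneg: "integrable arc_measure (\<lambda>x. Re (herglotz \<phi> (of_real r * cnj x)))"
    and integral_poisson_integral: "(\<integral>x. Re (herglotz \<phi> (of_real r * cnj x)) \<partial>arc_measure) = (\<integral>y. \<phi> y \<partial>arc_measure)"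
    and poisson_integral_nonneg: "AE x in arc_measure. 0 \<le> Re (herglotz \<phi> (of_real r * cnj x))"
proof -
  have [measurable]: "\<phi> \<in> borel_measurable borel" using \<phi> by (auto dest: borel_measurable_integrable)
  let ?P = "\<lambda>x. Re (herglotz \<phi> (of_real r * cnj x))"
  have small: "cmod (of_real r * cnj x) < 1" if "cmod x = 1" for x using that r by (simp add: norm_mult)
  have pn: "AE y in arc_measure. 0 \<le> poisson (of_real r * cnj x) y" if "cmod x = 1" for x
    using AE_arc_measure_circle by eventually_elim (use small[OF that] in \<open>auto intro: poisson_nonneg\<close>)
  show nn: "AE x in arc_measure. 0 \<le> ?P x"
    using AE_arc_measure_circle
  proof eventually_elim
    case (elim x)
    show ?case unfolding Re_herglotz[OF \<phi>(1) small[OF elim]]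
      using pn[OF elim] by (intro integral_nonneg_AE) (auto elim!: eventually_mono intro!: \<phi> mult_nonneg_nonneg)
  qed
  have eq: "AE x in arc_measure. ennreal (?P x) = (\<integral>\<^sup>+y. ennreal (\<phi> y) * ennreal (poisson (of_real r * cnj x) y) \<partial>arc_measure)"
    using AE_arc_measure_circle
  proof eventually_elim
    case (elim x)
    have "ennreal (?P x) = (\<integral>\<^sup>+y. ennreal (\<phi> y * poisson (of_real r * cnj x) y) \<partial>arc_measure)"
      unfolding Re_herglotz[OF \<phi>(1) small[OF elim]]
      using pn[OF elim] by (intro nn_integral_eq_integral[symmetric] integrable_poisson \<phi> small elim)
        (auto elim!: eventually_mono intro!: \<phi> mult_nonneg_nonneg)
    also have "\<dots> = (\<integral>\<^sup>+y. ennreal (\<phi> y) * ennreal (poisson (of_real r * cnj x) y) \<partial>arc_measure)"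
      using pn[OF elim] by (intro nn_integral_cong_AE) (auto elim!: eventually_mono simp: ennreal_mult \<phi>)
    finally show ?case .
  qed
  interpret pair_sigma_finite arc_measure arc_measure ..
  have "(\<integral>\<^sup>+x. ennreal (?P x) \<partial>arc_measure)
      = (\<integral>\<^sup>+x. \<integral>\<^sup>+y. ennreal (\<phi> y) * ennreal (poisson (of_real r * cnj x) y) \<partial>arc_measure \<partial>arc_measure)"
    using eq by (rule nn_integral_cong_AE)
  also have "\<dots> = (\<integral>\<^sup>+y. \<integral>\<^sup>+x. ennreal (\<phi> y) * ennreal (poisson (of_real r * cnj x) y) \<partial>arc_measure \<partial>arc_measure)"
    unfolding poisson_def by (rule Fubini'[symmetric]) measurable
  also have "\<dots> = (\<integral>\<^sup>+y. ennreal (\<phi> y) \<partial>arc_measure)"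
  proof (rule nn_integral_cong_AE)
    show "AE y in arc_measure. (\<integral>\<^sup>+x. ennreal (\<phi> y) * ennreal (poisson (of_real r * cnj x) y) \<partial>arc_measure) = ennreal (\<phi> y)"
      using AE_arc_measure_circle
    proof eventually_elim
      case (elim y)
      have "(\<integral>\<^sup>+x. ennreal (poisson (of_real r * cnj x) y) \<partial>arc_measure) = (\<integral>\<^sup>+x. ennreal (poisson (of_real r * cnj y) x) \<partial>arc_measure)"
        using AE_arc_measure_circle
        by (intro nn_integral_cong_AE) (auto elim!: eventually_mono simp: poisson_symmetric[OF _ elim])
      also have "\<dots> = 1" using small[OF elim] by (rule nn_integral_poisson)
      finally show ?case
        by (subst nn_integral_cmult) (auto simp: poisson_def)
    qed
  qed
  finally have fin: "(\<integral>\<^sup>+x. ennreal (?P x) \<partial>arc_measure) = ennreal (\<integral>y. \<phi> y \<partial>arc_measure)"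
    using \<phi> by (simp add: nn_integral_eq_integral)
  show int: "integrable arc_measure ?P"
    using nn fin by (intro integrableI_nonneg) auto
  show "(\<integral>x. ?P x \<partial>arc_measure) = (\<integral>y. \<phi> y \<partial>arc_measure)"
    using fin nn \<phi> int by (simp add: nn_integral_eq_integral integral_nonneg_AE)
qed

lemma
  assumes \<phi>: "integrable arc_measure \<phi>" and r: "0 \<le> r" "r < 1"
  shows integrable_poisson_integral: "integrable arc_measure (\<lambda>x. Re (herglotz \<phi> (of_real r * cnj x)))"
    and poisson_integral_contraction:
      "(\<integral>x. \<bar>Re (herglotz \<phi> (of_real r * cnj x))\<bar> \<partial>arc_measure) \<le> (\<integral>y. \<bar>\<phi> y\<bar> \<partial>arc_measure)"
proof -
  have [measurable]: "\<phi> \<in> borel_measurable borel" using \<phi> by (auto dest: borel_measurable_integrable)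
  let ?P = "\<lambda>\<phi> x. Re (herglotz \<phi> (of_real r * cnj x))"
  have a: "integrable arc_measure (\<lambda>y. \<bar>\<phi> y\<bar>)" using \<phi> by simp
  have dom: "AE x in arc_measure. \<bar>?P \<phi> x\<bar> \<le> ?P (\<lambda>y. \<bar>\<phi> y\<bar>) x"
    using AE_arc_measure_circle
  proof eventually_elim
    case (elim x)
    have small: "cmod (of_real r * cnj x) < 1" using elim r by (simp add: norm_mult)
    have "\<bar>?P \<phi> x\<bar> \<le> (\<integral>y. \<bar>\<phi> y * poisson (of_real r * cnj x) y\<bar> \<partial>arc_measure)"
      unfolding Re_herglotz[OF \<phi> small] by (rule integral_abs_bound)
    also have "\<dots> = ?P (\<lambda>y. \<bar>\<phi> y\<bar>) x"
      unfolding Re_herglotz[OF a small]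
      using AE_arc_measure_circle
      by (intro integral_cong_AE) (auto elim!: eventually_mono simp: abs_mult poisson_nonneg small)
    finally show ?case .
  qed
  note i = integrable_poisson_integral_nonneg[OF a _ r]
  show int: "integrable arc_measure (?P \<phi>)"
    by (rule Bochner_Integration.integrable_bound[OF i]) (use dom in \<open>auto elim!: eventually_mono\<close>)
  have "(\<integral>x. \<bar>?P \<phi> x\<bar> \<partial>arc_measure) \<le> (\<integral>x. ?P (\<lambda>y. \<bar>\<phi> y\<bar>) x \<partial>arc_measure)"
    using int i dom by (intro integral_mono_AE) auto
  also have "\<dots> = (\<integral>y. \<bar>\<phi> y\<bar> \<partial>arc_measure)"
    by (rule integral_poisson_integral[OF a _ r]) simp
  finally show "(\<integral>x. \<bar>?P \<phi> x\<bar> \<partial>arc_measure) \<le> (\<integral>y. \<bar>\<phi> y\<bar> \<partial>arc_measure)" .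
qed

section \<open>Convergence of radial Poisson integrals\<close>

definition rad :: "nat \<Rightarrow> real" where "rad k = 1 - 1 / (real k + 2)"

lemma rad: "0 < rad k" "rad k < 1" by (auto simp: rad_def field_simps)

lemma rad_tendsto: "rad \<longlonglongrightarrow> 1"
  unfolding rad_def by real_asymp

text \<open>Off \<open>V\<close> the kernel is of order \<open>1 - (rad k)\<^sup>2\<close>, since
  those points stay at distance \<rho> from \<open>x\<close>. The limit holds at every point of
  \<open>V\<close> on the circle, not just almost everywhere; this matters because it is used on
  sets that are null for arc length.\<close>

lemma poisson_integral_open_tendsto:
  assumes V: "open V" "x \<in> V" and x: "cmod x = 1"
  shows "(\<lambda>k. Re (herglotz (indicator V) (of_real (rad k) * cnj x))) \<longlonglongrightarrow> 1"
proof -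
  have [measurable]: "V \<in> sets borel" using V by auto
  obtain \<rho> where \<rho>: "\<rho> > 0" "ball x \<rho> \<subseteq> V" using V openE by blast
  have ii: "integrable arc_measure (indicator A :: complex \<Rightarrow> real)" if "A \<in> sets borel" for A
    using that by (intro integrable_real_indicator) (auto simp: less_top[symmetric])
  have bd: "\<bar>1 - Re (herglotz (indicator V) (of_real (rad k) * cnj x))\<bar> \<le> 4 * (1 - (rad k)\<^sup>2) / \<rho>\<^sup>2" for k
  proof -
    define z where "z = complex_of_real (rad k) * cnj x"
    have cz: "cmod z = rad k" using rad[of k] x by (simp add: z_def norm_mult)
    have z: "cmod z < 1" using cz rad by simp
    have r2: "0 \<le> 1 - (rad k)\<^sup>2" using rad[of k] by (simp add: power_le_one)
    have "1 - Re (herglotz (indicator V) z) = (\<integral>y. 1 * poisson z y \<partial>arc_measure) - (\<integral>y. indicator V y * poisson z y \<partial>arc_measure)"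
      using Re_herglotz[OF ii[OF \<open>V \<in> sets borel\<close>] z] integral_poisson[OF z] by simp
    also have "\<dots> = (\<integral>y. 1 * poisson z y - indicator V y * poisson z y \<partial>arc_measure)"
      by (rule Bochner_Integration.integral_diff[symmetric]) (intro integrable_poisson z ii; simp)+
    also have "\<dots> = (\<integral>y. indicator (- V) y * poisson z y \<partial>arc_measure)"
      by (intro Bochner_Integration.integral_cong) (auto simp: indicator_def)
    finally have eq: "1 - Re (herglotz (indicator V) z) = (\<integral>y. indicator (- V) y * poisson z y \<partial>arc_measure)" .
    have "0 \<le> (\<integral>y. indicator (- V) y * poisson z y \<partial>arc_measure)"
      using AE_arc_measure_circle
      by (intro integral_nonneg_AE) (auto elim!: eventually_mono intro!: mult_nonneg_nonneg poisson_nonneg z)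
    moreover have "(\<integral>y. indicator (- V) y * poisson z y \<partial>arc_measure) \<le> (\<integral>y. 4 * (1 - (rad k)\<^sup>2) / \<rho>\<^sup>2 \<partial>arc_measure)"
    proof (rule integral_mono_AE)
      show "integrable arc_measure (\<lambda>y. indicator (- V) y * poisson z y)"
        by (intro integrable_poisson z ii) auto
      show "AE y in arc_measure. indicator (- V) y * poisson z y \<le> 4 * (1 - (rad k)\<^sup>2) / \<rho>\<^sup>2"
        using AE_arc_measure_circle
      proof eventually_elim
        case (elim y)
        show ?case
        proof (cases "y \<in> V")
          case False
          then have "\<rho> \<le> cmod (x - y)" using \<rho> by (auto simp: dist_norm subset_iff not_less[symmetric])
          also have "\<dots> \<le> 2 * cmod (1 - z * y)"
            unfolding z_def by (rule norm_diff_le_double_kernel) (use x elim rad[of k] in auto)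
          finally have "(\<rho> / 2)\<^sup>2 \<le> (cmod (1 - z * y))\<^sup>2" using \<rho> by (intro power_mono) auto
          then have "poisson z y \<le> (1 - (rad k)\<^sup>2) / (\<rho> / 2)\<^sup>2"
            unfolding poisson_eq[OF elim] cz using r2 \<rho> by (intro frac_le) auto
          then show ?thesis using False by (simp add: power_divide mult.commute)
        qed (use r2 in simp)
      qed
    qed simp
    ultimately show ?thesis unfolding z_def[symmetric] eq by simp
  qed
  have "(\<lambda>k. 4 * (1 - (rad k)\<^sup>2) / \<rho>\<^sup>2) \<longlonglongrightarrow> 4 * (1 - 1\<^sup>2) / \<rho>\<^sup>2"
    using \<rho> by (intro tendsto_intros rad_tendsto) auto
  then have g0: "(\<lambda>k. 4 * (1 - (rad k)\<^sup>2) / \<rho>\<^sup>2) \<longlonglongrightarrow> 0" by simp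
  have "(\<lambda>k. 1 - Re (herglotz (indicator V) (of_real (rad k) * cnj x))) \<longlonglongrightarrow> 0"
    by (rule Lim_null_comparison[OF _ g0]) (simp only: real_norm_def bd eventually_True)
  from tendsto_diff[OF tendsto_const[of 1] this] show ?thesis by simp
qed

lemma integrable_arc_bounded:
  fixes f :: "complex \<Rightarrow> real"
  assumes "f \<in> borel_measurable borel" "\<And>y. \<bar>f y\<bar> \<le> B"
  shows "integrable arc_measure f"
  using assms by (intro arc_measure.integrable_const_bound[where B=B]) auto

lemma herglotz_add:
  assumes "integrable arc_measure \<phi>" "integrable arc_measure \<psi>" "cmod z < 1"
  shows "herglotz (\<lambda>y. \<phi> y + \<psi> y) z = herglotz \<phi> z + herglotz \<psi> z"
  using integrable_herglotz[OF assms(1,3)] integrable_herglotz[OF assms(2,3)]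
  by (simp add: herglotz_def distrib_right Bochner_Integration.integral_add del: times_divide_eq_right)

lemma herglotz_cmult: "herglotz (\<lambda>y. a * \<phi> y) z = of_real a * herglotz \<phi> z"
  by (simp add: herglotz_def mult.assoc del: times_divide_eq_right)

lemma poisson_integral_L1_open:
  assumes V: "open V"
  shows "(\<lambda>k. \<integral>x. \<bar>Re (herglotz (indicator V) (of_real (rad k) * cnj x)) - indicator V x\<bar> \<partial>arc_measure) \<longlonglongrightarrow> 0"
proof -
  have [measurable]: "V \<in> sets borel" using V by auto
  let ?P = "\<lambda>k x. Re (herglotz (indicator V) (of_real (rad k) * cnj x))"
  have i: "integrable arc_measure (indicator V :: complex \<Rightarrow> real)"
    by (rule integrable_arc_bounded[of _ 1]) auto
  have Pi: "integrable arc_measure (?P k)" for k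
    by (rule integrable_poisson_integral[OF i]) (use rad[of k] in auto)
  have P0: "AE x in arc_measure. 0 \<le> ?P k x" for k
    by (rule poisson_integral_nonneg[OF i]) (use rad[of k] in auto)
  have P1: "AE x in arc_measure. ?P k x \<le> 1" for k
    using AE_arc_measure_circle
    by eventually_elim (use rad[of k] in \<open>auto intro!: Re_herglotz_le[OF i] simp: norm_mult indicator_def\<close>)
  have Oi: "integrable arc_measure (\<lambda>x. indicator V x * ?P k x)" for k
    using integrable_mult_indicator[of V arc_measure "?P k"] Pi by simp
  \<comment> \<open>Since \<open>0 \<le> ?P k x \<le> 1\<close> and \<open>?P k\<close> has the same
    integral as the indicator of \<open>V\<close>, the excess off \<open>V\<close> equals the
    deficit on \<open>V\<close>. Pointwise convergence on \<open>V\<close> therefore suffices, and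
    the boundary of \<open>V\<close> never enters.\<close>
  have eq: "(\<integral>x. \<bar>?P k x - indicator V x\<bar> \<partial>arc_measure) = 2 * (\<integral>x. indicator V x * (1 - ?P k x) \<partial>arc_measure)" for k
  proof -
    have "(\<integral>x. \<bar>?P k x - indicator V x\<bar> \<partial>arc_measure) = (\<integral>x. (indicator V x - 2 * (indicator V x * ?P k x)) + ?P k x \<partial>arc_measure)"
      using P0[of k] P1[of k] by (intro integral_cong_AE) (auto simp: indicator_def)
    also have "\<dots> = ((\<integral>x. indicator V x \<partial>arc_measure) - 2 * (\<integral>x. indicator V x * ?P k x \<partial>arc_measure)) + (\<integral>x. ?P k x \<partial>arc_measure)"
      using i Pi Oi by (subst Bochner_Integration.integral_add, simp, simp, subst Bochner_Integration.integral_diff) auto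
    also have "(\<integral>x. ?P k x \<partial>arc_measure) = (\<integral>x. indicator V x \<partial>arc_measure)"
      by (rule integral_poisson_integral[OF i]) (use rad[of k] in auto)
    also have "((\<integral>x. indicator V x \<partial>arc_measure) - 2 * (\<integral>x. indicator V x * ?P k x \<partial>arc_measure)) + (\<integral>x. indicator V x \<partial>arc_measure)
       = 2 * ((\<integral>x. indicator V x \<partial>arc_measure) - (\<integral>x. indicator V x * ?P k x \<partial>arc_measure))" by simp
    also have "\<dots> = 2 * (\<integral>x. indicator V x - indicator V x * ?P k x \<partial>arc_measure)"
      using Bochner_Integration.integral_diff[OF i Oi] by simp
    finally show ?thesis by (simp add: right_diff_distrib)
  qed
  have "(\<lambda>k. \<integral>x. indicator V x * (1 - ?P k x) \<partial>arc_measure) \<longlonglongrightarrow> (\<integral>x. 0 \<partial>arc_measure)"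
  proof (rule integral_dominated_convergence[where w="\<lambda>_. 1"])
    show "AE x in arc_measure. (\<lambda>k. indicator V x * (1 - ?P k x)) \<longlonglongrightarrow> 0"
      using AE_arc_measure_circle
    proof eventually_elim
      case (elim x)
      show ?case
      proof (cases "x \<in> V")
        case True
        have "(\<lambda>k. 1 - ?P k x) \<longlonglongrightarrow> 1 - 1"
          by (intro tendsto_intros poisson_integral_open_tendsto[OF V True elim])
        then show ?thesis using True by simp
      qed simp
    qed
    show "AE x in arc_measure. norm (indicator V x * (1 - ?P k x)) \<le> 1" for k
      using P0[of k] P1[of k] by eventually_elim (auto simp: indicator_def)
  qed auto
  then show ?thesis unfolding eq using tendsto_mult_right_zero by fastforce
qed

lemma poisson_integral_L1_closure:
  assumes \<phi>: "integrable arc_measure \<phi>"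
    and approx: "\<And>e. e > 0 \<Longrightarrow> \<exists>\<psi>. integrable arc_measure \<psi> \<and> (\<integral>y. \<bar>\<phi> y - \<psi> y\<bar> \<partial>arc_measure) < e \<and>
      (\<lambda>k. \<integral>x. \<bar>Re (herglotz \<psi> (of_real (rad k) * cnj x)) - \<psi> x\<bar> \<partial>arc_measure) \<longlonglongrightarrow> 0"
  shows "(\<lambda>k. \<integral>x. \<bar>Re (herglotz \<phi> (of_real (rad k) * cnj x)) - \<phi> x\<bar> \<partial>arc_measure) \<longlonglongrightarrow> 0"
proof (rule LIMSEQ_I)
  fix e :: real assume "e > 0"
  let ?P = "\<lambda>\<phi> k x. Re (herglotz \<phi> (of_real (rad k) * cnj x))"
  obtain \<psi> where \<psi>: "integrable arc_measure \<psi>" "(\<integral>y. \<bar>\<phi> y - \<psi> y\<bar> \<partial>arc_measure) < e / 4"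
     "(\<lambda>k. \<integral>x. \<bar>?P \<psi> k x - \<psi> x\<bar> \<partial>arc_measure) \<longlonglongrightarrow> 0"
    using approx[of "e/4"] \<open>e > 0\<close> by auto
  have r: "0 \<le> rad k" "rad k < 1" for k using rad[of k] by auto
  have d: "integrable arc_measure (\<lambda>y. \<phi> y - \<psi> y)" using \<phi> \<psi> by simp
  have le: "(\<integral>x. \<bar>?P \<phi> k x - \<phi> x\<bar> \<partial>arc_measure) \<le> 2 * (\<integral>y. \<bar>\<phi> y - \<psi> y\<bar> \<partial>arc_measure) + (\<integral>x. \<bar>?P \<psi> k x - \<psi> x\<bar> \<partial>arc_measure)" for k
  proof -
    note i = integrable_poisson_integral[OF _ r, of _ k]
    have "(\<integral>x. \<bar>?P \<phi> k x - \<phi> x\<bar> \<partial>arc_measure) \<le> (\<integral>x. \<bar>?P (\<lambda>y. \<phi> y - \<psi> y) k x\<bar> + (\<bar>\<phi> x - \<psi> x\<bar> + \<bar>?P \<psi> k x - \<psi> x\<bar>) \<partial>arc_measure)"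
    proof (rule integral_mono_AE)
      show "AE x in arc_measure. \<bar>?P \<phi> k x - \<phi> x\<bar> \<le> \<bar>?P (\<lambda>y. \<phi> y - \<psi> y) k x\<bar> + (\<bar>\<phi> x - \<psi> x\<bar> + \<bar>?P \<psi> k x - \<psi> x\<bar>)"
        using AE_arc_measure_circle
      proof eventually_elim
        case (elim x)
        have "cmod (of_real (rad k) * cnj x) < 1" using elim r[of k] by (simp add: norm_mult)
        from herglotz_add[OF d \<psi>(1) this]
        have "?P \<phi> k x = ?P (\<lambda>y. \<phi> y - \<psi> y) k x + ?P \<psi> k x" by simp
        then show ?case by linarith
      qed
    qed (use i \<phi> \<psi>(1) d in auto)
    also have "\<dots> = (\<integral>x. \<bar>?P (\<lambda>y. \<phi> y - \<psi> y) k x\<bar> \<partial>arc_measure) + ((\<integral>x. \<bar>\<phi> x - \<psi> x\<bar> \<partial>arc_measure) + (\<integral>x. \<bar>?P \<psi> k x - \<psi> x\<bar> \<partial>arc_measure))"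
      using i[OF d] i[OF \<psi>(1)] d \<psi>(1)
      by (subst Bochner_Integration.integral_add, simp, simp, subst Bochner_Integration.integral_add) auto
    finally show ?thesis using poisson_integral_contraction[OF d r, of k] by linarith
  qed
  obtain N where N: "\<And>k. k \<ge> N \<Longrightarrow> norm ((\<integral>x. \<bar>?P \<psi> k x - \<psi> x\<bar> \<partial>arc_measure) - 0) < e / 2"
    using LIMSEQ_D[OF \<psi>(3), of "e/2"] \<open>e > 0\<close> by auto
  show "\<exists>N. \<forall>k\<ge>N. norm ((\<integral>x. \<bar>?P \<phi> k x - \<phi> x\<bar> \<partial>arc_measure) - 0) < e"
  proof (intro exI allI impI)
    fix k assume "N \<le> k"
    have "0 \<le> (\<integral>x. \<bar>?P \<phi> k x - \<phi> x\<bar> \<partial>arc_measure)" by (rule integral_nonneg_AE) simp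
    then show "norm ((\<integral>x. \<bar>?P \<phi> k x - \<phi> x\<bar> \<partial>arc_measure) - 0) < e"
      using le[of k] N[OF \<open>N \<le> k\<close>] \<psi>(2) by simp
  qed
qed

theorem poisson_integral_L1_tendsto:
  assumes "integrable arc_measure \<phi>"
  shows "(\<lambda>k. \<integral>x. \<bar>Re (herglotz \<phi> (of_real (rad k) * cnj x)) - \<phi> x\<bar> \<partial>arc_measure) \<longlonglongrightarrow> 0"
  using assms
proof (induction rule: integrable_induct)
  case (base A c)
  then have [measurable]: "A \<in> sets borel" by simp
  have ii: "integrable arc_measure (indicator B :: complex \<Rightarrow> real)" if "B \<in> sets borel" for B
    by (rule integrable_arc_bounded[of _ 1]) (use that in auto)
  show ?case
  proof (rule poisson_integral_L1_closure)
    show "integrable arc_measure (\<lambda>x. indicator A x *\<^sub>R c)" using ii by simp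
    fix e :: real assume "e > 0"
    \<comment> \<open>The summand 1 keeps the quotient meaningful for \<open>c = 0\<close>. A Borel
      set is then replaced by an open superset of nearly the same measure, for which convergence is
      known.\<close>
    define d where "d = e / (\<bar>c\<bar> + 1)"
    have "d > 0" using \<open>e > 0\<close> by (simp add: d_def)
    have "emeasure arc_measure A < emeasure arc_measure A + ennreal d"
      using \<open>d > 0\<close> by (simp add: arc_measure.emeasure_eq_measure ennreal_less_iff flip: ennreal_plus)
    moreover have "emeasure arc_measure A = (INF U\<in>{U. A \<subseteq> U \<and> open U}. emeasure arc_measure U)"
      by (rule outer_regular) auto
    ultimately obtain U where U: "A \<subseteq> U" "open U" "emeasure arc_measure U < emeasure arc_measure A + ennreal d"
      by (auto simp: INF_less_iff)
    have [measurable]: "U \<in> sets borel" using U by auto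
    have "ennreal (measure arc_measure U) < ennreal (measure arc_measure A + d)"
      using U(3) \<open>d > 0\<close> by (simp add: arc_measure.emeasure_eq_measure ennreal_plus)
    then have mU: "measure arc_measure U - measure arc_measure A < d"
      using ennreal_less_iff[of "measure arc_measure U"] by simp
    have "(\<integral>y. \<bar>indicator A y *\<^sub>R c - indicator U y * c\<bar> \<partial>arc_measure) = (\<integral>y. \<bar>c\<bar> * (indicator U y - indicator A y) \<partial>arc_measure)"
      using U(1) by (intro Bochner_Integration.integral_cong) (auto simp: indicator_def)
    also have "\<dots> = \<bar>c\<bar> * (measure arc_measure U - measure arc_measure A)"
      using ii by (simp add: Bochner_Integration.integral_diff)
    also have "\<dots> \<le> \<bar>c\<bar> * d" using mU by (intro mult_left_mono) auto
    also have "\<dots> < (\<bar>c\<bar> + 1) * d" using \<open>d > 0\<close> by simp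
    also have "\<dots> = e" by (simp add: d_def)
    finally have lt: "(\<integral>y. \<bar>indicator A y *\<^sub>R c - indicator U y * c\<bar> \<partial>arc_measure) < e" .
    have "Re (herglotz (\<lambda>y. indicator U y * c) z) = c * Re (herglotz (indicator U) z)" for z
      using herglotz_cmult[of c "indicator U" z] by (simp add: mult.commute)
    then have "\<bar>Re (herglotz (\<lambda>y. indicator U y * c) z) - indicator U x * c\<bar> = \<bar>c\<bar> * \<bar>Re (herglotz (indicator U) z) - indicator U x\<bar>" for z x
      by (simp add: mult.commute flip: abs_mult right_diff_distrib)
    then have "(\<lambda>k. \<integral>x. \<bar>Re (herglotz (\<lambda>y. indicator U y * c) (of_real (rad k) * cnj x)) - indicator U x * c\<bar> \<partial>arc_measure) \<longlonglongrightarrow> 0"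
      using tendsto_mult_right_zero[OF poisson_integral_L1_open[OF U(2)], of "\<bar>c\<bar>"] by simp
    then show "\<exists>\<psi>. integrable arc_measure \<psi> \<and> (\<integral>y. \<bar>indicator A y *\<^sub>R c - \<psi> y\<bar> \<partial>arc_measure) < e \<and>
      (\<lambda>k. \<integral>x. \<bar>Re (herglotz \<psi> (of_real (rad k) * cnj x)) - \<psi> x\<bar> \<partial>arc_measure) \<longlonglongrightarrow> 0"
      using lt ii by (intro exI[of _ "\<lambda>y. indicator U y * c"]) auto
  qed
next
  case (add f g)
  let ?P = "\<lambda>\<phi> k x. Re (herglotz \<phi> (of_real (rad k) * cnj x))"
  have r: "0 \<le> rad k" "rad k < 1" for k using rad[of k] by auto
  show ?case
  proof (rule Lim_null_comparison[OF _ tendsto_add_zero[OF add.IH]], intro always_eventually allI)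
    fix k
    note i = integrable_poisson_integral[OF _ r, of _ k]
    have "(\<integral>x. \<bar>?P (\<lambda>x. f x + g x) k x - (f x + g x)\<bar> \<partial>arc_measure) \<le> (\<integral>x. \<bar>?P f k x - f x\<bar> + \<bar>?P g k x - g x\<bar> \<partial>arc_measure)"
    proof (rule integral_mono_AE)
      show "AE x in arc_measure. \<bar>?P (\<lambda>x. f x + g x) k x - (f x + g x)\<bar> \<le> \<bar>?P f k x - f x\<bar> + \<bar>?P g k x - g x\<bar>"
        using AE_arc_measure_circle
      proof eventually_elim
        case (elim x)
        have "cmod (of_real (rad k) * cnj x) < 1" using elim r[of k] by (simp add: norm_mult)
        from herglotz_add[OF add.hyps this] show ?case by simp
      qed
    qed (use i add.hyps in auto)
    also have "\<dots> = (\<integral>x. \<bar>?P f k x - f x\<bar> \<partial>arc_measure) + (\<integral>x. \<bar>?P g k x - g x\<bar> \<partial>arc_measure)"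
      using i add.hyps by (intro Bochner_Integration.integral_add) auto
    finally show "norm (\<integral>x. \<bar>?P (\<lambda>x. f x + g x) k x - (f x + g x)\<bar> \<partial>arc_measure)
       \<le> (\<integral>x. \<bar>?P f k x - f x\<bar> \<partial>arc_measure) + (\<integral>x. \<bar>?P g k x - g x\<bar> \<partial>arc_measure)"
      by (simp add: integral_nonneg_AE)
  qed
next
  case (lim f s)
  show ?case
  proof (rule poisson_integral_L1_closure[OF lim.hyps(4)])
    fix e :: real assume "e > 0"
    have [measurable]: "f \<in> borel_measurable borel" "s i \<in> borel_measurable borel" for i
      using lim.hyps(1)[of i] lim.hyps(4) by (auto dest: borel_measurable_integrable)
    have "(\<lambda>i. \<integral>y. \<bar>f y - s i y\<bar> \<partial>arc_measure) \<longlonglongrightarrow> (\<integral>y. 0 \<partial>arc_measure)"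
    \<comment> \<open>The approximants in the induction rule satisfy
      \<open>\<bar>s i y\<bar> \<le> 2 * \<bar>f y\<bar>\<close>, whence the factor 3.\<close>
    proof (rule integral_dominated_convergence[where w="\<lambda>y. 3 * \<bar>f y\<bar>"])
      show "AE y in arc_measure. (\<lambda>i. \<bar>f y - s i y\<bar>) \<longlonglongrightarrow> 0"
      proof (intro always_eventually allI)
        fix y
        have "(\<lambda>i. \<bar>f y - s i y\<bar>) \<longlonglongrightarrow> \<bar>f y - f y\<bar>" using lim.hyps(2)[of y] by (intro tendsto_intros) auto
        then show "(\<lambda>i. \<bar>f y - s i y\<bar>) \<longlonglongrightarrow> 0" by simp
      qed
      show "AE y in arc_measure. norm \<bar>f y - s i y\<bar> \<le> 3 * \<bar>f y\<bar>" for i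
        using lim.hyps(3)[of _ i] by (intro always_eventually allI) (smt (verit) UNIV_I real_norm_def space_arc_measure)
    qed (use lim.hyps(4) in auto)
    then have "(\<lambda>i. \<integral>y. \<bar>f y - s i y\<bar> \<partial>arc_measure) \<longlonglongrightarrow> 0" by simp
    then have "\<forall>\<^sub>F i in sequentially. (\<integral>y. \<bar>f y - s i y\<bar> \<partial>arc_measure) < e"
      using order_tendstoD(2) \<open>e > 0\<close> by blast
    then obtain i where "(\<integral>y. \<bar>f y - s i y\<bar> \<partial>arc_measure) < e"
      by (auto simp: eventually_sequentially)
    then show "\<exists>\<psi>. integrable arc_measure \<psi> \<and> (\<integral>y. \<bar>f y - \<psi> y\<bar> \<partial>arc_measure) < e \<and>
      (\<lambda>k. \<integral>x. \<bar>Re (herglotz \<psi> (of_real (rad k) * cnj x)) - \<psi> x\<bar> \<partial>arc_measure) \<longlonglongrightarrow> 0"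
      using lim.hyps(1) lim.IH by blast
  qed
qed

section \<open>Outer functions and absolute continuity\<close>

lemma herglotz_norm_bound:
  assumes \<phi>: "integrable arc_measure \<phi>" and z: "cmod z < 1"
  shows "cmod (herglotz \<phi> z) \<le> 2 / (1 - cmod z) * (\<integral>y. \<bar>\<phi> y\<bar> \<partial>arc_measure)"
proof -
  have "cmod (herglotz \<phi> z) \<le> (\<integral>y. cmod (of_real (\<phi> y) * ((1 + z * y) / (1 - z * y))) \<partial>arc_measure)"
    unfolding herglotz_def by (rule integral_norm_bound)
  also have "\<dots> \<le> (\<integral>y. 2 / (1 - cmod z) * \<bar>\<phi> y\<bar> \<partial>arc_measure)"
  proof (rule integral_mono_AE)
    show "AE y in arc_measure. cmod (of_real (\<phi> y) * ((1 + z * y) / (1 - z * y))) \<le> 2 / (1 - cmod z) * \<bar>\<phi> y\<bar>"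
      using AE_arc_measure_circle
    proof eventually_elim
      case (elim y)
      have "\<bar>\<phi> y\<bar> * cmod ((1 + z * y) / (1 - z * y)) \<le> \<bar>\<phi> y\<bar> * (2 / (1 - cmod z))"
        using herglotz_kernel_bound[OF elim z] by (rule mult_left_mono) simp
      then show ?case by (simp only: norm_mult norm_of_real) (simp add: mult.commute)
    qed
  qed (use integrable_herglotz[OF \<phi> z] \<phi> in auto)
  finally show ?thesis by simp
qed

lemma norm_exp_minus_1_le: "cmod (exp a - 1) \<le> exp (cmod a) * cmod a"
proof -
  have "cmod (exp a - exp 0) \<le> exp (cmod a) * cmod (a - 0)"
  proof (rule field_differentiable_bound[of "cball 0 (cmod a)" exp exp])
    show "(exp has_field_derivative exp z) (at z within cball 0 (cmod a))" for z :: complex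
      by (rule DERIV_exp[THEN has_field_derivative_at_within])
    show "cmod (exp z) \<le> exp (cmod a)" if "z \<in> cball 0 (cmod a)" for z
      using that complex_Re_le_cmod[of z] by simp
  qed auto
  then show ?thesis by simp
qed

section \<open>Taylor coefficients of dilated outer functions\<close>

definition taylor_coeff :: "(complex \<Rightarrow> complex) \<Rightarrow> nat \<Rightarrow> complex" where
  "taylor_coeff h j = (deriv ^^ j) h 0 / fact j"

lemma taylor_coeff_bound:
  assumes h: "h holomorphic_on ball 0 R" and s: "0 < s" "s < R"
    and b: "\<And>w. cmod w = s \<Longrightarrow> cmod (h w) \<le> B"
  shows "cmod (taylor_coeff h j) \<le> B / s ^ j"
proof -
  have "norm ((deriv ^^ j) h 0) \<le> fact j * B / s ^ j"
  proof (rule Cauchy_inequality)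
    show "h holomorphic_on ball 0 s" by (rule holomorphic_on_subset[OF h]) (use s in auto)
    show "continuous_on (cball 0 s) h"
      by (rule holomorphic_on_imp_continuous_on[OF holomorphic_on_subset[OF h]]) (use s in auto)
  qed (use s b in auto)
  then show ?thesis by (simp add: taylor_coeff_def norm_divide field_simps)
qed

lemma
  assumes h: "h holomorphic_on ball 0 R" and R: "R > 1"
  shows taylor_coeff_sums: "\<And>x. cmod x = 1 \<Longrightarrow> (\<lambda>j. taylor_coeff h j * x ^ j) sums h x"
    and summable_taylor_coeff: "summable (\<lambda>j. cmod (taylor_coeff h j))"
proof -
  have s: "(\<lambda>j. taylor_coeff h j * x ^ j) sums h x" if "cmod x < R" for x
    using holomorphic_power_series[OF h, of x] that by (simp add: taylor_coeff_def)
  then show "\<And>x. cmod x = 1 \<Longrightarrow> (\<lambda>j. taylor_coeff h j * x ^ j) sums h x" using R by simp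
  obtain t where t: "1 < t" "t < R" using R dense by blast
  have "summable (\<lambda>j. taylor_coeff h j * complex_of_real t ^ j)"
    using s[of "of_real t"] t by (auto simp: sums_iff)
  from powser_insidea[OF this, of 1] show "summable (\<lambda>j. cmod (taylor_coeff h j))"
    using t by simp
qed

text \<open>For \<open>0 < r < 1\<close> the dilated function is analytic in the disk of radius
  \<open>1 / r\<close>, so its Taylor series converges absolutely on the unit circle and may be
  integrated term by term against a measure there.\<close>

definition outer_fun :: "real \<Rightarrow> (complex \<Rightarrow> real) \<Rightarrow> complex \<Rightarrow> complex" where
  "outer_fun r \<phi> z = exp (herglotz \<phi> (of_real r * z))"

lemma norm_outer_fun: "cmod (outer_fun r \<phi> z) = exp (Re (herglotz \<phi> (of_real r * z)))"
  by (simp add: outer_fun_def)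

lemma borel_measurable_outer_fun[measurable]:
  assumes [measurable]: "\<phi> \<in> borel_measurable borel"
  shows "outer_fun r \<phi> \<in> borel_measurable borel"
  unfolding outer_fun_def by measurable

lemma outer_fun_holomorphic:
  assumes \<phi>: "integrable arc_measure \<phi>" and r: "0 < r" "r < 1"
  shows "outer_fun r \<phi> holomorphic_on ball 0 (1 / r)"
proof -
  have "(\<lambda>z. complex_of_real r * z) ` ball 0 (1 / r) \<subseteq> ball 0 1"
    using r by (auto simp: norm_mult field_simps)
  then have "(herglotz \<phi> \<circ> (\<lambda>z. of_real r * z)) holomorphic_on ball 0 (1 / r)"
    by (intro holomorphic_on_compose holomorphic_intros holomorphic_on_subset[OF herglotz_holomorphic[OF \<phi>]])
  then show ?thesis unfolding outer_fun_def
    by (intro holomorphic_intros) (simp add: o_def)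
qed

text \<open>Cauchy's estimate on the circle of radius \<open>1 / 2\<close>: each single coefficient
  is controlled by closeness to 1 there, at the cost of a factor \<open>2 ^ j\<close> that does not
  depend on \<open>n\<close>.\<close>

lemma taylor_coeff_tendsto:
  fixes h :: "nat \<Rightarrow> complex \<Rightarrow> complex"
  assumes h: "\<And>n. h n holomorphic_on ball 0 (R n)" and R: "\<And>n. R n > 1"
    and e: "\<And>n w. cmod w = 1 / 2 \<Longrightarrow> cmod (h n w - 1) \<le> e n" and e0: "e \<longlonglongrightarrow> 0"
  shows "(\<lambda>n. taylor_coeff (h n) j) \<longlonglongrightarrow> (if j = 0 then 1 else 0)"
proof (rule LIM_zero_cancel, rule Lim_null_comparison)
  show "(\<lambda>n. e n / (1 / 2) ^ j) \<longlonglongrightarrow> 0" using tendsto_divide_zero[OF e0] by simp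
  show "\<forall>\<^sub>F n in sequentially. norm (taylor_coeff (h n) j - (if j = 0 then 1 else 0)) \<le> e n / (1 / 2) ^ j"
  proof (intro always_eventually allI)
    fix n
    have "taylor_coeff (\<lambda>w. h n w - 1) j = taylor_coeff (h n) j - (if j = 0 then 1 else 0)"
      using R[of n] unfolding taylor_coeff_def
      by (subst higher_deriv_diff[OF h]) (auto simp: holomorphic_on_const)
    moreover have "cmod (taylor_coeff (\<lambda>w. h n w - 1) j) \<le> e n / (1 / 2) ^ j"
      by (rule taylor_coeff_bound[of _ "R n"]) (use R[of n] e in \<open>auto intro!: holomorphic_intros h\<close>)
    ultimately show "norm (taylor_coeff (h n) j - (if j = 0 then 1 else 0)) \<le> e n / (1 / 2) ^ j" by simp
  qed
qed

lemma taylor_coeff_outer_fun_tendsto: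
  assumes \<phi>: "\<And>n. integrable arc_measure (\<phi> n)" and r: "\<And>n. 0 < r n" "\<And>n. r n < 1"
    and e: "\<And>n w. cmod w = 1 / 2 \<Longrightarrow> cmod (herglotz (\<phi> n) (of_real (r n) * w)) \<le> e n" and e0: "e \<longlonglongrightarrow> 0"
  shows "(\<lambda>n. taylor_coeff (outer_fun (r n) (\<phi> n)) j) \<longlonglongrightarrow> (if j = 0 then 1 else 0)"
proof (rule taylor_coeff_tendsto)
  show "outer_fun (r n) (\<phi> n) holomorphic_on ball 0 (1 / r n)" for n
    by (rule outer_fun_holomorphic[OF \<phi> r])
  show "1 / r n > 1" for n using r[of n] by simp
  have "(\<lambda>n. exp (e n) * e n) \<longlonglongrightarrow> exp 0 * 0" by (intro tendsto_intros e0)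
  then show "(\<lambda>n. exp (e n) * e n) \<longlonglongrightarrow> 0" by simp
  fix n and w :: complex assume w: "cmod w = 1 / 2"
  have "cmod (outer_fun (r n) (\<phi> n) w - 1) \<le> exp (cmod (herglotz (\<phi> n) (of_real (r n) * w))) * cmod (herglotz (\<phi> n) (of_real (r n) * w))"
    unfolding outer_fun_def by (rule norm_exp_minus_1_le)
  also have "\<dots> \<le> exp (e n) * e n" using e[OF w] by (intro mult_mono) auto
  finally show "cmod (outer_fun (r n) (\<phi> n) w - 1) \<le> exp (e n) * e n" .
qed

text \<open>This is the common interface of both applications, absolute continuity and vanishing off
  the good arcs. The radius \<open>r n\<close> may depend on \<open>n\<close>, so it can be chosen
  close to 1 after \<open>\<phi> n\<close> has been fixed.\<close>

theorem vanishing_by_outer_funs: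
  fixes q :: "complex \<Rightarrow> complex" and \<phi> :: "nat \<Rightarrow> complex \<Rightarrow> real"
  assumes M: "finite_circle_measure M" and q: "integrable M q" and Z: "Z \<in> sets borel"
    and decay: "\<And>k. cmod (\<integral>x. cnj x ^ k * q x \<partial>M) \<le> B * exp (- c * sqrt (real k))"
    and cc: "0 \<le> c'" "c' < c"
    and \<phi>: "\<And>n. integrable arc_measure (\<phi> n)" and r: "\<And>n. 0 < r n" "\<And>n. r n < 1"
    and bound: "\<And>n j. cmod (taylor_coeff (outer_fun (r n) (\<phi> n)) j) \<le> K * exp (c' * sqrt (real j))"
    and e: "\<And>n w. cmod w = 1 / 2 \<Longrightarrow> cmod (herglotz (\<phi> n) (of_real (r n) * w)) \<le> e n" and e0: "e \<longlonglongrightarrow> 0"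
    and Zlim: "(\<lambda>n. \<integral>x. indicator Z x * (cmod (outer_fun (r n) (\<phi> n) (cnj x)) * cmod (q x)) \<partial>M) \<longlonglongrightarrow> 0"
    and Zclim: "(\<lambda>n. \<integral>x. indicator (- Z) x * (cmod (outer_fun (r n) (\<phi> n) (cnj x) - 1) * cmod (q x)) \<partial>M) \<longlonglongrightarrow> 0"
  shows "AE x in M. x \<in> Z \<longrightarrow> q x = 0"
proof (rule vanishing_on_annihilated_set[OF M q Z decay cc _ _ _ bound _ Zlim Zclim])
  have hol: "outer_fun (r n) (\<phi> n) holomorphic_on ball 0 (1 / r n)" for n
    by (rule outer_fun_holomorphic[OF \<phi> r])
  have R: "1 / r n > 1" for n using r[of n] by simp
  show "summable (\<lambda>j. cmod (taylor_coeff (outer_fun (r n) (\<phi> n)) j))" for n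
    by (rule summable_taylor_coeff[OF hol R])
  show "(\<lambda>j. taylor_coeff (outer_fun (r n) (\<phi> n)) j * x ^ j) sums outer_fun (r n) (\<phi> n) x" if "cmod x = 1" for n x
    by (rule taylor_coeff_sums[OF hol R that])
  show "outer_fun (r n) (\<phi> n) \<in> borel_measurable borel" for n
    using borel_measurable_integrable[OF \<phi>[of n]] by (intro borel_measurable_outer_fun) simp
  show "(\<lambda>n. taylor_coeff (outer_fun (r n) (\<phi> n)) j) \<longlonglongrightarrow> (if j = 0 then 1 else 0)" for j
    by (rule taylor_coeff_outer_fun_tendsto[OF \<phi> r e e0])
qed

text \<open>This is the mean value property: all powers \<open>cnj x ^ j\<close> with
  \<open>j > 0\<close> integrate to zero, leaving the constant Taylor coefficient.\<close>

lemma integral_outer_fun: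
  assumes \<phi>: "integrable arc_measure \<phi>" and r: "0 < r" "r < 1"
  shows "integrable arc_measure (\<lambda>x. outer_fun r \<phi> (cnj x))"
    and "(\<integral>x. outer_fun r \<phi> (cnj x) \<partial>arc_measure) = outer_fun r \<phi> 0"
proof -
  have [measurable]: "\<phi> \<in> borel_measurable borel" using \<phi> by (auto dest: borel_measurable_integrable)
  let ?a = "taylor_coeff (outer_fun r \<phi>)"
  have hol: "outer_fun r \<phi> holomorphic_on ball 0 (1 / r)" by (rule outer_fun_holomorphic[OF \<phi> r])
  have R: "1 / r > 1" using r by simp
  have one: "integrable arc_measure (\<lambda>_. 1 :: complex)" by simp
  have hm: "outer_fun r \<phi> \<in> borel_measurable borel" by measurable
  note ps = sums_integral_power_series[OF finite_circle_measure_arc_measure one summable_taylor_coeff[OF hol R]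
    taylor_coeff_sums[OF hol R] hm, of 0]
  show "integrable arc_measure (\<lambda>x. outer_fun r \<phi> (cnj x))" using ps(1) by simp
  have z: "(\<integral>x. x powi (0 - int j) * 1 \<partial>arc_measure) = (if j = 0 then 1 else 0)" for j
  proof -
    have integrable_pow: "integrable arc_measure (\<lambda>x::complex. x ^ j)"
    proof (rule arc_measure.integrable_const_bound[where B=1])
      show "AE x in arc_measure. cmod (x ^ j) \<le> 1"
        using AE_arc_measure_circle by eventually_elim (simp add: norm_power)
    qed simp
    have "(\<integral>x. x powi (0 - int j) * 1 \<partial>arc_measure) = (\<integral>x. cnj (x ^ j) \<partial>arc_measure)"
      using AE_arc_measure_circle
      by (intro integral_cong_AE) (auto elim!: eventually_mono simp: cnj_power_eq_power_int)
    also have "\<dots> = cnj (\<integral>x. x ^ j \<partial>arc_measure)" by (rule integral_bounded_linear[OF bounded_linear_cnj]) (rule integrable_pow)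
    finally show ?thesis by (simp add: integral_arc_measure_power)
  qed
  have "(\<lambda>j. ?a j * (if j = 0 then 1 else 0)) sums (\<integral>x. outer_fun r \<phi> (cnj x) \<partial>arc_measure)"
    using ps(2) unfolding z by simp
  moreover have "(\<lambda>j. ?a j * (if j = 0 then 1 else 0)) sums (\<Sum>j\<in>{0}. ?a j * (if j = 0 then 1 else 0))"
    by (rule sums_finite) auto
  ultimately have "(\<integral>x. outer_fun r \<phi> (cnj x) \<partial>arc_measure) = ?a 0" using sums_unique2 by fastforce
  then show "(\<integral>x. outer_fun r \<phi> (cnj x) \<partial>arc_measure) = outer_fun r \<phi> 0"
    by (simp add: taylor_coeff_def)
qed

text \<open>This plays the role of the F. and M. Riesz theorem. The outer functions have modulus at most 1
  and their mean value over the circle tends to 1, hence they tend to 1 in \<open>L\<^sup>2\<close> of arc length.\<close>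
theorem vanishing_on_null_set:
  fixes q :: "complex \<Rightarrow> complex"
  assumes M: "finite_circle_measure M" and q: "integrable M q" and S: "S \<in> null_sets arc_measure"
    and decay: "\<And>k. cmod (\<integral>x. cnj x ^ k * q x \<partial>M) \<le> B * exp (- c * sqrt (real k))" and c: "c > 0"
    and ac: "\<And>N. N \<in> null_sets arc_measure \<Longrightarrow> N - S \<in> null_sets M"
  shows "AE x in M. x \<in> S \<longrightarrow> q x = 0"
proof -
  note [measurable_cong] = finite_circle_measureD(1)[OF M]
  have [measurable]: "q \<in> borel_measurable M" using q by auto
  have Sb[measurable]: "S \<in> sets borel" using S by auto
  define Q where "Q = (\<integral>x. indicator S x * cmod (q x) \<partial>M)"
  \<comment> \<open>The square makes \<open>n\<close> times the measure of \<open>V n\<close> tend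
    to zero, so that \<open>\<phi> n = - n\<close> on \<open>V n\<close> still has vanishing
    \<open>L1\<close> norm.\<close>
  have "\<exists>V. S \<subseteq> V \<and> open V \<and> measure arc_measure V < 1 / (real n + 1)\<^sup>2" for n :: nat
  proof -
    have "emeasure arc_measure S = (INF U\<in>{U. S \<subseteq> U \<and> open U}. emeasure arc_measure U)"
      by (rule outer_regular) auto
    then have "(INF U\<in>{U. S \<subseteq> U \<and> open U}. emeasure arc_measure U) < ennreal (1 / (real n + 1)\<^sup>2)"
      using S by (simp add: null_sets_def)
    then show ?thesis
      by (auto simp: INF_less_iff arc_measure.emeasure_eq_measure ennreal_less_iff)
  qed
  then obtain V where V: "\<And>n. S \<subseteq> V n" "\<And>n. open (V n)" "\<And>n. measure arc_measure (V n) < 1 / (real n + 1)\<^sup>2"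
    by metis
  have [measurable]: "V n \<in> sets borel" for n using V(2) by auto
  define \<phi> where "\<phi> n y = - real n * indicator (V n) y" for n :: nat and y
  have \<phi>m[measurable]: "\<phi> n \<in> borel_measurable borel" for n unfolding \<phi>_def by measurable
  have iV: "integrable arc_measure (indicator (V n) :: complex \<Rightarrow> real)" for n
    by (rule integrable_arc_bounded[of _ 1]) auto
  have \<phi>i: "integrable arc_measure (\<phi> n)" for n
    unfolding \<phi>_def using iV by simp
  have le1: "cmod (outer_fun (rad k) (\<phi> n) w) \<le> 1" if "cmod w \<le> 1" for k n w
  proof -
    have "cmod (of_real (rad k) * w) \<le> rad k"
      using that rad[of k] by (simp add: norm_mult mult_left_le)
    then have "cmod (of_real (rad k) * w) < 1" using rad[of k] by linarith
    then show ?thesis unfolding norm_outer_fun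
      using Re_herglotz_le[OF \<phi>i, of _ n 0] by (auto simp: \<phi>_def)
  qed
  have lim: "(\<lambda>k. \<integral>x. indicator S x * (cmod (outer_fun (rad k) (\<phi> n) (cnj x)) * cmod (q x)) \<partial>M)
      \<longlonglongrightarrow> (\<integral>x. exp (- real n) * (indicator S x * cmod (q x)) \<partial>M)" for n
  proof (rule integral_dominated_convergence[where w="\<lambda>x. cmod (q x)"])
    show "AE x in M. (\<lambda>k. indicator S x * (cmod (outer_fun (rad k) (\<phi> n) (cnj x)) * cmod (q x)))
       \<longlonglongrightarrow> exp (- real n) * (indicator S x * cmod (q x))"
      using finite_circle_measureD(4)[OF M]
    proof eventually_elim
      case (elim x)
      show ?case
      proof (cases "x \<in> S")
        case True
        then have "x \<in> V n" using V by auto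
        have "Re (herglotz (\<phi> n) z) = - real n * Re (herglotz (indicator (V n)) z)" for z
          unfolding \<phi>_def herglotz_cmult by simp
        then have "(\<lambda>k. cmod (outer_fun (rad k) (\<phi> n) (cnj x)) * cmod (q x)) \<longlonglongrightarrow> exp (- real n * 1) * cmod (q x)"
          unfolding norm_outer_fun
          by (simp only:) (intro tendsto_intros poisson_integral_open_tendsto[OF V(2) \<open>x \<in> V n\<close> elim])
        then show ?thesis using True by simp
      qed simp
    qed
    show "AE x in M. norm (indicator S x * (cmod (outer_fun (rad k) (\<phi> n) (cnj x)) * cmod (q x))) \<le> cmod (q x)" for k
      using finite_circle_measureD(4)[OF M]
    proof eventually_elim
      case (elim x)
      have "cmod (outer_fun (rad k) (\<phi> n) (cnj x)) * cmod (q x) \<le> 1 * cmod (q x)"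
        using elim by (intro mult_right_mono le1) auto
      then show ?case by (auto simp: indicator_def)
    qed
  qed (use q in auto)
  \<comment> \<open>For fixed \<open>n\<close> the integrals converge to
    \<open>exp (- real n) * Q\<close> as the radius tends to 1, so one radius can be picked that
    brings the integral below this value plus \<open>1 / (n + 1)\<close>.\<close>
  have "\<exists>k. (\<integral>x. indicator S x * (cmod (outer_fun (rad k) (\<phi> n) (cnj x)) * cmod (q x)) \<partial>M) < exp (- real n) * Q + 1 / (real n + 1)" for n
  proof -
    have "\<forall>\<^sub>F k in sequentially. (\<integral>x. indicator S x * (cmod (outer_fun (rad k) (\<phi> n) (cnj x)) * cmod (q x)) \<partial>M) < exp (- real n) * Q + 1 / (real n + 1)"
      using lim[of n] by (rule order_tendstoD) (simp add: Q_def)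
    then show ?thesis by (auto simp: eventually_sequentially)
  qed
  then obtain k where k: "\<And>n. (\<integral>x. indicator S x * (cmod (outer_fun (rad (k n)) (\<phi> n) (cnj x)) * cmod (q x)) \<partial>M) < exp (- real n) * Q + 1 / (real n + 1)"
    by metis
  define r where "r n = rad (k n)" for n
  have r: "0 < r n" "r n < 1" for n using rad by (auto simp: r_def)
  define h where "h n = outer_fun (r n) (\<phi> n)" for n
  have [measurable]: "h n \<in> borel_measurable borel" for n unfolding h_def by measurable
  have h1: "cmod (h n w) \<le> 1" if "cmod w \<le> 1" for n w unfolding h_def r_def by (rule le1[OF that])
  \<comment> \<open>The factor 4 is \<open>2 / (1 - 1 / 2)\<close>, the kernel bound at points of
    modulus at most \<open>1 / 2\<close>; the rest bounds the \<open>L1\<close> norm of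
    \<open>\<phi> n\<close>.\<close>
  define e where "e n = 4 * (real n / (real n + 1)\<^sup>2)" for n :: nat
  have e0: "e \<longlonglongrightarrow> 0" unfolding e_def by real_asymp
  have e: "cmod (herglotz (\<phi> n) (of_real (r n) * w)) \<le> e n" if "cmod w \<le> 1 / 2" for n w
  proof -
    have rw: "cmod (of_real (r n) * w) \<le> 1 / 2"
      using that r[of n] mult_mono[of "r n" 1 "cmod w" "1/2"] by (simp add: norm_mult)
    have I: "(\<integral>y. \<bar>\<phi> n y\<bar> \<partial>arc_measure) \<le> real n / (real n + 1)\<^sup>2"
    proof -
      have "(\<integral>y. \<bar>\<phi> n y\<bar> \<partial>arc_measure) = (\<integral>y. real n * indicator (V n) y \<partial>arc_measure)"
        by (intro Bochner_Integration.integral_cong) (auto simp: \<phi>_def indicator_def)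
      also have "\<dots> = real n * measure arc_measure (V n)" by simp
      also have "\<dots> \<le> real n * (1 / (real n + 1)\<^sup>2)" using V(3)[of n] by (intro mult_left_mono) auto
      finally show ?thesis by simp
    qed
    have "cmod (herglotz (\<phi> n) (of_real (r n) * w)) \<le> 2 / (1 - cmod (of_real (r n) * w)) * (\<integral>y. \<bar>\<phi> n y\<bar> \<partial>arc_measure)"
      by (rule herglotz_norm_bound[OF \<phi>i]) (use rw in auto)
    also have "\<dots> \<le> 4 * (real n / (real n + 1)\<^sup>2)"
      using rw by (intro mult_mono I integral_nonneg_AE) (auto simp: field_simps)
    finally show ?thesis by (simp add: e_def)
  qed
  have b: "cmod (taylor_coeff (h n) j) \<le> 1 * exp (c / 2 * sqrt (real j))" for n j
  proof -
    have "cmod (taylor_coeff (h n) j) \<le> 1 / 1 ^ j" unfolding h_def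
      by (rule taylor_coeff_bound[OF outer_fun_holomorphic[OF \<phi>i r]])
        (use r[of n] h1 in \<open>auto simp: h_def\<close>)
    also have "\<dots> \<le> 1 * exp (c / 2 * sqrt (real j))" using c by simp
    finally show ?thesis .
  qed
  have L2: "(\<lambda>n. \<integral>x. norm ((cmod (h n (cnj x) - 1))\<^sup>2) \<partial>arc_measure) \<longlonglongrightarrow> 0"
  proof (rule Lim_null_comparison)
    have "(\<lambda>n. h n 0) \<longlonglongrightarrow> 1"
    proof (rule LIM_zero_cancel, rule Lim_null_comparison)
      show "(\<lambda>n. exp (e n) * e n) \<longlonglongrightarrow> 0" using tendsto_mult[OF tendsto_exp[OF e0] e0] by simp
      show "\<forall>\<^sub>F n in sequentially. cmod (h n 0 - 1) \<le> exp (e n) * e n"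
      proof (intro always_eventually allI)
        fix n
        have le: "cmod (herglotz (\<phi> n) 0) \<le> e n" using e[of 0 n] by simp
        have "cmod (h n 0 - 1) \<le> exp (cmod (herglotz (\<phi> n) 0)) * cmod (herglotz (\<phi> n) 0)"
          unfolding h_def outer_fun_def using norm_exp_minus_1_le by simp
        also have "\<dots> \<le> exp (e n) * e n" using le by (intro mult_mono) auto
        finally show "cmod (h n 0 - 1) \<le> exp (e n) * e n" .
      qed
    qed
    then have "(\<lambda>n. 2 - 2 * Re (h n 0)) \<longlonglongrightarrow> 2 - 2 * Re 1" by (intro tendsto_intros)
    then show "(\<lambda>n. 2 - 2 * Re (h n 0)) \<longlonglongrightarrow> 0" by simp
    show "\<forall>\<^sub>F n in sequentially. norm (\<integral>x. norm ((cmod (h n (cnj x) - 1))\<^sup>2) \<partial>arc_measure) \<le> 2 - 2 * Re (h n 0)"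
    proof (intro always_eventually allI)
      fix n
      have hi: "integrable arc_measure (\<lambda>x. h n (cnj x))" and hI: "(\<integral>x. h n (cnj x) \<partial>arc_measure) = h n 0"
        unfolding h_def by (rule integral_outer_fun[OF \<phi>i r])+
      have "(\<integral>x. norm ((cmod (h n (cnj x) - 1))\<^sup>2) \<partial>arc_measure) \<le> (\<integral>x. 2 - 2 * Re (h n (cnj x)) \<partial>arc_measure)"
      proof (rule integral_mono_AE')
        show "AE x in arc_measure. norm ((cmod (h n (cnj x) - 1))\<^sup>2) \<le> 2 - 2 * Re (h n (cnj x))"
          using AE_arc_measure_circle
        proof eventually_elim
          case (elim x)
          have "(cmod (h n (cnj x)))\<^sup>2 \<le> 1" using h1[of "cnj x" n] elim by (simp add: power_le_one)
          \<comment> \<open>Together with \<open>\<bar>h\<bar> \<le> 1\<close> this identity bounds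
            \<open>\<bar>h - 1\<bar>\<close> squared by \<open>2 - 2 * Re h\<close>, whose mean is
            read off at the centre of the disk.\<close>
          moreover have "(cmod (h n (cnj x) - 1))\<^sup>2 = (cmod (h n (cnj x)))\<^sup>2 - 2 * Re (h n (cnj x)) + 1"
            unfolding cmod_power2 by (simp add: power2_eq_square algebra_simps)
          moreover have "norm ((cmod (h n (cnj x) - 1))\<^sup>2) = (cmod (h n (cnj x) - 1))\<^sup>2" by simp
          ultimately show ?case by linarith
        qed
        show "AE x in arc_measure. 0 \<le> 2 - 2 * Re (h n (cnj x))"
          using AE_arc_measure_circle
        proof eventually_elim
          case (elim x)
          show ?case using complex_Re_le_cmod[of "h n (cnj x)"] h1[of "cnj x" n] elim by simp
        qed
      qed (use integrable_Re[OF hi] in auto)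
      also have "\<dots> = 2 - 2 * Re (h n 0)"
        using integrable_Re[OF hi] integral_Re[OF hi] hI by simp
      finally show "norm (\<integral>x. norm ((cmod (h n (cnj x) - 1))\<^sup>2) \<partial>arc_measure) \<le> 2 - 2 * Re (h n 0)"
        by (simp add: integral_nonneg_AE)
    qed
  qed
  have hb: "cmod (h n (cnj x) - 1) \<le> 2" if "cmod x = 1" for n x
    using norm_triangle_ineq4[of "h n (cnj x)" 1] h1[of "cnj x" n] that by simp
  have "integrable arc_measure (\<lambda>x. (cmod (h n (cnj x) - 1))\<^sup>2)" for n
  proof (rule arc_measure.integrable_const_bound[where B="2\<^sup>2"])
    show "AE x in arc_measure. norm ((cmod (h n (cnj x) - 1))\<^sup>2) \<le> 2\<^sup>2"
      using AE_arc_measure_circle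
    proof eventually_elim
      case (elim x)
      have "(cmod (h n (cnj x) - 1))\<^sup>2 \<le> 2\<^sup>2" by (rule power_mono[OF hb[OF elim]]) simp
      then show ?case by simp
    qed
  qed measurable
  from tendsto_L1_AE_subseq[OF this L2] obtain s where s: "strict_mono s"
      "AE x in arc_measure. (\<lambda>n. (cmod (h (s n) (cnj x) - 1))\<^sup>2) \<longlonglongrightarrow> 0" by blast
  \<comment> \<open>The subsequence converges almost everywhere for arc length. By
    \<open>ac\<close>, the part of the exceptional set outside \<open>S\<close> is also null for
    \<open>M\<close>, which is where convergence to 1 is wanted.\<close>
  obtain N where N: "N \<in> null_sets arc_measure" "{x. \<not> (\<lambda>n. (cmod (h (s n) (cnj x) - 1))\<^sup>2) \<longlonglongrightarrow> 0} \<subseteq> N"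
    using s(2) unfolding eventually_ae_filter by auto
  have "AE x in M. x \<notin> N - S" using ac[OF N(1)] by (rule AE_not_in)
  then have conv: "AE x in M. x \<notin> S \<longrightarrow> (\<lambda>n. cmod (h (s n) (cnj x) - 1)) \<longlonglongrightarrow> 0"
  proof eventually_elim
    case (elim x)
    show ?case
    proof
      assume "x \<notin> S"
      with elim N have "(\<lambda>n. (cmod (h (s n) (cnj x) - 1))\<^sup>2) \<longlonglongrightarrow> 0" by auto
      from tendsto_real_sqrt[OF this] show "(\<lambda>n. cmod (h (s n) (cnj x) - 1)) \<longlonglongrightarrow> 0" by simp
    qed
  qed
  show ?thesis
  proof (rule vanishing_by_outer_funs[OF M q Sb decay, where c'="c/2" and K=1 and \<phi>="\<lambda>n. \<phi> (s n)" and r="\<lambda>n. r (s n)" and e="\<lambda>n. e (s n)"])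
    show "cmod (taylor_coeff (outer_fun (r (s n)) (\<phi> (s n))) j) \<le> 1 * exp (c / 2 * sqrt (real j))" for n j
      using b[of "s n" j] by (simp add: h_def)
    show "cmod (herglotz (\<phi> (s n)) (of_real (r (s n)) * w)) \<le> e (s n)" if "cmod w = 1/2" for n w
      using e that by simp
    show "(\<lambda>n. e (s n)) \<longlonglongrightarrow> 0" using LIMSEQ_subseq_LIMSEQ[OF e0 s(1)] by (simp add: o_def)
    have "(\<lambda>n. \<integral>x. indicator S x * (cmod (h n (cnj x)) * cmod (q x)) \<partial>M) \<longlonglongrightarrow> 0"
    proof (rule Lim_null_comparison)
      show "(\<lambda>n. exp (- real n) * Q + 1 / (real n + 1)) \<longlonglongrightarrow> 0" by real_asymp
      show "\<forall>\<^sub>F n in sequentially. norm (\<integral>x. indicator S x * (cmod (h n (cnj x)) * cmod (q x)) \<partial>M) \<le> exp (- real n) * Q + 1 / (real n + 1)"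
        using k by (intro always_eventually allI) (simp add: h_def r_def integral_nonneg_AE less_imp_le)
    qed
    from LIMSEQ_subseq_LIMSEQ[OF this s(1)]
    show "(\<lambda>n. \<integral>x. indicator S x * (cmod (outer_fun (r (s n)) (\<phi> (s n)) (cnj x)) * cmod (q x)) \<partial>M) \<longlonglongrightarrow> 0"
      by (simp add: o_def h_def)
    have "(\<lambda>n. \<integral>x. indicator (- S) x * (cmod (h (s n) (cnj x) - 1) * cmod (q x)) \<partial>M) \<longlonglongrightarrow> (\<integral>x. 0 \<partial>M)"
    proof (rule integral_dominated_convergence[where w="\<lambda>x. 2 * cmod (q x)"])
      show "AE x in M. (\<lambda>n. indicator (- S) x * (cmod (h (s n) (cnj x) - 1) * cmod (q x))) \<longlonglongrightarrow> 0"
        using conv by eventually_elim (auto simp: indicator_def intro!: tendsto_mult_left_zero)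
      show "AE x in M. norm (indicator (- S) x * (cmod (h (s n) (cnj x) - 1) * cmod (q x))) \<le> 2 * cmod (q x)" for n
        using finite_circle_measureD(4)[OF M]
        by eventually_elim (use hb in \<open>auto simp: indicator_def intro!: mult_right_mono\<close>)
    qed (use q in auto)
    then show "(\<lambda>n. \<integral>x. indicator (- S) x * (cmod (outer_fun (r (s n)) (\<phi> (s n)) (cnj x) - 1) * cmod (q x)) \<partial>M) \<longlonglongrightarrow> 0"
      by (simp add: h_def)
  qed (use c \<phi>i r in auto)
qed

section \<open>Arcs and functions of mean zero\<close>

text \<open>An arc is cut out of the circle by an open half-plane, because the cosine is strictly
  decreasing on \<open>[0, pi]\<close>. This form shows that arcs are relatively open and
  Borel.\<close>

lemma cis_image_interval_eq:
  assumes "0 < s" "s < pi"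
  shows "cis ` {m - s<..<m + s} = {x \<in> circle. cos s < Re (x * cis (- m))}"
proof (intro set_eqI iffI)
  fix x assume "x \<in> cis ` {m - s<..<m + s}"
  then obtain t where t: "x = cis t" "\<bar>t - m\<bar> < s" by auto
  have "cos s < cos \<bar>t - m\<bar>" using t assms by (intro cos_monotone_0_pi) auto
  moreover have "Re (x * cis (- m)) = cos (t - m)"
    unfolding t(1) cis_mult by simp
  ultimately show "x \<in> {x \<in> circle. cos s < Re (x * cis (- m))}"
    using t by simp
next
  fix x assume x: "x \<in> {x \<in> circle. cos s < Re (x * cis (- m))}"
  define y where "y = x * cis (- m)"
  have "cmod y = 1" using x by (simp add: y_def norm_mult)
  then have y: "y = cis (Arg y)" using cis_Arg[of y] by (cases "y = 0") (auto simp: sgn_eq)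
  have "x = y * cis m" by (simp add: y_def mult.assoc cis_mult)
  then have xt: "x = cis (m + Arg y)" using y cis_mult[of "Arg y" m] by (simp add: add.commute)
  have "cos s < cos \<bar>Arg y\<bar>" using x y by (metis (mono_tags, lifting) Re_complex_of_real cis.sel(1) cos_abs_real mem_Collect_eq y_def)
  moreover have "\<bar>Arg y\<bar> \<le> pi" using Arg_bounded[of y] by auto
  ultimately have "\<bar>Arg y\<bar> < s"
    using assms cos_monotone_0_pi_le[of s "\<bar>Arg y\<bar>"] by linarith
  then show "x \<in> cis ` {m - s<..<m + s}" unfolding xt by (intro imageI) auto
qed

lemma open_arc_eq_Int_open:
  assumes "open_arc I"
  obtains W where "open W" "I = circle \<inter> W"
proof -
  obtain a b where ab: "a < b" "b - a < 2 * pi" "I = cis ` {a<..<b}" using assms by (auto simp: open_arc_def)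
  have "{a<..<b} = {(a+b)/2 - (b-a)/2<..<(a+b)/2 + (b-a)/2}" by (simp add: field_simps)
  then have "I = circle \<inter> {x. cos ((b-a)/2) < Re (x * cis (- ((a+b)/2)))}"
    using ab cis_image_interval_eq[of "(b-a)/2" "(a+b)/2"] by auto
  moreover have "open {x. cos ((b-a)/2) < Re (x * cis (- ((a+b)/2)))}"
    by (intro open_Collect_less continuous_intros)
  ultimately show ?thesis using that by blast
qed

lemma open_arc_borel: "open_arc I \<Longrightarrow> I \<in> sets borel"
  by (elim open_arc_eq_Int_open) auto

section \<open>The partition of the circle into \<open>N\<close> equal arcs\<close>

lemma cis_2pi_inj:
  assumes "s \<in> {0..<1}" "t \<in> {0..1}" "cis (2 * pi * s) = cis (2 * pi * t)"
  shows "s = t \<or> (s = 0 \<and> t = 1)"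
proof -
  have "sin (2 * pi * s) = sin (2 * pi * t) \<and> cos (2 * pi * s) = cos (2 * pi * t)"
    using assms(3) by (auto simp: complex_eq_iff)
  then obtain n :: int where "2 * pi * s = 2 * pi * t + 2 * pi * n" using sin_cos_eq_iff by blast
  then have "2 * pi * s = 2 * pi * (t + n)" by (simp add: algebra_simps)
  then have st: "s = t + n" using pi_gt_zero by (simp del: distrib_left_numeral)
  then have "n < 1" "n \<ge> -1" using assms by auto
  then have "n = 0 \<or> n = -1" by auto
  then show ?thesis using st assms by auto
qed

text \<open>The arcs are open, so that the failure of logarithmic integrability, which is stated for
  open arcs, applies to them. They cover the circle up to the finitely many division points.\<close>

definition Arc :: "nat \<Rightarrow> nat \<Rightarrow> complex set" where
  "Arc N j = (\<lambda>t. cis (2 * pi * t)) ` {real j / real N<..<(real j + 1) / real N}"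

lemma open_arc_Arc:
  assumes "N \<ge> 2" shows "open_arc (Arc N j)"
  unfolding open_arc_def
proof (intro exI conjI)
  let ?a = "2 * pi * (real j / real N)" and ?b = "2 * pi * ((real j + 1) / real N)"
  show "?a < ?b" using assms by (simp add: divide_strict_right_mono)
  have "?b - ?a = 2 * pi * (1 / real N)" by (simp add: diff_divide_distrib[symmetric] right_diff_distrib[symmetric])
  also have "\<dots> < 2 * pi * 1" using assms by (intro mult_strict_left_mono) auto
  finally show "?b - ?a < 2 * pi" by simp
  have "(\<lambda>t. 2 * pi * t) ` {u<..<v} = {2 * pi * u<..<2 * pi * v}" for u v :: real
    by (auto simp: image_iff intro!: bexI[of _ "x / (2 * pi)" for x]) (auto simp: field_simps)
  then show "Arc N j = cis ` {?a<..<?b}"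
    unfolding Arc_def by (metis image_image)
qed

lemma Arc_borel[measurable]: "N \<ge> 2 \<Longrightarrow> Arc N j \<in> sets borel"
  using open_arc_Arc open_arc_borel by blast

lemma Arc_index:
  assumes "j < N"
  shows "0 \<le> real j / real N" "(real j + 1) / real N \<le> 1"
  using assms by (auto simp: field_simps)

lemma Arc_param_range:
  assumes "j < N" "t \<in> {real j / real N<..<(real j + 1) / real N}"
  shows "0 < t" "t < 1"
proof -
  have "real j / real N < t" "t < (real j + 1) / real N" using assms(2) by auto
  then show "0 < t" "t < 1" using Arc_index[OF assms(1)] by linarith+
qed

lemma mem_Arc_iff:
  assumes j: "j < N" and t: "t \<in> {0..<1}"
  shows "cis (2 * pi * t) \<in> Arc N j \<longleftrightarrow> t \<in> {real j / real N<..<(real j + 1) / real N}"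
proof
  assume "cis (2 * pi * t) \<in> Arc N j"
  then obtain s where s: "s \<in> {real j / real N<..<(real j + 1) / real N}" "cis (2 * pi * t) = cis (2 * pi * s)"
    by (auto simp: Arc_def)
  have "s \<in> {0..1}" "s \<noteq> 1" using Arc_param_range[OF j s(1)] by auto
  with cis_2pi_inj[OF t _ s(2)] show "t \<in> {real j / real N<..<(real j + 1) / real N}" using s(1) by auto
qed (auto simp: Arc_def)

lemma Arc_disjoint:
  assumes "i < N" "j < N" "y \<in> Arc N i" "y \<in> Arc N j" shows "i = j"
proof -
  obtain t where t: "t \<in> {real i / real N<..<(real i + 1) / real N}" "y = cis (2 * pi * t)"
    using assms by (auto simp: Arc_def)
  have "t \<in> {0..<1}" using Arc_param_range[OF assms(1) t(1)] by auto
  then have t2: "t \<in> {real j / real N<..<(real j + 1) / real N}" using mem_Arc_iff[OF assms(2)] assms(4) t(2) by blast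
  have N: "real N > 0" using assms by simp
  have "real i < t * real N" "t * real N < real i + 1" "real j < t * real N" "t * real N < real j + 1"
    using t t2 N by (simp_all add: pos_divide_less_eq pos_less_divide_eq)
  then show ?thesis by linarith
qed

lemma AE_in_some_Arc:
  assumes N: "N \<ge> 2"
  shows "AE y in arc_measure. \<exists>j<N. y \<in> Arc N j"
proof -
  have [measurable]: "Arc N j \<in> sets borel" for j using N by auto
  let ?B = "- (\<Union>j<N. Arc N j)"
  have "{t. cis (2 * pi * t) \<in> ?B} \<inter> {0..<1} \<subseteq> (\<lambda>j. real j / real N) ` {..<N}"
  proof
    fix t assume t: "t \<in> {t. cis (2 * pi * t) \<in> ?B} \<inter> {0..<1}"
    define j where "j = nat \<lfloor>t * real N\<rfloor>"
    have tN: "0 \<le> t * real N" "t * real N < real N" using t N by auto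
    then have j: "real j \<le> t * real N" "t * real N < real j + 1" "j < N"
      unfolding j_def by linarith+
    have "t \<notin> {real j / real N<..<(real j + 1) / real N}"
      using t j(3) mem_Arc_iff[OF j(3), of t] by auto
    then have "t = real j / real N" using j N by (auto simp: field_simps not_less)
    then show "t \<in> (\<lambda>j. real j / real N) ` {..<N}" using j by auto
  qed
  then have "countable ({t. cis (2 * pi * t) \<in> ?B} \<inter> {0..<1})"
    by (rule countable_subset) auto
  then have "emeasure lborel ({t. cis (2 * pi * t) \<in> ?B} \<inter> {0..<1}) = 0"
    by (rule emeasure_lborel_countable)
  moreover have "?B \<in> sets borel" by measurable
  ultimately have "?B \<in> null_sets arc_measure"
    using emeasure_arc_measure[of ?B] by (simp only: null_sets_def mem_Collect_eq sets_arc_measure simp_thms)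
  then show ?thesis by (rule AE_I') auto
qed

lemma measure_Arc:
  assumes N: "N \<ge> 2" and j: "j < N"
  shows "measure arc_measure (Arc N j) = 1 / real N"
proof -
  have "{t. cis (2 * pi * t) \<in> Arc N j} \<inter> {0..<1} = {real j / real N<..<(real j + 1) / real N}"
  proof (intro set_eqI iffI)
    fix t assume t: "t \<in> {real j / real N<..<(real j + 1) / real N}"
    have "t \<in> {0..<1}" using Arc_param_range[OF j t] by auto
    with t show "t \<in> {t. cis (2 * pi * t) \<in> Arc N j} \<inter> {0..<1}" using mem_Arc_iff[OF j] by auto
  qed (use mem_Arc_iff[OF j] in auto)
  then have "emeasure arc_measure (Arc N j) = emeasure lborel {real j / real N<..<(real j + 1) / real N}"
    using N by (simp add: emeasure_arc_measure)
  also have "\<dots> = ennreal (1 / real N)"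
    by (subst emeasure_lborel_Ioo) (use N in \<open>auto simp: divide_right_mono diff_divide_distrib[symmetric]\<close>)
  finally show ?thesis by (simp add: measure_def)
qed

lemma Arc_diameter:
  assumes "y \<in> Arc N j" "y' \<in> Arc N j"
  shows "cmod (y - y') \<le> 2 * pi / real N"
proof -
  obtain t t' where t: "t \<in> {real j / real N<..<(real j + 1) / real N}" "y = cis (2 * pi * t)"
    "t' \<in> {real j / real N<..<(real j + 1) / real N}" "y' = cis (2 * pi * t')"
    using assms by (auto simp: Arc_def)
  have "\<bar>t - t'\<bar> \<le> (real j + 1) / real N - real j / real N" using t by auto
  then have tt: "\<bar>t - t'\<bar> \<le> 1 / real N" by (simp add: diff_divide_distrib[symmetric])
  have "cmod (y - y') \<le> 1 * \<bar>2 * pi * t - 2 * pi * t'\<bar>"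
    unfolding t(2,4)
  proof -
    have "cis a - cis b = cis b * (cis (a - b) - 1)" for a b by (simp add: right_diff_distrib cis_mult)
    then have "cmod (cis a - cis b) = 2 * \<bar>sin ((a - b) / 2)\<bar>" for a b
      using dist_exp_i_1[of "a - b"] by (simp add: norm_mult cis_conv_exp)
    then show "cmod (cis (2 * pi * t) - cis (2 * pi * t')) \<le> 1 * \<bar>2 * pi * t - 2 * pi * t'\<bar>"
      using abs_sin_x_le_abs_x[of "(2 * pi * t - 2 * pi * t') / 2"] by simp
  qed
  also have "\<dots> = 2 * pi * \<bar>t - t'\<bar>" by (simp add: right_diff_distrib[symmetric] abs_mult)
  also have "\<dots> \<le> 2 * pi * (1 / real N)" using tt by (intro mult_left_mono) auto
  finally show ?thesis by simp
qed

section \<open>Oscillation of the Herglotz kernel on one arc\<close>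

lemma kernel_weight_integrable:
  assumes z: "cmod z < 1" and [measurable]: "A \<in> sets borel"
  shows "integrable arc_measure (\<lambda>y. indicator A y * (4 * pi * cmod z / (cmod (1 - z * y))\<^sup>2))"
proof (rule arc_measure.integrable_const_bound[where B="4 * pi * cmod z / (1 - cmod z)\<^sup>2"])
  show "AE y in arc_measure. norm (indicator A y * (4 * pi * cmod z / (cmod (1 - z * y))\<^sup>2)) \<le> 4 * pi * cmod z / (1 - cmod z)\<^sup>2"
    using AE_arc_measure_circle
  proof eventually_elim
    case (elim y)
    have "4 * pi * cmod z / (cmod (1 - z * y))\<^sup>2 \<le> 4 * pi * cmod z / (1 - cmod z)\<^sup>2"
      using one_minus_norm_le[OF elim, of z] z by (intro divide_left_mono power_mono mult_pos_pos) auto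
    then show ?case using z by (auto simp: indicator_def)
  qed
qed measurable

text \<open>With \<open>y = cis (2 * pi * t)\<close> and \<open>w = z * y\<close>, the kernel has
  derivative \<open>2 / (1 - w)\<^sup>2\<close> in \<open>w\<close>, and \<open>w\<close> has
  derivative \<open>2 * pi * \<i> * w\<close> in \<open>t\<close>. The weight on the right is the
  modulus of the product, so its integral over the arc is the variation of the kernel there.\<close>

lemma kernel_oscillation:
  assumes z: "cmod z < 1" and N: "N \<ge> 2" and j: "j < N" and y: "y \<in> Arc N j" "y' \<in> Arc N j"
  shows "cmod ((1 + z * y) / (1 - z * y) - (1 + z * y') / (1 - z * y'))
     \<le> (\<integral>v. indicator (Arc N j) v * (4 * pi * cmod z / (cmod (1 - z * v))\<^sup>2) \<partial>arc_measure)"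
proof -
  define I where "I = {real j / real N<..<(real j + 1) / real N}"
  define K where "K t = (1 + z * cis (2 * pi * t)) / (1 - z * cis (2 * pi * t))" for t
  define K' where "K' t = 4 * pi * \<i> * z * cis (2 * pi * t) / (1 - z * cis (2 * pi * t))\<^sup>2" for t
  have nz: "1 - z * cis (2 * pi * t) \<noteq> 0" for t
    using one_minus_norm_le[of "cis (2 * pi * t)" z] z by auto
  have dK: "(K has_vector_derivative K' t) (at t within A)" for t A
  proof -
    have 1: "((\<lambda>t. z * cis (2 * pi * t)) has_vector_derivative (2 * pi * \<i> * z * cis (2 * pi * t))) (at t within A)"
      by (auto intro!: derivative_eq_intros simp: has_vector_derivative_def scaleR_conv_of_real algebra_simps)
    have 2: "((\<lambda>w. (1 + w) / (1 - w)) has_field_derivative 2 / (1 - w)\<^sup>2) (at w)" if "1 - w \<noteq> 0" for w :: complex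
      using that by (auto intro!: derivative_eq_intros simp: field_simps power2_eq_square)
    have "(((\<lambda>w. (1 + w) / (1 - w)) \<circ> (\<lambda>t. z * cis (2 * pi * t))) has_vector_derivative
       (2 * pi * \<i> * z * cis (2 * pi * t)) * (2 / (1 - z * cis (2 * pi * t))\<^sup>2)) (at t within A)"
      by (rule field_vector_diff_chain_within[OF 1 has_field_derivative_at_within[OF 2[OF nz]]])
    then show ?thesis by (simp add: K_def[abs_def] K'_def o_def mult_ac)
  qed
  have cK: "continuous_on A K'" for A
    unfolding K'_def by (intro continuous_intros) (use nz in auto)
  have nK: "norm (K' t) = 4 * pi * cmod z / (cmod (1 - z * cis (2 * pi * t)))\<^sup>2" for t
    by (simp add: K'_def norm_divide norm_mult norm_power)
  have [measurable]: "K' \<in> borel_measurable borel" by (rule borel_measurable_continuous_onI[OF cK])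
  have W: "(\<integral>v. indicator (Arc N j) v * (4 * pi * cmod z / (cmod (1 - z * v))\<^sup>2) \<partial>arc_measure) = (\<integral>t. indicator I t * norm (K' t) \<partial>lborel)"
    and Wi: "integrable lborel (\<lambda>t. indicator I t * norm (K' t))"
  proof -
    have [measurable]: "Arc N j \<in> sets borel" using N by auto
    have m: "(\<lambda>v. indicator (Arc N j) v * (4 * pi * cmod z / (cmod (1 - z * v))\<^sup>2)) \<in> borel_measurable borel" by measurable
    have eq: "indicator {0..<1} t *\<^sub>R (indicator (Arc N j) (cis (2 * pi * t)) * (4 * pi * cmod z / (cmod (1 - z * cis (2 * pi * t)))\<^sup>2))
       = indicator I t * norm (K' t)" for t
    proof (cases "t \<in> {0..<1}")
      case True
      then show ?thesis using mem_Arc_iff[OF j True] by (simp add: nK I_def indicator_def)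
    next
      case False
      then have "t \<notin> I" using Arc_param_range[OF j, of t] by (auto simp: I_def)
      then show ?thesis using False by simp
    qed
    show "(\<integral>v. indicator (Arc N j) v * (4 * pi * cmod z / (cmod (1 - z * v))\<^sup>2) \<partial>arc_measure) = (\<integral>t. indicator I t * norm (K' t) \<partial>lborel)"
      unfolding integral_arc_measure[OF m] eq ..
    show "integrable lborel (\<lambda>t. indicator I t * norm (K' t))"
      using kernel_weight_integrable[OF z, of "Arc N j"] unfolding integrable_arc_measure[OF m] eq by simp
  qed
  have le: "cmod (K b - K a) \<le> (\<integral>t. indicator I t * norm (K' t) \<partial>lborel)" if ab: "a \<in> I" "b \<in> I" "a \<le> b" for a b
  proof -
    have sub: "{a..b} \<subseteq> I" using ab by (auto simp: I_def)
    have "K b - K a = (\<integral>x. indicator {a .. b} x *\<^sub>R K' x \<partial>lborel)"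
      by (rule integral_FTC_Icc[symmetric]) (use ab dK cK in auto)
    also have "cmod \<dots> \<le> (\<integral>x. norm (indicator {a .. b} x *\<^sub>R K' x) \<partial>lborel)" by (rule integral_norm_bound)
    also have "\<dots> \<le> (\<integral>t. indicator I t * norm (K' t) \<partial>lborel)"
      by (rule integral_mono_AE'[OF Wi]; rule AE_I2) (use sub in \<open>auto simp: indicator_def\<close>)
    finally show ?thesis .
  qed
  obtain a b where ab: "a \<in> I" "y = cis (2 * pi * a)" "b \<in> I" "y' = cis (2 * pi * b)"
    using y by (auto simp: Arc_def I_def)
  have "cmod (K a - K b) \<le> (\<integral>t. indicator I t * norm (K' t) \<partial>lborel)"
    using le[of a b] le[of b a] ab by (cases "a \<le> b") (auto simp: norm_minus_commute)
  then show ?thesis unfolding W ab(2,4) K_def by simp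
qed

text \<open>Since \<open>\<phi>\<close> has mean zero on each arc, only the oscillation of the Herglotz kernel on the arcs
  matters, and these oscillations add up to at most its total variation.\<close>
theorem herglotz_mean_zero_bound:
  assumes z: "cmod z < 1" and N: "N \<ge> 2" and J: "J \<subseteq> {..<N}"
    and \<psi>: "\<And>j. j \<in> J \<Longrightarrow> integrable arc_measure (\<psi> j)"
    and mean: "\<And>j. j \<in> J \<Longrightarrow> (\<integral>y. indicator (Arc N j) y * \<psi> j y \<partial>arc_measure) = 0"
    and L1: "\<And>j. j \<in> J \<Longrightarrow> (\<integral>y. indicator (Arc N j) y * \<bar>\<psi> j y\<bar> \<partial>arc_measure) \<le> D"
  shows "cmod (herglotz (\<lambda>y. \<Sum>j\<in>J. indicator (Arc N j) y * \<psi> j y) z)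
    \<le> D * (\<integral>y. indicator (\<Union>j\<in>J. Arc N j) y * (4 * pi * cmod z / (cmod (1 - z * y))\<^sup>2) \<partial>arc_measure)"
proof -
  have fin: "finite J" using J finite_subset by blast
  have [measurable]: "Arc N j \<in> sets borel" for j using N by auto
  let ?K = "\<lambda>y. (1 + z * y) / (1 - z * y)"
  let ?W = "\<lambda>y. 4 * pi * cmod z / (cmod (1 - z * y))\<^sup>2"
  have i: "integrable arc_measure (\<lambda>y. indicator (Arc N j) y * \<psi> j y)" if "j \<in> J" for j
    using integrable_mult_indicator[OF _ \<psi>[OF that], of "Arc N j"] by simp
  have piece: "cmod (herglotz (\<lambda>y. indicator (Arc N j) y * \<psi> j y) z) \<le> D * (\<integral>y. indicator (Arc N j) y * ?W y \<partial>arc_measure)"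
    if j: "j \<in> J" for j
  proof -
    define O1 where "O1 = (\<integral>y. indicator (Arc N j) y * ?W y \<partial>arc_measure)"
    have O1: "O1 \<ge> 0" unfolding O1_def by (rule integral_nonneg_AE) auto
    have jN: "j < N" using j J by auto
    \<comment> \<open>The midpoint serves as reference point: \<open>\<psi> j\<close> has mean zero
      on the arc, so the constant kernel value at \<open>y0\<close> can be subtracted under the
      integral.\<close>
    define y0 where "y0 = cis (2 * pi * ((real j + 1/2) / real N))"
    have y0: "y0 \<in> Arc N j" unfolding y0_def Arc_def
      using N by (intro imageI) (auto simp: divide_strict_right_mono)
    have ik: "integrable arc_measure (\<lambda>y. of_real (indicator (Arc N j) y * \<psi> j y) * ?K y)"
      by (rule integrable_herglotz[OF i[OF j] z])
    have ic: "integrable arc_measure (\<lambda>y. complex_of_real (indicator (Arc N j) y * \<psi> j y) * ?K y0)"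
      using i[OF j] by (intro integrable_mult_left integrable_of_real)
    have zero: "(\<integral>y. complex_of_real (indicator (Arc N j) y * \<psi> j y) * ?K y0 \<partial>arc_measure) = 0"
      using mean[OF j] by (subst integral_mult_left_zero) (simp add: integral_complex_of_real del: of_real_mult)
    have eqn: "herglotz (\<lambda>y. indicator (Arc N j) y * \<psi> j y) z
       = (\<integral>y. of_real (indicator (Arc N j) y * \<psi> j y) * ?K y - of_real (indicator (Arc N j) y * \<psi> j y) * ?K y0 \<partial>arc_measure)"
      unfolding herglotz_def Bochner_Integration.integral_diff[OF ik ic] zero by (simp only: diff_zero)
    have "cmod (herglotz (\<lambda>y. indicator (Arc N j) y * \<psi> j y) z) \<le> (\<integral>y. cmod (of_real (indicator (Arc N j) y * \<psi> j y) * ?K y - of_real (indicator (Arc N j) y * \<psi> j y) * ?K y0) \<partial>arc_measure)"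
      unfolding eqn by (rule integral_norm_bound)
    also have "\<dots> \<le> (\<integral>y. (indicator (Arc N j) y * \<bar>\<psi> j y\<bar>) * O1 \<partial>arc_measure)"
    proof (rule integral_mono)
      show "integrable arc_measure (\<lambda>y. cmod (of_real (indicator (Arc N j) y * \<psi> j y) * ?K y - of_real (indicator (Arc N j) y * \<psi> j y) * ?K y0))"
        by (rule integrable_norm) (rule Bochner_Integration.integrable_diff[OF ik ic])
      show "integrable arc_measure (\<lambda>y. (indicator (Arc N j) y * \<bar>\<psi> j y\<bar>) * O1)"
        using integrable_abs[OF i[OF j]] by (simp add: abs_mult)
      fix y
      show "cmod (of_real (indicator (Arc N j) y * \<psi> j y) * ?K y - of_real (indicator (Arc N j) y * \<psi> j y) * ?K y0) \<le> (indicator (Arc N j) y * \<bar>\<psi> j y\<bar>) * O1"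
      proof (cases "y \<in> Arc N j")
        case True
        have "cmod (?K y - ?K y0) \<le> O1" unfolding O1_def by (rule kernel_oscillation[OF z N jN True y0])
        then have "\<bar>\<psi> j y\<bar> * cmod (?K y - ?K y0) \<le> \<bar>\<psi> j y\<bar> * O1" by (intro mult_left_mono) auto
        moreover have "of_real (indicator (Arc N j) y * \<psi> j y) * ?K y - of_real (indicator (Arc N j) y * \<psi> j y) * ?K y0 = of_real (\<psi> j y) * (?K y - ?K y0)"
          using True by (simp add: right_diff_distrib del: times_divide_eq_right)
        ultimately show ?thesis using True by (simp add: norm_mult del: times_divide_eq_right)
      qed simp
    qed
    also have "\<dots> = (\<integral>y. indicator (Arc N j) y * \<bar>\<psi> j y\<bar> \<partial>arc_measure) * O1" by simp
    also have "\<dots> \<le> D * O1" using L1[OF j] O1 by (rule mult_right_mono)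
    finally show ?thesis by (simp add: O1_def)
  qed
  have "herglotz (\<lambda>y. \<Sum>j\<in>J. indicator (Arc N j) y * \<psi> j y) z = (\<Sum>j\<in>J. herglotz (\<lambda>y. indicator (Arc N j) y * \<psi> j y) z)"
    unfolding herglotz_def
    by (subst Bochner_Integration.integral_sum[symmetric, OF integrable_herglotz[OF i z]])
      (simp_all add: sum_distrib_right del: times_divide_eq_right)
  also have "cmod \<dots> \<le> (\<Sum>j\<in>J. D * (\<integral>y. indicator (Arc N j) y * ?W y \<partial>arc_measure))"
    by (rule sum_norm_le) (rule piece)
  also have "\<dots> = D * (\<integral>y. (\<Sum>j\<in>J. indicator (Arc N j) y * ?W y) \<partial>arc_measure)"
    by (subst Bochner_Integration.integral_sum) (use kernel_weight_integrable[OF z] in \<open>auto simp: sum_distrib_left\<close>)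
  also have "(\<integral>y. (\<Sum>j\<in>J. indicator (Arc N j) y * ?W y) \<partial>arc_measure) = (\<integral>y. indicator (\<Union>j\<in>J. Arc N j) y * ?W y \<partial>arc_measure)"
  proof (intro Bochner_Integration.integral_cong refl)
    fix y
    have "Arc N a \<inter> Arc N b = {}" if "a \<in> J" "b \<in> J" "a \<noteq> b" for a b
    proof -
      have "a < N" "b < N" using that J by auto
      then show ?thesis using Arc_disjoint[of a N b] that(3) by blast
    qed
    then have "disjoint_family_on (Arc N) J" by (simp add: disjoint_family_on_def)
    then have "(indicator (\<Union>j\<in>J. Arc N j) y :: real) = (\<Sum>j\<in>J. indicator (Arc N j) y)"
      by (rule indicator_UN_disjoint[OF fin])
    then show "(\<Sum>j\<in>J. indicator (Arc N j) y * ?W y) = indicator (\<Union>j\<in>J. Arc N j) y * ?W y"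
      by (simp only: sum_distrib_right)
  qed
  finally show ?thesis .
qed

section \<open>Local integrability of the logarithm\<close>

text \<open>For \<open>T \<ge> 0\<close> this is the negative part of the logarithm, cut off at
  height \<open>T\<close>. Taking the maximum inside \<open>ln\<close> gives the value
  \<open>T\<close> at 0, whereas \<open>ln 0 = 0\<close> would hide the zeros of
  \<open>g\<close>.\<close>

definition trunc_log :: "real \<Rightarrow> real \<Rightarrow> real" where
  "trunc_log T a = max 0 (- ln (max a (exp (- T))))"

lemma borel_measurable_trunc_log[measurable]: "trunc_log T \<in> borel_measurable borel"
  unfolding trunc_log_def by measurable

lemma trunc_log_bounds:
  assumes "T \<ge> 0" shows "0 \<le> trunc_log T a" "trunc_log T a \<le> T"
proof -
  have "ln (exp (- T)) \<le> ln (max a (exp (- T)))" by (intro ln_mono) auto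
  then show "0 \<le> trunc_log T a" "trunc_log T a \<le> T" using assms by (auto simp: trunc_log_def)
qed

lemma trunc_log_0: "trunc_log 0 a = 0"
  using ln_ge_zero[of "max a 1"] by (simp add: trunc_log_def)

lemma trunc_log_at_0: "T \<ge> 0 \<Longrightarrow> trunc_log T 0 = T"
  by (simp add: trunc_log_def max_def)

lemma trunc_log_mono:
  assumes "T \<le> T'" shows "trunc_log T a \<le> trunc_log T' a"
proof -
  have "ln (max a (exp (- T'))) \<le> ln (max a (exp (- T)))" using assms by (intro ln_mono max.mono) (auto simp: less_max_iff_disj)
  then show ?thesis by (auto simp: trunc_log_def)
qed

text \<open>This makes the integral of the truncated logarithm continuous in \<open>T\<close>, as
  needed for the intermediate value theorem.\<close>

lemma trunc_log_lipschitz: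
  assumes "T \<le> T'" shows "trunc_log T' a \<le> trunc_log T a + (T' - T)"
proof -
  have p: "max a (exp (- T)) > 0" by (simp add: less_max_iff_disj)
  have "exp (- (T' - T)) * max a (exp (- T)) = max (exp (- (T' - T)) * a) (exp (- (T' - T)) * exp (- T))"
    by (simp add: max_mult_distrib_left)
  also have "\<dots> \<le> max a (exp (- T'))"
  proof (cases "a \<ge> 0")
    case True
    then have "exp (- (T' - T)) * a \<le> 1 * a" using assms by (intro mult_right_mono) auto
    then show ?thesis by (simp flip: exp_add)
  next
    case False
    then have "exp (- (T' - T)) * a < 0" by (intro mult_pos_neg) auto
    then have "exp (- (T' - T)) * a \<le> exp (- T')" using exp_gt_zero[of "- T'"] by linarith
    then show ?thesis by (simp flip: exp_add)
  qed
  finally have "ln (exp (- (T' - T)) * max a (exp (- T))) \<le> ln (max a (exp (- T')))"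
    using p by (intro ln_mono) auto
  then have "- (T' - T) + ln (max a (exp (- T))) \<le> ln (max a (exp (- T')))"
    using p by (subst (asm) ln_mult) auto
  then show ?thesis using assms by (auto simp: trunc_log_def)
qed

text \<open>Adding the truncated negative part to the logarithm raises small values to at most 1 and
  leaves values above 1 alone.\<close>

lemma exp_trunc_log_le:
  assumes "a \<ge> 0" "T \<ge> 0" shows "exp (trunc_log T a) * a \<le> max a 1"
proof -
  have p: "max a (exp (- T)) > 0" by (simp add: less_max_iff_disj)
  show ?thesis
  proof (cases "0 \<le> - ln (max a (exp (- T)))")
    case True
    then have "exp (trunc_log T a) * a = a / max a (exp (- T))"
      using p by (simp add: trunc_log_def exp_minus field_simps)
    also have "\<dots> \<le> 1" using p by (simp add: divide_le_eq)
    finally show ?thesis by simp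
  next
    case False
    then show ?thesis by (simp add: trunc_log_def)
  qed
qed

lemma trunc_log_tendsto:
  assumes "a > 0" shows "(\<lambda>n. trunc_log (real n) a) \<longlonglongrightarrow> max 0 (- ln a)"
proof -
  have "(\<lambda>n. exp (- real n)) \<longlonglongrightarrow> 0" by real_asymp
  then have "\<forall>\<^sub>F n in sequentially. exp (- real n) < a" using assms by (rule order_tendstoD)
  then have "\<forall>\<^sub>F n in sequentially. trunc_log (real n) a = max 0 (- ln a)"
    by eventually_elim (simp add: trunc_log_def max_def)
  then show ?thesis by (rule tendsto_eventually)
qed

text \<open>As a function of \<open>T\<close> the integral starts at 0, is increasing and
  1-Lipschitz, and is unbounded on a bad set, so it takes every value \<open>A \<ge> 0\<close>. If
  it were bounded, the zeros of \<open>g\<close> in \<open>I\<close> would be null and monotone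
  convergence would make the negative part of the logarithm integrable.\<close>

lemma exists_trunc_log_integral:
  fixes g :: "complex \<Rightarrow> complex"
  assumes g: "integrable arc_measure g" and I[measurable]: "I \<in> sets borel" and A: "A \<ge> 0"
    and bad: "\<not> ((AE y in arc_measure. y \<in> I \<longrightarrow> g y \<noteq> 0) \<and> set_integrable arc_measure I (\<lambda>y. ln (cmod (g y))))"
  shows "\<exists>T\<ge>0. (\<integral>y. indicator I y * trunc_log T (cmod (g y)) \<partial>arc_measure) = A"
proof -
  have gm[measurable]: "g \<in> borel_measurable borel" using g by (auto dest: borel_measurable_integrable)
  define F where "F T = (\<integral>y. indicator I y * trunc_log T (cmod (g y)) \<partial>arc_measure)" for T
  have int: "integrable arc_measure (\<lambda>y. indicator I y * trunc_log T (cmod (g y)))" if "T \<ge> 0" for T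
    by (rule integrable_arc_bounded[of _ T]) (use trunc_log_bounds[OF that] that in \<open>auto simp: indicator_def\<close>)
  have mono: "F T \<le> F T'" if "0 \<le> T" "T \<le> T'" for T T'
    unfolding F_def using int that by (intro integral_mono) (auto simp: indicator_def trunc_log_mono)
  have lip: "F T' \<le> F T + (T' - T)" if "0 \<le> T" "T \<le> T'" for T T'
  proof -
    have "F T' \<le> (\<integral>y. indicator I y * trunc_log T (cmod (g y)) + (T' - T) \<partial>arc_measure)"
      unfolding F_def using int that
      by (intro integral_mono) (auto simp: indicator_def trunc_log_lipschitz)
    also have "\<dots> = F T + (T' - T)" using int[of T] that by (simp add: F_def)
    finally show ?thesis .
  qed
  have F0: "F 0 = 0" by (simp add: F_def trunc_log_0)
  have "\<exists>T\<ge>0. F T \<ge> A"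
  proof (rule ccontr)
    assume "\<not> ?thesis"
    then have bd: "F T \<le> A" if "T \<ge> 0" for T using that by (meson linear)
    have Z: "measure arc_measure (I \<inter> {y. g y = 0}) = 0"
    proof (rule ccontr)
      let ?m = "measure arc_measure (I \<inter> {y. g y = 0})"
      assume "?m \<noteq> 0"
      then have m: "?m > 0" using zero_less_measure_iff by blast
      \<comment> \<open>On the zero set the integrand equals \<open>T\<close>, so this choice forces
        the integral to be at least \<open>A + 1\<close>, against the bound
        \<open>A\<close>.\<close>
      define T where "T = (A + 1) / ?m"
      have T: "T \<ge> 0" using m A by (simp add: T_def)
      have "A + 1 = T * ?m" using m by (simp add: T_def)
      also have "\<dots> = (\<integral>y. T * indicator (I \<inter> {y. g y = 0}) y \<partial>arc_measure)" by simp
      also have "\<dots> \<le> F T" unfolding F_def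
      proof (rule integral_mono)
        show "integrable arc_measure (\<lambda>y. T * indicator (I \<inter> {y. g y = 0}) y)"
          by (intro integrable_mult_right integrable_arc_bounded[of _ 1]) (auto simp: indicator_def)
        show "T * indicator (I \<inter> {y. g y = 0}) y \<le> indicator I y * trunc_log T (cmod (g y))" for y
          using trunc_log_bounds[OF T] trunc_log_at_0[OF T] T by (auto simp: indicator_def)
      qed (rule int[OF T])
      also have "\<dots> \<le> A" by (rule bd[OF T])
      finally show False by simp
    qed
    then have nz: "AE y in arc_measure. y \<in> I \<longrightarrow> g y \<noteq> 0"
      by (intro AE_I'[of "I \<inter> {y. g y = 0}"]) (auto simp: null_sets_def arc_measure.emeasure_eq_measure)
    have "incseq (\<lambda>n. F (real n))" by (intro monoI mono) auto
    then obtain L where L: "(\<lambda>n. F (real n)) \<longlonglongrightarrow> L"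
      using incseq_convergent[of "\<lambda>n. F (real n)" A] bd by (metis of_nat_0_le_iff)
    have minus: "integrable arc_measure (\<lambda>y. indicator I y * max 0 (- ln (cmod (g y))))"
    proof (rule integrable_monotone_convergence[OF _ _ _ L[unfolded F_def]])
      show "AE y in arc_measure. mono (\<lambda>n. indicator I y * trunc_log (real n) (cmod (g y)))"
        by (auto simp: mono_def indicator_def trunc_log_mono)
      show "AE y in arc_measure. (\<lambda>n. indicator I y * trunc_log (real n) (cmod (g y))) \<longlonglongrightarrow> indicator I y * max 0 (- ln (cmod (g y)))"
        using nz by eventually_elim (auto simp: indicator_def intro!: trunc_log_tendsto)
    qed (use int in auto)
    \<comment> \<open>The positive part of the logarithm is always integrable, being at most
      \<open>\<bar>g\<bar>\<close>; only the negative part can diverge.\<close>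
    have plus: "integrable arc_measure (\<lambda>y. indicator I y * max 0 (ln (cmod (g y))))"
    proof (rule Bochner_Integration.integrable_bound[OF integrable_norm[OF g]])
      have "max 0 (ln a) \<le> a" if "a \<ge> 0" for a :: real
        using that ln_le_minus_one[of a] by (cases "a = 0") auto
      then show "AE y in arc_measure. norm (indicator I y * max 0 (ln (cmod (g y)))) \<le> norm (cmod (g y))"
        by (intro AE_I2) (simp add: indicator_def)
    qed simp
    have "indicator I y *\<^sub>R ln (cmod (g y)) = indicator I y * max 0 (ln (cmod (g y))) - indicator I y * max 0 (- ln (cmod (g y)))" for y
      by (auto simp: indicator_def)
    then have "set_integrable arc_measure I (\<lambda>y. ln (cmod (g y)))"
      unfolding set_integrable_def using Bochner_Integration.integrable_diff[OF plus minus] by simp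
    with nz bad show False by blast
  qed
  then obtain T1 where T1: "T1 \<ge> 0" "A \<le> F T1" by blast
  have "continuous_on {0..T1} F"
  proof (rule lipschitz_on_continuous_on)
    show "1-lipschitz_on {0..T1} F"
    proof (rule lipschitz_onI)
      fix x y assume "x \<in> {0..T1}" "y \<in> {0..T1}"
      then show "dist (F x) (F y) \<le> 1 * dist x y"
        using lip[of x y] lip[of y x] mono[of x y] mono[of y x]
        by (cases "x \<le> y") (auto simp: dist_real_def)
    qed simp
  qed
  from IVT'[of F 0 A T1, OF _ T1(2) T1(1) this] F0 A show ?thesis unfolding F_def by auto
qed

text \<open>Cauchy's estimate at radius \<open>1 - t\<close> with the balancing value
  \<open>t = sqrt (d / j)\<close>: the exponent \<open>d / t + 2 * t * j\<close> becomes
  \<open>3 * sqrt (d * j)\<close>. The condition \<open>d \<le> 1 / 4\<close> keeps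
  \<open>t \<le> 1 / 2\<close>, where \<open>1 / (1 - t) \<le> exp (2 * t)\<close>. The factor
  \<open>exp 1\<close> absorbs the case \<open>j = 0\<close>, in which no such \<open>t\<close> is
  available.\<close>

lemma taylor_coeff_outer_fun_bound:
  assumes \<phi>: "integrable arc_measure \<phi>" and r: "0 < r" "r < 1" and d: "0 < d" "d \<le> 1 / 4"
    and b: "\<And>z. cmod z < 1 \<Longrightarrow> cmod (herglotz \<phi> z) \<le> d / (1 - cmod z)"
  shows "cmod (taylor_coeff (outer_fun r \<phi>) j) \<le> exp 1 * exp (3 * sqrt d * sqrt (real j))"
proof -
  have hol: "outer_fun r \<phi> holomorphic_on ball 0 (1 / r)" by (rule outer_fun_holomorphic[OF \<phi> r])
  have R: "1 / r > 1" using r by simp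
  have hb: "cmod (outer_fun r \<phi> w) \<le> exp (d / (1 - s))" if "cmod w = s" "s < 1" for w s
  proof -
    have rw: "cmod (of_real r * w) \<le> s" using norm_ge_zero[of w] that r mult_left_le_one_le[of "cmod w" r] by (simp add: norm_mult)
    have "Re (herglotz \<phi> (of_real r * w)) \<le> cmod (herglotz \<phi> (of_real r * w))" by (rule complex_Re_le_cmod)
    also have "\<dots> \<le> d / (1 - cmod (of_real r * w))" using rw that by (intro b) auto
    also have "\<dots> \<le> d / (1 - s)" using rw that d by (intro divide_left_mono mult_pos_pos) auto
    finally show ?thesis by (simp add: norm_outer_fun)
  qed
  show ?thesis
  proof (cases "j = 0")
    case True
    have "cmod (taylor_coeff (outer_fun r \<phi>) 0) = cmod (outer_fun r \<phi> 0)" by (simp add: taylor_coeff_def)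
    also have "\<dots> \<le> exp d" using hb[of 0 0] by simp
    also have "\<dots> \<le> exp 1" using d by simp
    finally show ?thesis using True by simp
  next
    case False
    define t where "t = sqrt (d / real j)"
    have j: "real j \<ge> 1" using False by linarith
    have "d / real j \<le> 1 / 4" using d j by (simp add: divide_le_eq)
    then have "t \<le> sqrt (1 / 4)" unfolding t_def by (rule real_sqrt_le_mono)
    then have t: "0 < t" "t \<le> 1 / 2" using d j by (auto simp: t_def real_sqrt_divide)
    have gen: "a / s * (s * s) = a * s" "a * a / (a / s) = a * s" if "a \<noteq> 0" "s \<noteq> 0" for a s :: real
      using that by auto
    have tj: "t * real j = sqrt d * sqrt (real j)" and dt: "d / t = sqrt d * sqrt (real j)"
      using gen[of "sqrt d" "sqrt (real j)"] d j by (simp_all add: t_def real_sqrt_divide)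
    have "cmod (taylor_coeff (outer_fun r \<phi>) j) \<le> exp (d / t) / (1 - t) ^ j"
      by (rule taylor_coeff_bound[OF hol]) (use t R hb[of _ "1 - t"] in auto)
    also have "\<dots> = exp (d / t) * (1 / (1 - t)) ^ j" by (simp add: power_divide)
    also have "\<dots> \<le> exp (d / t) * exp (2 * t) ^ j"
    proof (intro mult_left_mono power_mono)
      have "0 \<le> t * (1 - 2 * t)" using t by (intro mult_nonneg_nonneg) auto
      then have "1 \<le> (1 + 2 * t) * (1 - t)" by (simp add: algebra_simps)
      then have "1 / (1 - t) \<le> 1 + 2 * t" using t by (simp add: divide_le_eq)
      also have "\<dots> \<le> exp (2 * t)" by (rule exp_ge_add_one_self)
      finally show "1 / (1 - t) \<le> exp (2 * t)" .
    qed (use t in auto)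
    also have "\<dots> = exp (d / t + 2 * (t * real j))" by (simp add: exp_add exp_of_nat_mult[symmetric] mult_ac)
    also have "\<dots> = exp (3 * sqrt d * sqrt (real j))" unfolding tj dt by simp
    also have "\<dots> \<le> exp 1 * exp (3 * sqrt d * sqrt (real j))" by simp
    finally show ?thesis .
  qed
qed

text \<open>For bounded \<phi> the Poisson integrals obey the same upper bound, which dominates the
  integrand. Convergence in \<open>L1\<close> gives convergence almost everywhere along a
  subsequence, and one good radius is all that is asked for.\<close>

lemma exists_radius_approximating:
  fixes g :: "complex \<Rightarrow> complex"
  assumes g: "integrable arc_measure g" and \<phi>[measurable]: "\<phi> \<in> borel_measurable borel"
    and T: "\<And>y. \<bar>\<phi> y\<bar> \<le> T" and e: "e > 0"
  shows "\<exists>k. (\<integral>x. \<bar>exp (Re (herglotz \<phi> (of_real (rad k) * cnj x))) - exp (\<phi> x)\<bar> * cmod (g x) \<partial>arc_measure) < e"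
proof -
  have [measurable]: "g \<in> borel_measurable borel" using g by (auto dest: borel_measurable_integrable)
  let ?P = "\<lambda>k x. Re (herglotz \<phi> (of_real (rad k) * cnj x))"
  have \<phi>i: "integrable arc_measure \<phi>" using T by (intro integrable_arc_bounded) auto
  have i: "integrable arc_measure (\<lambda>x. ?P k x - \<phi> x)" for k
    using integrable_poisson_integral[OF \<phi>i, of "rad k"] rad[of k] \<phi>i by simp
  have "(\<lambda>k. \<integral>x. norm (?P k x - \<phi> x) \<partial>arc_measure) \<longlonglongrightarrow> 0"
    using poisson_integral_L1_tendsto[OF \<phi>i] by simp
  from tendsto_L1_AE_subseq[OF i this] obtain s where s: "strict_mono s"
    "AE x in arc_measure. (\<lambda>n. ?P (s n) x - \<phi> x) \<longlonglongrightarrow> 0" by blast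
  have "(\<lambda>n. \<integral>x. \<bar>exp (?P (s n) x) - exp (\<phi> x)\<bar> * cmod (g x) \<partial>arc_measure) \<longlonglongrightarrow> (\<integral>x. 0 \<partial>arc_measure)"
  proof (rule integral_dominated_convergence[where w="\<lambda>x. (exp T + exp T) * cmod (g x)"])
    show "AE x in arc_measure. (\<lambda>n. \<bar>exp (?P (s n) x) - exp (\<phi> x)\<bar> * cmod (g x)) \<longlonglongrightarrow> 0"
      using s(2)
    proof eventually_elim
      case (elim x)
      then have "(\<lambda>n. ?P (s n) x) \<longlonglongrightarrow> \<phi> x" by (rule LIM_zero_cancel)
      then have "(\<lambda>n. \<bar>exp (?P (s n) x) - exp (\<phi> x)\<bar> * cmod (g x)) \<longlonglongrightarrow> \<bar>exp (\<phi> x) - exp (\<phi> x)\<bar> * cmod (g x)"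
        by (intro tendsto_intros)
      then show ?case by simp
    qed
    show "AE x in arc_measure. norm (\<bar>exp (?P (s n) x) - exp (\<phi> x)\<bar> * cmod (g x)) \<le> (exp T + exp T) * cmod (g x)" for n
      using AE_arc_measure_circle
    proof eventually_elim
      case (elim x)
      have "cmod (of_real (rad (s n)) * cnj x) < 1" using elim rad[of "s n"] by (simp add: norm_mult)
      from Re_herglotz_le[OF \<phi>i this, of T] have "?P (s n) x \<le> T" using T by (auto simp: abs_le_iff)
      moreover have "\<phi> x \<le> T" using T[of x] by simp
      ultimately have "exp (?P (s n) x) \<le> exp T" "exp (\<phi> x) \<le> exp T" by auto
      moreover have "0 < exp (?P (s n) x)" "0 < exp (\<phi> x)" by auto
      ultimately have "\<bar>exp (?P (s n) x) - exp (\<phi> x)\<bar> \<le> exp T + exp T" by linarith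
      then have "\<bar>exp (?P (s n) x) - exp (\<phi> x)\<bar> * cmod (g x) \<le> (exp T + exp T) * cmod (g x)"
        by (rule mult_right_mono) simp
      then show ?case by (simp add: abs_mult)
    qed
  qed (use g in auto)
  then have "(\<lambda>n. \<integral>x. \<bar>exp (?P (s n) x) - exp (\<phi> x)\<bar> * cmod (g x) \<partial>arc_measure) \<longlonglongrightarrow> 0" by simp
  then have "\<forall>\<^sub>F n in sequentially. (\<integral>x. \<bar>exp (?P (s n) x) - exp (\<phi> x)\<bar> * cmod (g x) \<partial>arc_measure) < e"
    using e by (rule order_tendstoD)
  then show ?thesis by (auto simp: eventually_sequentially)
qed

text \<open>Every arc of the \<open>n\<close>-th partition that meets \<open>E\<close> carries a function \<open>\<phi>\<close> of mean zero which
  equals \<open>- A\<close> except where \<open>g\<close> is so small that \<open>exp \<phi> * \<bar>g\<bar>\<close> is still of size \<open>exp (- A)\<close>; the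
  divergence of the logarithmic integral provides the room for this. Away from \<open>E\<close> one takes
  \<open>\<phi> = 0\<close>.\<close>
theorem vanishing_off_log_integrable_arcs:
  fixes g :: "complex \<Rightarrow> complex"
  assumes g: "integrable arc_measure g"
    and decay: "\<And>k. cmod (\<integral>x. cnj x ^ k * g x \<partial>arc_measure) \<le> B * exp (- c * sqrt (real k))" and c: "c > 0"
    and E: "closed E"
    and bad: "\<And>I. open_arc I \<Longrightarrow> I \<inter> E \<noteq> {} \<Longrightarrow>
      \<not> ((AE y in arc_measure. y \<in> I \<longrightarrow> g y \<noteq> 0) \<and> set_integrable arc_measure I (\<lambda>y. ln (cmod (g y))))"
  shows "AE x in arc_measure. x \<in> E \<longrightarrow> g x = 0"
proof -
  have [measurable]: "g \<in> borel_measurable borel" using g by (auto dest: borel_measurable_integrable)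
  have Eb[measurable]: "E \<in> sets borel" using E by auto
  define w where "w x = cmod (g x)" for x
  have [measurable]: "w \<in> borel_measurable borel" unfolding w_def by measurable
  have wi: "integrable arc_measure w" unfolding w_def using g by simp
  have w0: "w x \<ge> 0" for x by (simp add: w_def)
  \<comment> \<open>\<open>W\<close> is the integrable majorant of
    \<open>exp (\<phi> n y) * w y\<close> for all \<open>n\<close> at once.\<close>
  define W where "W x = max (w x) 1" for x
  have Wi: "integrable arc_measure W" unfolding W_def using wi by (intro integrable_max) auto
  have [measurable]: "W \<in> borel_measurable borel" unfolding W_def by measurable
  have Ww: "w x \<le> W x" "0 \<le> W x" for x using w0[of x] by (auto simp: W_def)
  \<comment> \<open>The bound \<open>1 / 4\<close> is the one required by the coefficient estimate;
    \<open>(c / 6)\<^sup>2\<close> ensures \<open>3 * sqrt \<delta>0 \<le> c / 2\<close>, half of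
    the available decay rate.\<close>
  define \<delta>0 where "\<delta>0 = min (1 / 4) ((c / 6)\<^sup>2)"
  have \<delta>0: "\<delta>0 > 0" "\<delta>0 \<le> 1 / 4" using c by (auto simp: \<delta>0_def)
  have s\<delta>0: "sqrt \<delta>0 \<le> c / 6"
    using real_sqrt_le_mono[of \<delta>0 "(c / 6)\<^sup>2"] c by (simp add: \<delta>0_def)
  \<comment> \<open>With \<open>A n = n + 1\<close> and \<open>N n = (n + p)\<^sup>2\<close> one
    gets \<open>\<delta> n \<le> 8 * pi / (n + p)\<close>, so a large \<open>p\<close> keeps every
    \<open>\<delta> n\<close> below \<open>\<delta>0\<close>, while \<open>A n\<close> grows and
    \<open>A n / N n\<close> tends to 0.\<close>
  obtain p0 :: nat where p0: "8 * pi / \<delta>0 < real p0" using reals_Archimedean2 by blast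
  define p where "p = p0 + 2"
  have p: "p \<ge> 2" "8 * pi / \<delta>0 \<le> real p" using p0 by (auto simp: p_def)
  define N where "N n = (n + p)\<^sup>2" for n :: nat
  define A where "A n = real n + 1" for n :: nat
  \<comment> \<open>This is the product of \<open>2 * A n / N n\<close>, the \<open>L1\<close> bound
    on one arc, and \<open>4 * pi\<close>, the constant in the bound for the total variation of the
    kernel.\<close>
  define \<delta> where "\<delta> n = 8 * pi * A n / real (N n)" for n
  have Nge: "N n \<ge> 2" for n
  proof -
    have "2 * 2 \<le> (n + p) * (n + p)" using p(1) by (intro mult_mono) auto
    then show ?thesis by (simp add: N_def power2_eq_square)
  qed
  have Npos: "real (N n) > 0" for n using Nge[of n] by linarith
  have Ap: "A n > 0" for n by (simp add: A_def)
  have \<delta>pos: "\<delta> n > 0" for n using Ap[of n] Npos[of n] by (simp add: \<delta>_def)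
  have \<delta>le: "\<delta> n \<le> \<delta>0" for n
  proof -
    have np: "real n + real p > 0" using p(1) by simp
    have "\<delta> n \<le> 8 * pi * (real n + real p) / (real n + real p)\<^sup>2"
      using p(1) by (auto simp: \<delta>_def A_def N_def intro!: divide_right_mono)
    also have "\<dots> = 8 * pi / (real n + real p)" using np by (simp add: power2_eq_square)
    also have "\<dots> \<le> 8 * pi / real p" using p(1) by (intro divide_left_mono mult_pos_pos) auto
    also have "\<dots> \<le> \<delta>0" using p \<delta>0 by (simp add: divide_le_eq mult.commute)
    finally show ?thesis .
  qed
  have \<delta>lim: "\<delta> \<longlonglongrightarrow> 0" unfolding \<delta>_def A_def N_def by (simp only: of_nat_power of_nat_add) real_asymp
  have Nlim: "(\<lambda>n. 2 * pi / real (N n)) \<longlonglongrightarrow> 0" unfolding N_def by (simp only: of_nat_power of_nat_add) real_asymp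
  define J where "J n = {j. j < N n \<and> Arc (N n) j \<inter> E \<noteq> {}}" for n
  have fJ: "finite (J n)" for n unfolding J_def by (rule finite_subset[of _ "{..<N n}"]) auto
  have JN: "J n \<subseteq> {..<N n}" for n by (auto simp: J_def)
  have [measurable]: "Arc (N n) j \<in> sets borel" for n j using Arc_borel[OF Nge] .
  have ex: "\<exists>T. T \<ge> 0 \<and> (\<integral>y. indicator (Arc (N n) j) y * trunc_log T (w y) \<partial>arc_measure) = A n / real (N n)" if "j \<in> J n" for n j
  proof -
    have "Arc (N n) j \<inter> E \<noteq> {}" using that by (simp add: J_def)
    from exists_trunc_log_integral[OF g Arc_borel[OF Nge] _ bad[OF open_arc_Arc[OF Nge] this], of "A n / real (N n)"]
    show ?thesis unfolding w_def using Ap[of n] by simp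
  qed
  \<comment> \<open>The truncation height is determined by the divergent integral only for
    \<open>j\<close> in \<open>J n\<close>; sums over arcs below run over \<open>J n\<close>
    alone.\<close>
  define T where "T n j = (SOME T. T \<ge> 0 \<and> (\<integral>y. indicator (Arc (N n) j) y * trunc_log T (w y) \<partial>arc_measure) = A n / real (N n))" for n j
  have T: "T n j \<ge> 0" "(\<integral>y. indicator (Arc (N n) j) y * trunc_log (T n j) (w y) \<partial>arc_measure) = A n / real (N n)"
    if "j \<in> J n" for n j
    using someI_ex[OF ex[OF that]] unfolding T_def[symmetric] by blast+
  \<comment> \<open>The truncated logarithm has integral \<open>A n / N n\<close> over the arc,
    which is \<open>A n\<close> times the measure of the arc, so \<open>\<psi> n j\<close> has mean
    zero there and \<open>L1\<close> norm at most twice this amount.\<close>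
  define \<psi> where "\<psi> n j y = trunc_log (T n j) (w y) - A n" for n j y
  define \<phi> where "\<phi> n y = (\<Sum>j\<in>J n. indicator (Arc (N n) j) y * \<psi> n j y)" for n y
  define V where "V n = (\<Union>j\<in>J n. Arc (N n) j)" for n
  have [measurable]: "V n \<in> sets borel" for n unfolding V_def using fJ by (intro sets.finite_UN) auto
  have [measurable]: "\<psi> n j \<in> borel_measurable borel" for n j unfolding \<psi>_def by measurable
  have [measurable]: "\<phi> n \<in> borel_measurable borel" for n unfolding \<phi>_def by measurable
  have \<psi>b: "\<bar>\<psi> n j y\<bar> \<le> trunc_log (T n j) (w y) + A n" "trunc_log (T n j) (w y) \<le> T n j" "0 \<le> trunc_log (T n j) (w y)"
    if "j \<in> J n" for n j y
    using trunc_log_bounds[OF T(1)[OF that], of "w y"] Ap[of n] by (auto simp: \<psi>_def)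
  have \<phi>V: "\<phi> n y = \<psi> n j y" if "j \<in> J n" "y \<in> Arc (N n) j" for n j y
  proof -
    have "\<phi> n y = (\<Sum>i\<in>J n. if i = j then \<psi> n j y else 0)"
      unfolding \<phi>_def
    proof (rule sum.cong[OF refl])
      fix i assume i: "i \<in> J n"
      show "indicator (Arc (N n) i) y * \<psi> n i y = (if i = j then \<psi> n j y else 0)"
        using Arc_disjoint[of i "N n" j y] i that JN[of n] by (auto simp: indicator_def)
    qed
    then show ?thesis using that fJ by simp
  qed
  have \<phi>0: "\<phi> n y = 0" if "y \<notin> V n" for n y
    using that unfolding \<phi>_def V_def by (intro sum.neutral) auto
  have \<phi>b: "\<bar>\<phi> n y\<bar> \<le> (\<Sum>j\<in>J n. T n j + A n)" for n y
    unfolding \<phi>_def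
  proof (rule order_trans[OF sum_abs], rule sum_mono)
    fix j assume j: "j \<in> J n"
    show "\<bar>indicator (Arc (N n) j) y * \<psi> n j y\<bar> \<le> T n j + A n"
      using \<psi>b[OF j, of y] T(1)[OF j] Ap[of n] by (auto simp: indicator_def)
  qed
  have \<phi>i: "integrable arc_measure (\<phi> n)" for n
    using \<phi>b by (intro integrable_arc_bounded) auto
  have e\<phi>V: "exp (\<phi> n y) * w y \<le> exp (- A n) * W y" if yV: "y \<in> V n" for n y
  proof -
    obtain j where j: "j \<in> J n" "y \<in> Arc (N n) j" using yV by (auto simp: V_def)
    have "exp (\<phi> n y) * w y = exp (- A n) * (exp (trunc_log (T n j) (w y)) * w y)"
      unfolding \<phi>V[OF j] \<psi>_def by (simp add: exp_diff exp_minus field_simps)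
    also have "\<dots> \<le> exp (- A n) * W y"
      unfolding W_def using exp_trunc_log_le[OF w0 T(1)[OF j(1)]] by (intro mult_left_mono) auto
    finally show ?thesis .
  qed
  have e\<phi>: "exp (\<phi> n y) * w y \<le> W y" for n y
  proof (cases "y \<in> V n")
    case True
    have "exp (- A n) * W y \<le> 1 * W y" using Ap[of n] Ww by (intro mult_right_mono) auto
    with e\<phi>V[OF True] show ?thesis by simp
  qed (use \<phi>0 Ww in simp)
  have trunc_i: "integrable arc_measure (\<lambda>y. indicator (Arc (N n) j) y * trunc_log (T n j) (w y))" if "j \<in> J n" for n j
    using \<psi>b[OF that] T(1)[OF that] by (intro integrable_arc_bounded[of _ "T n j"]) (auto simp: indicator_def)
  have const_i: "integrable arc_measure (\<lambda>y. indicator (Arc (N n) j) y * A n)" for n j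
    by (intro integrable_mult_left integrable_arc_bounded[of _ 1]) (auto simp: indicator_def)
  have const_I: "(\<integral>y. indicator (Arc (N n) j) y * A n \<partial>arc_measure) = A n / real (N n)" if "j \<in> J n" for n j
    using measure_Arc[OF Nge, of j n] that by (simp add: J_def)
  have key: "cmod (herglotz (\<phi> n) z) \<le> 2 * A n / real (N n) *
      (\<integral>y. indicator (V n) y * (4 * pi * cmod z / (cmod (1 - z * y))\<^sup>2) \<partial>arc_measure)" if z: "cmod z < 1" for n z
    unfolding \<phi>_def V_def
  proof (rule herglotz_mean_zero_bound[OF z Nge JN])
    fix j assume j: "j \<in> J n"
    show "integrable arc_measure (\<psi> n j)"
    proof (rule integrable_arc_bounded)
      show "\<bar>\<psi> n j y\<bar> \<le> T n j + A n" for y using \<psi>b(1,2)[OF j, of y] by linarith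
    qed simp
    have "(\<integral>y. indicator (Arc (N n) j) y * \<psi> n j y \<partial>arc_measure)
       = (\<integral>y. indicator (Arc (N n) j) y * trunc_log (T n j) (w y) - indicator (Arc (N n) j) y * A n \<partial>arc_measure)"
      by (simp add: \<psi>_def right_diff_distrib)
    also have "\<dots> = 0"
      unfolding Bochner_Integration.integral_diff[OF trunc_i[OF j] const_i] T(2)[OF j] const_I[OF j] by simp
    finally show "(\<integral>y. indicator (Arc (N n) j) y * \<psi> n j y \<partial>arc_measure) = 0" .
    have "(\<integral>y. indicator (Arc (N n) j) y * \<bar>\<psi> n j y\<bar> \<partial>arc_measure)
       \<le> (\<integral>y. indicator (Arc (N n) j) y * trunc_log (T n j) (w y) + indicator (Arc (N n) j) y * A n \<partial>arc_measure)"
    proof (rule integral_mono_AE')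
      show "integrable arc_measure (\<lambda>y. indicator (Arc (N n) j) y * trunc_log (T n j) (w y) + indicator (Arc (N n) j) y * A n)"
        by (rule Bochner_Integration.integrable_add[OF trunc_i[OF j] const_i])
      show "AE y in arc_measure. indicator (Arc (N n) j) y * \<bar>\<psi> n j y\<bar>
          \<le> indicator (Arc (N n) j) y * trunc_log (T n j) (w y) + indicator (Arc (N n) j) y * A n"
        by (rule AE_I2) (use \<psi>b(1)[OF j] in \<open>auto simp: indicator_def\<close>)
      show "AE y in arc_measure. 0 \<le> indicator (Arc (N n) j) y * trunc_log (T n j) (w y) + indicator (Arc (N n) j) y * A n"
        by (rule AE_I2) (use \<psi>b(3)[OF j] Ap[of n] in \<open>auto simp: indicator_def intro!: add_nonneg_nonneg less_imp_le\<close>)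
    qed
    also have "\<dots> = 2 * A n / real (N n)"
      unfolding Bochner_Integration.integral_add[OF trunc_i[OF j] const_i] T(2)[OF j] const_I[OF j] by simp
    finally show "(\<integral>y. indicator (Arc (N n) j) y * \<bar>\<psi> n j y\<bar> \<partial>arc_measure) \<le> 2 * A n / real (N n)" .
  qed
  have AN0: "0 \<le> 2 * A n / real (N n)" for n using Ap[of n] Npos[of n] by simp
  \<comment> \<open>Because \<open>\<bar>z\<bar> * (1 - \<bar>z\<bar>) \<le> 1 -
    \<bar>z\<bar>\<^sup>2\<close>, the variation weight is at most
    \<open>4 * pi / (1 - \<bar>z\<bar>)\<close> times the Poisson kernel, which has integral
    1.\<close>
  have bd: "cmod (herglotz (\<phi> n) z) \<le> \<delta> n / (1 - cmod z)" if z: "cmod z < 1" for n z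
  proof -
    have z1: "1 - (cmod z)\<^sup>2 > 0" using z by (simp add: power_less_one_iff abs_square_less_1)
    have pi1: "integrable arc_measure (\<lambda>y. 4 * pi / (1 - cmod z) * poisson z y)"
      by (rule integrable_poisson[OF _ z]) simp
    have "(\<integral>y. indicator (V n) y * (4 * pi * cmod z / (cmod (1 - z * y))\<^sup>2) \<partial>arc_measure) \<le> (\<integral>y. 4 * pi / (1 - cmod z) * poisson z y \<partial>arc_measure)"
    proof (rule integral_mono_AE[OF kernel_weight_integrable[OF z] pi1])
      show "AE y in arc_measure. indicator (V n) y * (4 * pi * cmod z / (cmod (1 - z * y))\<^sup>2) \<le> 4 * pi / (1 - cmod z) * poisson z y"
        using AE_arc_measure_circle
      proof eventually_elim
        case (elim y)
        have n0: "cmod (1 - z * y) > 0" using one_minus_norm_le[OF elim, of z] z by linarith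
        have "cmod z * (1 - cmod z) \<le> 1 * (1 - cmod z)" using z by (intro mult_right_mono) auto
        also have "\<dots> \<le> (1 + cmod z) * (1 - cmod z)" using z by (intro mult_right_mono) auto
        also have "\<dots> = 1 - (cmod z)\<^sup>2" by (simp add: power2_eq_square algebra_simps)
        finally have "cmod z \<le> (1 - (cmod z)\<^sup>2) / (1 - cmod z)" using z by (simp add: pos_le_divide_eq)
        then have "4 * pi * cmod z / (cmod (1 - z * y))\<^sup>2 \<le> 4 * pi * ((1 - (cmod z)\<^sup>2) / (1 - cmod z)) / (cmod (1 - z * y))\<^sup>2"
          by (intro divide_right_mono mult_left_mono) auto
        also have "\<dots> = 4 * pi / (1 - cmod z) * poisson z y" unfolding poisson_eq[OF elim] by simp
        finally have "4 * pi * cmod z / (cmod (1 - z * y))\<^sup>2 \<le> 4 * pi / (1 - cmod z) * poisson z y" .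
        moreover have "0 \<le> 4 * pi / (1 - cmod z) * poisson z y" using z poisson_nonneg[OF elim z] by simp
        ultimately show ?case by (auto simp: indicator_def)
      qed
    qed simp
    also have "\<dots> = 4 * pi / (1 - cmod z)" using integral_poisson[OF z] by simp
    finally have "cmod (herglotz (\<phi> n) z) \<le> 2 * A n / real (N n) * (4 * pi / (1 - cmod z))"
      using key[OF z, of n] AN0[of n] by (meson mult_left_mono order_trans)
    also have "\<dots> = \<delta> n / (1 - cmod z)" by (simp add: \<delta>_def)
    finally show ?thesis .
  qed
  have "\<exists>k. (\<integral>x. \<bar>exp (Re (herglotz (\<phi> n) (of_real (rad k) * cnj x))) - exp (\<phi> n x)\<bar> * cmod (g x) \<partial>arc_measure) < 1 / (real n + 1)" for n
    by (rule exists_radius_approximating[OF g _ \<phi>b]) auto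
  then obtain k where k: "\<And>n. (\<integral>x. \<bar>exp (Re (herglotz (\<phi> n) (of_real (rad (k n)) * cnj x))) - exp (\<phi> n x)\<bar> * cmod (g x) \<partial>arc_measure) < 1 / (real n + 1)"
    by metis
  define r where "r n = rad (k n)" for n
  have r: "0 < r n" "r n < 1" for n using rad by (auto simp: r_def)
  define h where "h n x = outer_fun (r n) (\<phi> n) (cnj x)" for n x
  have [measurable]: "h n \<in> borel_measurable borel" for n unfolding h_def by measurable
  \<comment> \<open>The radius is chosen so that this error between the modulus of
    \<open>h n\<close> and its boundary target, weighted by \<open>\<bar>g\<bar>\<close>, tends to
    zero in \<open>L1\<close>.\<close>
  define D where "D n x = \<bar>cmod (h n x) - exp (\<phi> n x)\<bar> * w x" for n x
  have [measurable]: "D n \<in> borel_measurable borel" for n unfolding D_def by measurable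
  have Dk: "(\<integral>x. D n x \<partial>arc_measure) < 1 / (real n + 1)" for n
    using k[of n] by (simp add: D_def h_def norm_outer_fun r_def w_def)
  have D0: "0 \<le> D n x" for n x using w0 by (simp add: D_def)
  have Di: "integrable arc_measure (D n)" for n
  proof (rule Bochner_Integration.integrable_bound)
    show "integrable arc_measure (\<lambda>x. (exp (\<Sum>j\<in>J n. T n j + A n) + exp (\<Sum>j\<in>J n. T n j + A n)) * w x)" using wi by simp
    show "AE x in arc_measure. norm (D n x) \<le> norm ((exp (\<Sum>j\<in>J n. T n j + A n) + exp (\<Sum>j\<in>J n. T n j + A n)) * w x)"
      using AE_arc_measure_circle
    proof eventually_elim
      case (elim x)
      let ?S = "\<Sum>j\<in>J n. T n j + A n"
      have "cmod (of_real (r n) * cnj x) < 1" using elim r[of n] by (simp add: norm_mult)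
      from Re_herglotz_le[OF \<phi>i this, of n ?S] have "cmod (h n x) \<le> exp ?S"
        using \<phi>b[of n] by (auto simp: h_def norm_outer_fun abs_le_iff)
      moreover have "exp (\<phi> n x) \<le> exp ?S" using \<phi>b[of n x] by simp
      moreover have "0 \<le> cmod (h n x)" "0 < exp (\<phi> n x)" by auto
      ultimately have "\<bar>cmod (h n x) - exp (\<phi> n x)\<bar> \<le> exp ?S + exp ?S" by linarith
      then have "D n x \<le> (exp ?S + exp ?S) * w x" unfolding D_def using w0 by (rule mult_right_mono)
      then show ?case using D0[of n x] by simp
    qed
  qed simp
  have Dlim: "(\<lambda>n. \<integral>x. D n x \<partial>arc_measure) \<longlonglongrightarrow> 0"
  proof (rule Lim_null_comparison)
    show "(\<lambda>n. 1 / (real n + 1)) \<longlonglongrightarrow> 0" by real_asymp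
    show "\<forall>\<^sub>F n in sequentially. norm (\<integral>x. D n x \<partial>arc_measure) \<le> 1 / (real n + 1)"
      using Dk D0 by (intro always_eventually allI) (simp add: integral_nonneg_AE less_imp_le)
  qed
  have hle: "cmod (h n x) * w x \<le> D n x + exp (\<phi> n x) * w x" for n x
  proof -
    have "cmod (h n x) * w x \<le> (\<bar>cmod (h n x) - exp (\<phi> n x)\<bar> + exp (\<phi> n x)) * w x"
      using w0 by (intro mult_right_mono) auto
    then show ?thesis by (simp add: D_def distrib_right)
  qed
  \<comment> \<open>The arcs in \<open>V n\<close> meet \<open>E\<close> and shrink, so eventually
    they stay at distance \<open>\<rho> / 2\<close> from \<open>x\<close>, where the kernel
    denominators are at least \<open>\<rho> / 4\<close> in modulus for every radius. The variation
    is then bounded, and the factor \<open>2 * A n / N n\<close> drives the Herglotz integral to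
    0.\<close>
  have hconv: "(\<lambda>n. cmod (h n x - 1)) \<longlonglongrightarrow> 0" if x: "cmod x = 1" "x \<notin> E" for x
  proof -
    obtain \<rho> where \<rho>: "\<rho> > 0" "ball x \<rho> \<inter> E = {}"
      using E x(2) by (metis Compl_iff Int_commute disjoint_eq_subset_Compl openE open_Compl)
    have "(\<lambda>n. herglotz (\<phi> n) (of_real (r n) * cnj x)) \<longlonglongrightarrow> 0"
    proof (rule Lim_null_comparison)
      show "(\<lambda>n. 16 / \<rho>\<^sup>2 * \<delta> n) \<longlonglongrightarrow> 0" using \<delta>lim by (rule tendsto_mult_right_zero)
      have "\<forall>\<^sub>F n in sequentially. 2 * pi / real (N n) < \<rho> / 2"
        using Nlim \<rho> by (intro order_tendstoD) auto
      then show "\<forall>\<^sub>F n in sequentially. norm (herglotz (\<phi> n) (of_real (r n) * cnj x)) \<le> 16 / \<rho>\<^sup>2 * \<delta> n"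
      proof eventually_elim
        case (elim n)
        define z where "z = of_real (r n) * cnj x"
        have cz: "cmod z = r n" using r[of n] x by (simp add: z_def norm_mult)
        have z: "cmod z < 1" using cz r by simp
        have "(\<integral>y. indicator (V n) y * (4 * pi * cmod z / (cmod (1 - z * y))\<^sup>2) \<partial>arc_measure) \<le> (\<integral>y. 64 * pi / \<rho>\<^sup>2 \<partial>arc_measure)"
        proof (rule integral_mono_AE[OF kernel_weight_integrable[OF z]])
          show "AE y in arc_measure. indicator (V n) y * (4 * pi * cmod z / (cmod (1 - z * y))\<^sup>2) \<le> 64 * pi / \<rho>\<^sup>2"
            using AE_arc_measure_circle
          proof eventually_elim
            case (elim y)
            show ?case
            proof (cases "y \<in> V n")
              case True
              then obtain j e where j: "y \<in> Arc (N n) j" "e \<in> Arc (N n) j" "e \<in> E" by (auto simp: V_def J_def)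
              have "cmod (x - e) \<ge> \<rho>" using \<rho>(2) j(3) by (auto simp: dist_norm not_less[symmetric])
              moreover have "cmod (y - e) < \<rho> / 2" using Arc_diameter[OF j(1,2)] \<open>2 * pi / real (N n) < \<rho> / 2\<close> by linarith
              moreover have "cmod (x - e) \<le> cmod (x - y) + cmod (y - e)" using norm_triangle_ineq[of "x - y" "y - e"] by simp
              moreover have "cmod (x - y) \<le> 2 * cmod (1 - z * y)"
                unfolding z_def by (rule norm_diff_le_double_kernel) (use x elim r[of n] in auto)
              ultimately have "\<rho> / 4 \<le> cmod (1 - z * y)" by linarith
              then have "(\<rho> / 4)\<^sup>2 \<le> (cmod (1 - z * y))\<^sup>2" using \<rho> by (intro power_mono) auto
              moreover have "4 * pi * cmod z \<le> 4 * pi" using z by simp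
              ultimately have "4 * pi * cmod z / (cmod (1 - z * y))\<^sup>2 \<le> 4 * pi / (\<rho> / 4)\<^sup>2"
                using \<rho> by (intro frac_le) auto
              also have "\<dots> = 64 * pi / \<rho>\<^sup>2" by (simp add: power_divide)
              finally show ?thesis using True by simp
            qed simp
          qed
        qed auto
        also have "\<dots> = 64 * pi / \<rho>\<^sup>2" by simp
        finally have "cmod (herglotz (\<phi> n) z) \<le> 2 * A n / real (N n) * (64 * pi / \<rho>\<^sup>2)"
          using key[OF z, of n] AN0[of n] by (meson mult_left_mono order_trans)
        also have "\<dots> = 16 / \<rho>\<^sup>2 * \<delta> n" by (simp add: \<delta>_def mult_ac)
        finally show ?case by (simp add: z_def)
      qed
    qed
    then have "(\<lambda>n. cmod (exp (herglotz (\<phi> n) (of_real (r n) * cnj x)) - 1)) \<longlonglongrightarrow> cmod (exp 0 - 1)"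
      by (intro tendsto_intros)
    then show ?thesis by (simp add: h_def outer_fun_def)
  qed
  have EV: "AE x in arc_measure. x \<in> E \<longrightarrow> x \<in> V n" for n
    using AE_in_some_Arc[OF Nge[of n]] by eventually_elim (auto simp: V_def J_def)
  show ?thesis
  proof (rule vanishing_by_outer_funs[OF finite_circle_measure_arc_measure g Eb decay, where c'="c/2" and K="exp 1" and \<phi>=\<phi> and r=r and e="\<lambda>n. 2 * \<delta> n"])
    show "integrable arc_measure (\<phi> n)" for n by (rule \<phi>i)
    show "0 < r n" "r n < 1" for n by (rule r)+
    show "0 \<le> c / 2" "c / 2 < c" using c by auto
    show "cmod (taylor_coeff (outer_fun (r n) (\<phi> n)) j) \<le> exp 1 * exp (c / 2 * sqrt (real j))" for n j
    proof -
      have "cmod (taylor_coeff (outer_fun (r n) (\<phi> n)) j) \<le> exp 1 * exp (3 * sqrt (\<delta> n) * sqrt (real j))"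
        using \<delta>le[of n] \<delta>0 by (intro taylor_coeff_outer_fun_bound \<phi>i r \<delta>pos bd) auto
      also have "\<dots> \<le> exp 1 * exp (c / 2 * sqrt (real j))"
      proof -
        have "sqrt (\<delta> n) \<le> c / 6" using real_sqrt_le_mono[OF \<delta>le[of n]] s\<delta>0 by linarith
        then have "3 * sqrt (\<delta> n) * sqrt (real j) \<le> c / 2 * sqrt (real j)" by (intro mult_right_mono) auto
        then show ?thesis by simp
      qed
      finally show ?thesis .
    qed
    show "cmod (herglotz (\<phi> n) (of_real (r n) * u)) \<le> 2 * \<delta> n" if "cmod u = 1 / 2" for n u
    proof -
      have ru: "cmod (of_real (r n) * u) \<le> 1 / 2" using that r[of n] by (simp only: norm_mult norm_of_real)
      then have "cmod (herglotz (\<phi> n) (of_real (r n) * u)) \<le> \<delta> n / (1 - cmod (of_real (r n) * u))" by (intro bd) auto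
      also have "\<dots> \<le> \<delta> n / (1 / 2)" using ru \<delta>pos[of n] by (intro divide_left_mono mult_pos_pos) auto
      finally show ?thesis by simp
    qed
    show "(\<lambda>n. 2 * \<delta> n) \<longlonglongrightarrow> 0" using \<delta>lim by (rule tendsto_mult_right_zero)
    \<comment> \<open>Almost every point of \<open>E\<close> lies in some arc of \<open>V n\<close>,
      where \<open>exp (\<phi> n)\<close> times \<open>\<bar>g\<bar>\<close> is at most
      \<open>exp (- A n) * W\<close>; the passage from \<open>exp (\<phi> n)\<close> to
      \<open>h n\<close> costs \<open>D n\<close>.\<close>
    have "(\<lambda>n. \<integral>x. indicator E x * (cmod (h n x) * w x) \<partial>arc_measure) \<longlonglongrightarrow> 0"
    proof (rule Lim_null_comparison)
      have "(\<lambda>n. exp (- A n) * (\<integral>x. W x \<partial>arc_measure)) \<longlonglongrightarrow> 0" unfolding A_def by (rule tendsto_mult_left_zero) real_asymp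
      from tendsto_add[OF Dlim this]
      show "(\<lambda>n. (\<integral>x. D n x \<partial>arc_measure) + exp (- A n) * (\<integral>x. W x \<partial>arc_measure)) \<longlonglongrightarrow> 0" by simp
      show "\<forall>\<^sub>F n in sequentially. norm (\<integral>x. indicator E x * (cmod (h n x) * w x) \<partial>arc_measure)
          \<le> (\<integral>x. D n x \<partial>arc_measure) + exp (- A n) * (\<integral>x. W x \<partial>arc_measure)"
      proof (intro always_eventually allI)
        fix n
        have "(\<integral>x. indicator E x * (cmod (h n x) * w x) \<partial>arc_measure) \<le> (\<integral>x. D n x + exp (- A n) * W x \<partial>arc_measure)"
        proof (rule integral_mono_AE')
          show "integrable arc_measure (\<lambda>x. D n x + exp (- A n) * W x)" using Di Wi by simp
          show "AE x in arc_measure. indicator E x * (cmod (h n x) * w x) \<le> D n x + exp (- A n) * W x"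
            using EV[of n]
          proof eventually_elim
            case (elim x)
            show ?case
            proof (cases "x \<in> E")
              case True
              then show ?thesis using hle[of n x] e\<phi>V[of x n] elim by simp
            qed (use D0 Ww in \<open>auto intro!: add_nonneg_nonneg\<close>)
          qed
          show "AE x in arc_measure. 0 \<le> D n x + exp (- A n) * W x"
            using D0 Ww by (intro AE_I2 add_nonneg_nonneg mult_nonneg_nonneg) auto
        qed
        also have "\<dots> = (\<integral>x. D n x \<partial>arc_measure) + exp (- A n) * (\<integral>x. W x \<partial>arc_measure)"
          using Di Wi by simp
        finally show "norm (\<integral>x. indicator E x * (cmod (h n x) * w x) \<partial>arc_measure)
          \<le> (\<integral>x. D n x \<partial>arc_measure) + exp (- A n) * (\<integral>x. W x \<partial>arc_measure)"
          using w0 by (simp add: integral_nonneg_AE)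
      qed
    qed
    then show "(\<lambda>n. \<integral>x. indicator E x * (cmod (outer_fun (r n) (\<phi> n) (cnj x)) * cmod (g x)) \<partial>arc_measure) \<longlonglongrightarrow> 0"
      by (simp add: h_def w_def)
    \<comment> \<open>The functions \<open>D n\<close> tend to zero in \<open>L1\<close> but have no
      evident common majorant, so dominated convergence is not applied to the integrand itself.
      Subtracting \<open>D n\<close> and cutting at 0 leaves functions bounded by
      \<open>2 * W\<close>; the subtracted part is restored afterwards.\<close>
    define G where "G n x = max 0 (indicator (- E) x * (cmod (h n x - 1) * w x) - D n x)" for n x
    have Glim: "(\<lambda>n. \<integral>x. G n x \<partial>arc_measure) \<longlonglongrightarrow> (\<integral>x. 0 \<partial>arc_measure)"
      and Gi: "\<And>n. integrable arc_measure (G n)"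
    proof -
      have Gb: "norm (G n x) \<le> 2 * W x" for n x
      proof -
        have "cmod (h n x - 1) * w x \<le> (cmod (h n x) + 1) * w x"
          using norm_triangle_ineq4[of "h n x" 1] w0 by (intro mult_right_mono) auto
        also have "\<dots> \<le> D n x + 2 * W x" using hle[of n x] e\<phi>[of n x] Ww[of x] by (simp add: distrib_right)
        finally have "indicator (- E) x * (cmod (h n x - 1) * w x) - D n x \<le> 2 * W x"
          using D0[of n x] Ww[of x] by (auto simp: indicator_def)
        then show ?thesis using Ww[of x] by (simp add: G_def)
      qed
      have [measurable]: "G n \<in> borel_measurable borel" for n unfolding G_def by measurable
      have W2: "integrable arc_measure (\<lambda>x. 2 * W x)" using Wi by simp
      show "integrable arc_measure (G n)" for n
        by (rule Bochner_Integration.integrable_bound[OF W2]) (use Gb Ww in auto)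
      show "(\<lambda>n. \<integral>x. G n x \<partial>arc_measure) \<longlonglongrightarrow> (\<integral>x. 0 \<partial>arc_measure)"
      proof (rule integral_dominated_convergence[OF _ _ W2])
        show "AE x in arc_measure. (\<lambda>n. G n x) \<longlonglongrightarrow> 0"
          using AE_arc_measure_circle
        proof eventually_elim
          case (elim x)
          show ?case
          proof (cases "x \<in> E")
            case True
            then have "G n x = 0" for n using D0[of n x] by (simp add: G_def)
            then show ?thesis by simp
          next
            case False
            show ?thesis
            proof (rule Lim_null_comparison)
              show "(\<lambda>n. cmod (h n x - 1) * w x) \<longlonglongrightarrow> 0" using hconv[OF elim False] by (rule tendsto_mult_left_zero)
              show "\<forall>\<^sub>F n in sequentially. norm (G n x) \<le> cmod (h n x - 1) * w x"
                using D0 w0[of x] by (intro always_eventually allI) (simp add: G_def False)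
            qed
          qed
        qed
      qed (use Gb in auto)
    qed
    have "(\<lambda>n. \<integral>x. indicator (- E) x * (cmod (h n x - 1) * w x) \<partial>arc_measure) \<longlonglongrightarrow> 0"
    proof (rule Lim_null_comparison)
      show "(\<lambda>n. (\<integral>x. G n x \<partial>arc_measure) + (\<integral>x. D n x \<partial>arc_measure)) \<longlonglongrightarrow> 0"
        using tendsto_add[OF Glim Dlim] by simp
      show "\<forall>\<^sub>F n in sequentially. norm (\<integral>x. indicator (- E) x * (cmod (h n x - 1) * w x) \<partial>arc_measure)
         \<le> (\<integral>x. G n x \<partial>arc_measure) + (\<integral>x. D n x \<partial>arc_measure)"
      proof (intro always_eventually allI)
        fix n
        have "(\<integral>x. indicator (- E) x * (cmod (h n x - 1) * w x) \<partial>arc_measure) \<le> (\<integral>x. G n x + D n x \<partial>arc_measure)"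
        proof (rule integral_mono_AE')
          show "integrable arc_measure (\<lambda>x. G n x + D n x)" using Gi Di by simp
          show "AE x in arc_measure. indicator (- E) x * (cmod (h n x - 1) * w x) \<le> G n x + D n x"
            by (rule AE_I2) (simp add: G_def)
          show "AE x in arc_measure. 0 \<le> G n x + D n x"
            using D0 by (intro AE_I2 add_nonneg_nonneg) (auto simp: G_def)
        qed
        also have "\<dots> = (\<integral>x. G n x \<partial>arc_measure) + (\<integral>x. D n x \<partial>arc_measure)" using Gi Di by simp
        finally show "norm (\<integral>x. indicator (- E) x * (cmod (h n x - 1) * w x) \<partial>arc_measure)
         \<le> (\<integral>x. G n x \<partial>arc_measure) + (\<integral>x. D n x \<partial>arc_measure)"
          using w0 by (simp add: integral_nonneg_AE)
      qed
    qed
    then show "(\<lambda>n. \<integral>x. indicator (- E) x * (cmod (outer_fun (r n) (\<phi> n) (cnj x) - 1) * cmod (g x)) \<partial>arc_measure) \<longlonglongrightarrow> 0"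
      by (simp add: h_def w_def)
  qed
qed

section \<open>Decomposition of complex measures\<close>

lemma exists_dominating_measure:
  assumes M1: "finite_circle_measure M1" and M2: "finite_circle_measure M2"
  shows "\<exists>M. finite_circle_measure M \<and> absolutely_continuous M M1 \<and> absolutely_continuous M M2"
proof -
  note s1 = finite_circle_measureD[OF M1] and s2 = finite_circle_measureD[OF M2]
  interpret M1: finite_measure M1 by (rule s1)
  interpret M2: finite_measure M2 by (rule s2)
  define M where "M = measure_of UNIV (sets borel) (\<lambda>A. emeasure M1 A + emeasure M2 A)"
  have sM: "sets M = sets borel" unfolding M_def using sets.sigma_sets_eq[of "borel :: complex measure"]
    by (simp add: sets_measure_of)
  have em: "emeasure M A = emeasure M1 A + emeasure M2 A" if A: "A \<in> sets borel" for A
  proof (rule emeasure_measure_of[OF M_def])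
    show "A \<in> sets M" using A sM by simp
    show "positive (sets M) (\<lambda>A. emeasure M1 A + emeasure M2 A)" by (simp add: positive_def)
    show "countably_additive (sets M) (\<lambda>A. emeasure M1 A + emeasure M2 A)"
    proof (rule countably_additiveI)
      fix F :: "nat \<Rightarrow> complex set" assume F: "range F \<subseteq> sets M" "disjoint_family F"
      have "range F \<subseteq> sets M1" "range F \<subseteq> sets M2" using F(1) sM s1(1) s2(1) by auto
      then show "(\<Sum>i. emeasure M1 (F i) + emeasure M2 (F i)) = emeasure M1 (\<Union>(range F)) + emeasure M2 (\<Union>(range F))"
        using F(2) by (simp add: suminf_add[symmetric] suminf_emeasure)
    qed
  qed simp
  have spM: "space M = UNIV" using sets_eq_imp_space_eq[OF sM] by simp
  have "finite_circle_measure M"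
    unfolding finite_circle_measure_def
  proof (intro conjI sM)
    show "finite_measure M"
      by (rule finite_measureI) (use em[of UNIV] spM s1(2) s2(2) M1.emeasure_finite M2.emeasure_finite in auto)
    show "emeasure M (- circle) = 0"
      using em[of "- circle"] M1 M2 by (simp add: finite_circle_measure_def)
  qed
  moreover have "absolutely_continuous M M1" "absolutely_continuous M M2"
    using em sM s1(1) s2(1) by (auto simp: absolutely_continuous_def null_sets_def)
  ultimately show ?thesis by blast
qed

lemma finite_circle_measure_density:
  assumes M: "finite_circle_measure M" and N: "finite_circle_measure N" and ac: "absolutely_continuous M N"
  obtains d :: "complex \<Rightarrow> real" where "integrable M d" "\<And>x. 0 \<le> d x" "N = density M (\<lambda>x. ennreal (d x))"
proof -
  note sM = finite_circle_measureD[OF M] and sN = finite_circle_measureD[OF N]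
  interpret M: finite_measure M by (rule sM)
  interpret N: finite_measure N by (rule sN)
  have sets: "sets N = sets M" using sM sN by simp
  obtain D where D: "D \<in> borel_measurable M" "AE x in M. RN_deriv M N x = ennreal (D x)" "\<And>x. 0 \<le> D x"
    using M.real_RN_deriv[OF sN(3) ac sets] by metis
  have "N = density M (RN_deriv M N)" using M.density_RN_deriv[OF ac sets] by simp
  also have "\<dots> = density M (\<lambda>x. ennreal (D x))" using D by (intro density_cong) auto
  finally have eq: "N = density M (\<lambda>x. ennreal (D x))" .
  have "(\<integral>\<^sup>+x. ennreal (D x) \<partial>M) = emeasure N UNIV"
    unfolding eq using D(1) sM by (subst emeasure_density) auto
  also have "\<dots> < \<infinity>" using N.emeasure_finite by (simp add: less_top[symmetric])
  finally have "integrable M D" using D by (intro integrableI_nonneg) auto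
  then show ?thesis using that D eq by blast
qed

text \<open>A single measure \<open>M\<close> dominates the four parts and also arc length. Writing
  arc length as a density \<open>d\<close> over \<open>M\<close> makes the singular part of the
  complex measure visible: it is what \<open>q\<close> carries on the zero set of
  \<open>d\<close>.\<close>

lemma cmeas_as_density:
  assumes \<mu>: "finite_circle_measure \<mu>1" "finite_circle_measure \<mu>2" "finite_circle_measure \<mu>3" "finite_circle_measure \<mu>4"
  obtains M q d where "finite_circle_measure M" "integrable M (q :: complex \<Rightarrow> complex)"
    "integrable M (d :: complex \<Rightarrow> real)" "\<And>x. 0 \<le> d x" "arc_measure = density M (\<lambda>x. ennreal (d x))"
    "\<And>n. fourier_coeff \<mu>1 \<mu>2 \<mu>3 \<mu>4 n = (\<integral>x. cnj x ^ n * q x \<partial>M)"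
    "\<And>A. A \<in> sets borel \<Longrightarrow> cmeas_val \<mu>1 \<mu>2 \<mu>3 \<mu>4 A = (\<integral>x. of_real (indicator A x) * q x \<partial>M)"
proof -
  obtain M12 where M12: "finite_circle_measure M12" "absolutely_continuous M12 \<mu>1" "absolutely_continuous M12 \<mu>2"
    using exists_dominating_measure[OF \<mu>(1,2)] by blast
  obtain M34 where M34: "finite_circle_measure M34" "absolutely_continuous M34 \<mu>3" "absolutely_continuous M34 \<mu>4"
    using exists_dominating_measure[OF \<mu>(3,4)] by blast
  obtain M14 where M14: "finite_circle_measure M14" "absolutely_continuous M14 M12" "absolutely_continuous M14 M34"
    using exists_dominating_measure[OF M12(1) M34(1)] by blast
  obtain M where M: "finite_circle_measure M" "absolutely_continuous M M14" "absolutely_continuous M arc_measure"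
    using exists_dominating_measure[OF M14(1) finite_circle_measure_arc_measure] by blast
  have ac: "absolutely_continuous M \<mu>1" "absolutely_continuous M \<mu>2" "absolutely_continuous M \<mu>3" "absolutely_continuous M \<mu>4"
    using M(2) M14(2,3) M12(2,3) M34(2,3) unfolding absolutely_continuous_def by (meson subset_trans)+
  note [measurable_cong] = finite_circle_measureD(1)[OF M(1)]
  obtain d1 where d1: "integrable M d1" "\<And>x. 0 \<le> d1 x" "\<mu>1 = density M (\<lambda>x. ennreal (d1 x))"
    by (rule finite_circle_measure_density[OF M(1) \<mu>(1) ac(1)]) blast
  obtain d2 where d2: "integrable M d2" "\<And>x. 0 \<le> d2 x" "\<mu>2 = density M (\<lambda>x. ennreal (d2 x))"
    by (rule finite_circle_measure_density[OF M(1) \<mu>(2) ac(2)]) blast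
  obtain d3 where d3: "integrable M d3" "\<And>x. 0 \<le> d3 x" "\<mu>3 = density M (\<lambda>x. ennreal (d3 x))"
    by (rule finite_circle_measure_density[OF M(1) \<mu>(3) ac(3)]) blast
  obtain d4 where d4: "integrable M d4" "\<And>x. 0 \<le> d4 x" "\<mu>4 = density M (\<lambda>x. ennreal (d4 x))"
    by (rule finite_circle_measure_density[OF M(1) \<mu>(4) ac(4)]) blast
  obtain d where d: "integrable M d" "\<And>x. 0 \<le> d x" "arc_measure = density M (\<lambda>x. ennreal (d x))"
    by (rule finite_circle_measure_density[OF M(1) finite_circle_measure_arc_measure M(3)]) blast
  define q where "q x = (of_real (d1 x) - of_real (d2 x)) + \<i> * (of_real (d3 x) - of_real (d4 x))" for x
  have q: "integrable M q" unfolding q_def using d1(1) d2(1) d3(1) d4(1) by simp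
  have one: "integral\<^sup>L \<mu> f = (\<integral>x. f x * of_real (e x) \<partial>M)" and onei: "integrable M (\<lambda>x. f x * of_real (e x))"
    if "\<mu> = density M (\<lambda>x. ennreal (e x))" "integrable M e" "\<And>x. 0 \<le> e x" and [measurable]: "f \<in> borel_measurable borel"
      and "\<And>x. cmod x = 1 \<Longrightarrow> cmod (f x) \<le> 1"
    for \<mu> e and f :: "complex \<Rightarrow> complex"
  proof -
    show "integrable M (\<lambda>x. f x * of_real (e x))"
      using integrable_of_real[OF that(2)] that(4,5)
      by (rule integrable_mult_bounded_on_circle[OF M(1)])
    have "integral\<^sup>L \<mu> f = (\<integral>x. e x *\<^sub>R f x \<partial>M)"
      unfolding that(1) using that(2,3) by (intro integral_density) auto
    then show "integral\<^sup>L \<mu> f = (\<integral>x. f x * of_real (e x) \<partial>M)"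
      by (simp add: scaleR_conv_of_real mult.commute)
  qed
  have ci: "cmeas_integral \<mu>1 \<mu>2 \<mu>3 \<mu>4 f = (\<integral>x. f x * q x \<partial>M)"
    if f: "f \<in> borel_measurable borel" "\<And>x. cmod x = 1 \<Longrightarrow> cmod (f x) \<le> 1" for f
  proof -
    note i = onei[OF d1(3,1,2) f] onei[OF d2(3,1,2) f] onei[OF d3(3,1,2) f] onei[OF d4(3,1,2) f]
    have "(\<integral>x. f x * q x \<partial>M) = (\<integral>x. (f x * of_real (d1 x) - f x * of_real (d2 x)) + \<i> * (f x * of_real (d3 x) - f x * of_real (d4 x)) \<partial>M)"
      by (simp add: q_def algebra_simps)
    also have "\<dots> = cmeas_integral \<mu>1 \<mu>2 \<mu>3 \<mu>4 f"
      using i one[OF d1(3,1,2) f] one[OF d2(3,1,2) f] one[OF d3(3,1,2) f] one[OF d4(3,1,2) f]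
      by (simp add: cmeas_integral_def)
    finally show ?thesis by simp
  qed
  show ?thesis
  proof
    show "fourier_coeff \<mu>1 \<mu>2 \<mu>3 \<mu>4 n = (\<integral>x. cnj x ^ n * q x \<partial>M)" for n
      unfolding fourier_coeff_def by (rule ci) (auto simp: norm_power)
    show "cmeas_val \<mu>1 \<mu>2 \<mu>3 \<mu>4 A = (\<integral>x. of_real (indicator A x) * q x \<partial>M)" if [measurable]: "A \<in> sets borel" for A
    proof -
      have "(\<integral>x. complex_of_real (indicator A x) \<partial>\<mu>) = of_real (measure \<mu> A)" if "finite_circle_measure \<mu>" for \<mu>
        using finite_circle_measureD(2)[OF that] by (subst integral_complex_of_real) simp
      then have "cmeas_val \<mu>1 \<mu>2 \<mu>3 \<mu>4 A = cmeas_integral \<mu>1 \<mu>2 \<mu>3 \<mu>4 (\<lambda>x. of_real (indicator A x))"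
        using \<mu> by (simp add: cmeas_val_def cmeas_integral_def)
      also have "\<dots> = (\<integral>x. of_real (indicator A x) * q x \<partial>M)"
        by (rule ci) (auto simp: indicator_def)
      finally show ?thesis .
    qed
  qed (use M(1) q d in auto)
qed

theorem cmeas_absolutely_continuous:
  assumes \<mu>: "finite_circle_measure \<mu>1" "finite_circle_measure \<mu>2" "finite_circle_measure \<mu>3" "finite_circle_measure \<mu>4"
    and c: "c > 0"
    and decay: "\<And>n. cmod (fourier_coeff \<mu>1 \<mu>2 \<mu>3 \<mu>4 n) \<le> B * exp (- c * sqrt (real n))"
  obtains g where "integrable arc_measure g"
    "\<And>A. A \<in> sets borel \<Longrightarrow> cmeas_val \<mu>1 \<mu>2 \<mu>3 \<mu>4 A = (LINT x:A|arc_measure. g x)"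
    "\<And>n. (\<integral>x. cnj x ^ n * g x \<partial>arc_measure) = fourier_coeff \<mu>1 \<mu>2 \<mu>3 \<mu>4 n"
proof -
  obtain M q d where M: "finite_circle_measure M" and q: "integrable M (q :: complex \<Rightarrow> complex)"
    and d: "integrable M (d :: complex \<Rightarrow> real)" "\<And>x. 0 \<le> d x" "arc_measure = density M (\<lambda>x. ennreal (d x))"
    and fc: "\<And>n. fourier_coeff \<mu>1 \<mu>2 \<mu>3 \<mu>4 n = (\<integral>x. cnj x ^ n * q x \<partial>M)"
    and cv: "\<And>A. A \<in> sets borel \<Longrightarrow> cmeas_val \<mu>1 \<mu>2 \<mu>3 \<mu>4 A = (\<integral>x. of_real (indicator A x) * q x \<partial>M)"
    by (rule cmeas_as_density[OF \<mu>]) blast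
  note sM[measurable_cong] = finite_circle_measureD(1)[OF M]
  have spM: "space M = UNIV" by (rule finite_circle_measureD(2)[OF M])
  have [measurable]: "d \<in> borel_measurable borel" "q \<in> borel_measurable borel"
    using d(1) q by (auto dest!: borel_measurable_integrable simp: measurable_cong_sets[OF sM refl])
  \<comment> \<open>\<open>S\<close> is null for arc length, and off \<open>S\<close> every
    arc-length null set is null for \<open>M\<close>. These are the two requirements for concluding
    that \<open>q\<close> vanishes on \<open>S\<close>, after which \<open>q / d\<close> is the
    density with respect to arc length.\<close>
  define S where "S = {x. d x = 0}"
  have [measurable]: "S \<in> sets borel" unfolding S_def by measurable
  have null: "X \<in> null_sets arc_measure \<longleftrightarrow> X \<in> sets borel \<and> (AE x in M. x \<in> X \<longrightarrow> d x = 0)" for X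
    unfolding d(3) using d(2) sM
    by (subst null_sets_density_iff) (auto simp: ennreal_eq_0_iff order_antisym_conv intro!: AE_cong)
  have q0: "AE x in M. x \<in> S \<longrightarrow> q x = 0"
  proof (rule vanishing_on_null_set[OF M q _ decay[unfolded fc] c])
    show "S \<in> null_sets arc_measure" unfolding null by (simp add: S_def)
    show "X - S \<in> null_sets M" if X: "X \<in> null_sets arc_measure" for X
    proof (subst AE_iff_null_sets)
      have [measurable]: "X \<in> sets borel" using X null by blast
      show "X - S \<in> sets M" using sM by simp
      have "AE x in M. x \<in> X \<longrightarrow> d x = 0" using X null by blast
      then show "AE x in M. x \<notin> X - S" by eventually_elim (auto simp: S_def)
    qed
  qed
  define g where "g x = (if d x = 0 then 0 else q x / of_real (d x))" for x
  have [measurable]: "g \<in> borel_measurable borel" unfolding g_def by measurable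
  have dg: "AE x in M. d x *\<^sub>R (f x * g x) = f x * q x" for f
    using q0 by eventually_elim (auto simp: g_def S_def scaleR_conv_of_real)
  have int: "(\<integral>x. f x * g x \<partial>arc_measure) = (\<integral>x. f x * q x \<partial>M)" if [measurable]: "f \<in> borel_measurable borel" for f
  proof -
    have "(\<integral>x. f x * g x \<partial>arc_measure) = (\<integral>x. d x *\<^sub>R (f x * g x) \<partial>M)"
      unfolding d(3) using d(2) by (intro integral_density) auto
    also have "\<dots> = (\<integral>x. f x * q x \<partial>M)" by (rule integral_cong_AE[OF _ _ dg]) auto
    finally show ?thesis .
  qed
  have "integrable arc_measure g"
  proof -
    have "integrable M (\<lambda>x. d x *\<^sub>R g x)"
      using dg[of "\<lambda>_. 1"] q by (subst integrable_cong_AE[of _ _ q]) auto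
    then show ?thesis unfolding d(3) using d(2) by (subst integrable_density) auto
  qed
  moreover have "cmeas_val \<mu>1 \<mu>2 \<mu>3 \<mu>4 A = (LINT x:A|arc_measure. g x)" if A[measurable]: "A \<in> sets borel" for A
  proof -
    have "(LINT x:A|arc_measure. g x) = (\<integral>x. of_real (indicator A x) * g x \<partial>arc_measure)"
      by (simp add: set_lebesgue_integral_def scaleR_conv_of_real)
    also have "\<dots> = (\<integral>x. of_real (indicator A x) * q x \<partial>M)" by (rule int) measurable
    finally show ?thesis using cv[OF A] by simp
  qed
  moreover have "(\<integral>x. cnj x ^ n * g x \<partial>arc_measure) = fourier_coeff \<mu>1 \<mu>2 \<mu>3 \<mu>4 n" for n
    unfolding fc by (rule int) measurable
  ultimately show ?thesis using that by blast
qed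

text \<open>As \<open>ln 0 = 0\<close>, integrability of \<open>ln (cmod (g y))\<close> alone would
  tolerate zeros of \<open>g\<close> on a set of positive measure; the clause that \<open>g\<close>
  is nonzero almost everywhere on \<open>I\<close> gives the integral condition its usual
  meaning.\<close>

theorem theoremC:
  fixes \<mu>1 \<mu>2 \<mu>3 \<mu>4 :: "complex measure"
  assumes "finite_circle_measure \<mu>1" "finite_circle_measure \<mu>2"
    and "finite_circle_measure \<mu>3" "finite_circle_measure \<mu>4"
    and "\<exists>c>0. \<exists>B. \<forall>n. cmod (fourier_coeff \<mu>1 \<mu>2 \<mu>3 \<mu>4 n) * exp (c * sqrt (real n)) \<le> B"
  shows "\<exists>g :: complex \<Rightarrow> complex.
           integrable arc_measure g \<and>
           (\<forall>A \<in> sets borel. cmeas_val \<mu>1 \<mu>2 \<mu>3 \<mu>4 A = (LINT x:A|arc_measure. g x)) \<and>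
           (\<exists>U. openin (top_of_set circle) U \<and>
              (U - {x \<in> circle. cmod (g x) > 0}) \<union> ({x \<in> circle. cmod (g x) > 0} - U)
                 \<in> null_sets arc_measure \<and>
              (\<forall>x\<in>U. \<exists>I. open_arc I \<and> x \<in> I \<and> I \<subseteq> U \<and>
                   (AE y in arc_measure. y \<in> I \<longrightarrow> g y \<noteq> 0) \<and>
                   set_integrable arc_measure I (\<lambda>y. ln (cmod (g y)))))"
proof -
  obtain c B where c: "c > 0" and B: "\<And>n. cmod (fourier_coeff \<mu>1 \<mu>2 \<mu>3 \<mu>4 n) * exp (c * sqrt (real n)) \<le> B"
    using assms(5) by blast
  have decay: "cmod (fourier_coeff \<mu>1 \<mu>2 \<mu>3 \<mu>4 n) \<le> B * exp (- c * sqrt (real n))" for n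
    using B[of n] by (simp add: exp_minus field_simps)
  obtain g where g: "integrable arc_measure g"
    and val: "\<And>A. A \<in> sets borel \<Longrightarrow> cmeas_val \<mu>1 \<mu>2 \<mu>3 \<mu>4 A = (LINT x:A|arc_measure. g x)"
    and fc: "\<And>n. (\<integral>x. cnj x ^ n * g x \<partial>arc_measure) = fourier_coeff \<mu>1 \<mu>2 \<mu>3 \<mu>4 n"
    by (rule cmeas_absolutely_continuous[OF assms(1-4) c decay]) blast
  have [measurable]: "g \<in> borel_measurable borel" using g by (auto dest: borel_measurable_integrable)
  define good where "good I \<longleftrightarrow> open_arc I \<and> (AE y in arc_measure. y \<in> I \<longrightarrow> g y \<noteq> 0) \<and>
      set_integrable arc_measure I (\<lambda>y. ln (cmod (g y)))" for I
  define U where "U = \<Union>{I. good I}"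
  have arc_open: "openin (top_of_set circle) I" if "good I" for I
    using that open_arc_eq_Int_open[of I] by (metis good_def openin_open)
  have U: "openin (top_of_set circle) U" unfolding U_def using arc_open by (intro openin_Union) auto
  then obtain W where W: "open W" "U = circle \<inter> W" by (auto simp: openin_open)
  have [measurable]: "U \<in> sets borel" using W by auto
  have E: "closed (circle - U)"
  proof -
    have "circle - U = circle - W" using W by auto
    then show ?thesis using W by (simp add: closed_Diff)
  qed
  have gE: "AE x in arc_measure. x \<in> circle - U \<longrightarrow> g x = 0"
  proof (rule vanishing_off_log_integrable_arcs[OF g decay[folded fc] c E])
    fix I assume "open_arc I" "I \<inter> (circle - U) \<noteq> {}"
    then show "\<not> ((AE y in arc_measure. y \<in> I \<longrightarrow> g y \<noteq> 0) \<and> set_integrable arc_measure I (\<lambda>y. ln (cmod (g y))))"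
      unfolding U_def good_def by blast
  qed
  \<comment> \<open>\<open>U\<close> is a union of possibly uncountably many arcs. A countable
    subfamily already covers it, so the exceptional null sets of the single arcs add up to a null
    set.\<close>
  obtain F where F: "F \<subseteq> {I. good I}" "countable F" "\<Union>F = U"
    using Lindelof_openin[of "{I. good I}" circle] arc_open unfolding U_def by (metis mem_Collect_eq)
  have "AE y in arc_measure. \<forall>I\<in>F. y \<in> I \<longrightarrow> g y \<noteq> 0"
    using F by (subst AE_ball_countable) (auto simp: good_def)
  then have gU: "AE y in arc_measure. y \<in> U \<longrightarrow> g y \<noteq> 0"
    by eventually_elim (use F in blast)
  let ?P = "{x \<in> circle. cmod (g x) > 0}"
  have "(U - ?P) \<union> (?P - U) \<in> null_sets arc_measure"
  proof (subst AE_iff_null_sets)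
    have "?P = circle \<inter> {x. cmod (g x) > 0}" by auto
    also have "\<dots> \<in> sets borel" by measurable
    finally show "(U - ?P) \<union> (?P - U) \<in> sets arc_measure" by simp
    show "AE x in arc_measure. x \<notin> (U - ?P) \<union> (?P - U)"
      using gE gU AE_arc_measure_circle by eventually_elim auto
  qed
  moreover have "\<exists>I. open_arc I \<and> x \<in> I \<and> I \<subseteq> U \<and> (AE y in arc_measure. y \<in> I \<longrightarrow> g y \<noteq> 0) \<and>
      set_integrable arc_measure I (\<lambda>y. ln (cmod (g y)))" if "x \<in> U" for x
    using that unfolding U_def good_def by blast
  ultimately show ?thesis using g val U by blast
qed

end
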